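(* Let $G$ be either (i) a symmetric subgroup of $\mathrm{GL}_m(\mathbb{C})\times\mathrm{GL}_n(\mathbb{C})$ with $T_m(\mathbb{C})\times T_n(\mathbb{C})\le G$, or (ii) a symmetric subgroup of $\mathrm{GL}_m(\mathbb{C})$ with $T_m(\mathbb{C})\le G$ (in this case write $Y=I_n$ below). Let $A\in\mathbb{C}^{m\times n}$ and $B\in\mathbb{C}^{n\times m}$ be nonzero, let $\kappa_F(A',B')=\|A'\|_F\|B'\|_F$, let $\kappa_F^\star=\inf_{(X,Y)\in G}\kappa_F(XAY^{-1},YBX^{-1})$, and let $C_{A,B}(K(X,Y))=\log\|XAY^{-1}\|_F+\log\|YBX^{-1}\|_F$. Consider the gradient descent iteration $(X_0,Y_0)=(I_m,I_n)$, $(X_{k+1},Y_{k+1})=(e^{-\eta H_k}X_k,e^{-\eta H'_k}Y_k)$ with $(H_k,H_k')=\nabla C_{A,B}(K(X_k,Y_k))$ and $\eta=1/8$. There is an absolute constant $c>0$ such that for every $0<\varepsilon<1/2$ and every integer $T\ge c\,\max(m^3,n^3)\log(\kappa_F(A,B)/\kappa_F^\star)/\varepsilon^2$, one has $\log\kappa_F(X_TAY_T^{-1},Y_TBX_T^{-1})-\log\kappa_F^\star<\varepsilon$.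
   Context: $T_m(\mathbb{C})$ is the group of invertible diagonal $m\times m$ matrices. A subgroup is symmetric if it is Zariski closed and closed under conjugate transposition. $K=G\cap(\mathrm{U}_m\times\mathrm{U}_n)$ (resp. $G\cap\mathrm{U}_m$); $\mathrm{Lie}(G)=\{(H_1,H_2):(e^{tH_1},e^{tH_2})\in G\ \forall t\}$; $i\mathrm{Lie}(K)$ is the set of Hermitian pairs in $\mathrm{Lie}(G)$. The gradient $\nabla f(Kg)\in i\mathrm{Lie}(K)$ of smooth $f$ on the right coset space $G/K$ is defined by $\langle\nabla f(Kg),H\rangle=\frac{d}{dt}|_{t=0}f(Ke^{tH}g)$ for all $H\in i\mathrm{Lie}(K)$, with $\langle(H_1,H_2),(H_3,H_4)\rangle=\mathrm{Re}(\mathrm{tr}(H_1^*H_3)+\mathrm{tr}(H_2^*H_4))$ and $e^{tH}(X,Y)=(e^{tH_1}X,e^{tH_2}Y)$. *)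

theory Defs
  imports "HOL-Analysis.Analysis" "Jordan_Normal_Form.Matrix"
begin

type_synonym cmat = "complex mat"

definition GL :: "nat \<Rightarrow> cmat set" where
  "GL m = {X \<in> carrier_mat m m. invertible_mat X}"

definition minv :: "cmat \<Rightarrow> cmat" where
  "minv X = (SOME Z. Z \<in> carrier_mat (dim_row X) (dim_row X) \<and> inverts_mat X Z \<and> inverts_mat Z X)"

definition cadj :: "cmat \<Rightarrow> cmat" where
  "cadj X = mat (dim_col X) (dim_row X) (\<lambda>(i,j). cnj (X $$ (j,i)))"

definition mtrace :: "cmat \<Rightarrow> complex" where
  "mtrace X = (\<Sum>i<dim_row X. X $$ (i,i))"

definition frob :: "cmat \<Rightarrow> real" where
  "frob X = sqrt (\<Sum>i<dim_row X. \<Sum>j<dim_col X. (cmod (X $$ (i,j)))^2)"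

definition mexp :: "cmat \<Rightarrow> cmat" where
  "mexp H = mat (dim_row H) (dim_col H)
      (\<lambda>(i,j). \<Sum>k. (H ^\<^sub>m k) $$ (i,j) / of_nat (fact k))"

definition torus :: "nat \<Rightarrow> cmat set" where
  "torus m = {X \<in> carrier_mat m m. diagonal_mat X \<and> (\<forall>i<m. X $$ (i,i) \<noteq> 0)}"

inductive_set polyfun2 :: "nat \<Rightarrow> nat \<Rightarrow> (cmat \<times> cmat \<Rightarrow> complex) set"
  for m n where
  const: "(\<lambda>_. c) \<in> polyfun2 m n"
| proj1: "i < m \<Longrightarrow> j < m \<Longrightarrow> (\<lambda>p. fst p $$ (i,j)) \<in> polyfun2 m n"
| proj2: "i < n \<Longrightarrow> j < n \<Longrightarrow> (\<lambda>p. snd p $$ (i,j)) \<in> polyfun2 m n"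
| add: "f \<in> polyfun2 m n \<Longrightarrow> g \<in> polyfun2 m n \<Longrightarrow> (\<lambda>p. f p + g p) \<in> polyfun2 m n"
| mult: "f \<in> polyfun2 m n \<Longrightarrow> g \<in> polyfun2 m n \<Longrightarrow> (\<lambda>p. f p * g p) \<in> polyfun2 m n"

inductive_set polyfun1 :: "nat \<Rightarrow> (cmat \<Rightarrow> complex) set"
  for m where
  const: "(\<lambda>_. c) \<in> polyfun1 m"
| proj: "i < m \<Longrightarrow> j < m \<Longrightarrow> (\<lambda>X. X $$ (i,j)) \<in> polyfun1 m"
| add: "f \<in> polyfun1 m \<Longrightarrow> g \<in> polyfun1 m \<Longrightarrow> (\<lambda>X. f X + g X) \<in> polyfun1 m"
| mult: "f \<in> polyfun1 m \<Longrightarrow> g \<in> polyfun1 m \<Longrightarrow> (\<lambda>X. f X * g X) \<in> polyfun1 m"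

definition symmetric_subgroup2 :: "nat \<Rightarrow> nat \<Rightarrow> (cmat \<times> cmat) set \<Rightarrow> bool" where
  "symmetric_subgroup2 m n G \<longleftrightarrow>
     G \<subseteq> GL m \<times> GL n \<and>
     (1\<^sub>m m, 1\<^sub>m n) \<in> G \<and>
     (\<forall>g\<in>G. \<forall>h\<in>G. (fst g * fst h, snd g * snd h) \<in> G) \<and>
     (\<forall>g\<in>G. (minv (fst g), minv (snd g)) \<in> G) \<and>
     (\<exists>P \<subseteq> polyfun2 m n. G = {g \<in> GL m \<times> GL n. \<forall>p\<in>P. p g = 0}) \<and>
     (\<forall>g\<in>G. (cadj (fst g), cadj (snd g)) \<in> G)"

definition symmetric_subgroup1 :: "nat \<Rightarrow> cmat set \<Rightarrow> bool" where
  "symmetric_subgroup1 m G \<longleftrightarrow>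
     G \<subseteq> GL m \<and>
     1\<^sub>m m \<in> G \<and>
     (\<forall>X\<in>G. \<forall>Y\<in>G. X * Y \<in> G) \<and>
     (\<forall>X\<in>G. minv X \<in> G) \<and>
     (\<exists>P \<subseteq> polyfun1 m. G = {X \<in> GL m. \<forall>p\<in>P. p X = 0}) \<and>
     (\<forall>X\<in>G. cadj X \<in> G)"

definition iLieK :: "nat \<Rightarrow> nat \<Rightarrow> (cmat \<times> cmat) set \<Rightarrow> (cmat \<times> cmat) set" where
  "iLieK m n G = {H. fst H \<in> carrier_mat m m \<and> snd H \<in> carrier_mat n n \<and>
      cadj (fst H) = fst H \<and> cadj (snd H) = snd H \<and>
      (\<forall>t::real. (mexp (of_real t \<cdot>\<^sub>m fst H), mexp (of_real t \<cdot>\<^sub>m snd H)) \<in> G)}"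

definition ip :: "cmat \<times> cmat \<Rightarrow> cmat \<times> cmat \<Rightarrow> real" where
  "ip H H' = Re (mtrace (cadj (fst H) * fst H') + mtrace (cadj (snd H) * snd H'))"

definition pexp :: "real \<Rightarrow> cmat \<times> cmat \<Rightarrow> cmat \<times> cmat \<Rightarrow> cmat \<times> cmat" where
  "pexp t H g = (mexp (of_real t \<cdot>\<^sub>m fst H) * fst g, mexp (of_real t \<cdot>\<^sub>m snd H) * snd g)"

text \<open>Gradient of F (a function of g that is constant on cosets Kg) at Kg.\<close>
definition grad :: "nat \<Rightarrow> nat \<Rightarrow> (cmat \<times> cmat) set \<Rightarrow> (cmat \<times> cmat \<Rightarrow> real)
    \<Rightarrow> cmat \<times> cmat \<Rightarrow> cmat \<times> cmat" where
  "grad m n G F g = (THE V. V \<in> iLieK m n G \<and>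
      (\<forall>H\<in>iLieK m n G. ((\<lambda>t. F (pexp t H g)) has_real_derivative ip V H) (at 0)))"

definition kappaF :: "cmat \<Rightarrow> cmat \<Rightarrow> real" where
  "kappaF A B = frob A * frob B"

definition costAB :: "cmat \<Rightarrow> cmat \<Rightarrow> cmat \<times> cmat \<Rightarrow> real" where
  "costAB A B g = ln (frob (fst g * A * minv (snd g))) + ln (frob (snd g * B * minv (fst g)))"

definition kappa_star :: "(cmat \<times> cmat) set \<Rightarrow> cmat \<Rightarrow> cmat \<Rightarrow> real" where
  "kappa_star G A B = (INF g\<in>G. kappaF (fst g * A * minv (snd g)) (snd g * B * minv (fst g)))"

fun gd_iter :: "nat \<Rightarrow> nat \<Rightarrow> (cmat \<times> cmat) set \<Rightarrow> cmat \<Rightarrow> cmat \<Rightarrow> real \<Rightarrow> nat \<Rightarrow> cmat \<times> cmat" where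
  "gd_iter m n G A B \<eta> 0 = (1\<^sub>m m, 1\<^sub>m n)"
| "gd_iter m n G A B \<eta> (Suc k) =
     (let g = gd_iter m n G A B \<eta> k; V = grad m n G (costAB A B) g
      in pexp (- \<eta>) V g)"

end

(* The gradient at a point with current matrices A, B consists of the Hermitian matrices
   AA*/|A|^2 - B*B/|B|^2 and BB*/|B|^2 - A*A/|A|^2, restricted to the entries allowed by G, and a
   step of size 1/8 lowers the cost by at least |gradient|^2/32.  Because G contains the torus, the
   unitaries of the spectral decompositions of X*X and Y*Y can be chosen in K.  In these bases the
   squared entries of A and B are unit flows on a bipartite digraph, whose divergences are the diagonal
   entries of the gradient.  Up to the mass of an acyclic flow, which is at most (m+n)^(3/2) times the
   norm of the divergence, the flows form a circulation, and AM-GM on a circulation shows that scaling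
   cannot decrease the product of the norms by a fraction of more than half that mass.  A gap of eps to the infimum thus
   forces |gradient|^2 > eps^2/(m+n)^3, so the cost drops by a fixed amount while the gap persists. *)
theory Submission
  imports Defs "Jordan_Normal_Form.Determinant"
begin

section \<open>Flows\<close>

text \<open>The algebraic obstacle is case (i): \<open>G\<close> may contain a pair of permutation
  matrices without containing either of them paired with the identity, so X and Y cannot be treated
  as elements of two separate groups. What survives is that, for (X, Y) in \<open>G\<close>, X
  normalises the slice of all Z with (Z, 1) in \<open>G\<close>. Conjugating torus elements by a
  normalising matrix and rescaling by the torus turns nonzero entries into transvections of the
  slice. Applied to X*X, this shows that its nonzero entries sit at pairs of indices whose
  transvections all lie in the slice. The spectral theorem is then proved inside the slice by
  rotations that are products of transvections and diagonal matrices, and the diagonalising unitary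
  belongs to the group by construction. The analytic estimate compares the current point directly
  with every other point of its orbit, so the infimum need not be attained. The step size is tied to
  the squared gradient norm being at most 8: every difference of eigenvalues of the two gradient
  components is then at most 4, and a step changes the squared entries by factors exp(u) with u in
  [-1, 1].\<close>

lemma walk_weights:
  fixes E :: "('a \<times> 'a) set"
  assumes "finite V" and "E \<subseteq> V \<times> V" and "(a, b) \<in> E\<^sup>+"
  shows "\<exists>w :: 'a \<Rightarrow> 'a \<Rightarrow> real. (\<forall>u v. 0 \<le> w u v) \<and> (\<forall>u v. w u v > 0 \<longrightarrow> (u, v) \<in> E) \<and>
    (\<exists>u v. w u v > 0) \<and>
    (\<forall>x\<in>V. (\<Sum>u\<in>V. w x u) - (\<Sum>u\<in>V. w u x) = of_bool (x = a) - of_bool (x = b))"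
  using assms(3)
proof (induction rule: trancl_induct)
  case (base b)
  then have V: "a \<in> V" "b \<in> V" using assms(2) by auto
  show ?case
  proof (intro exI[of _ "\<lambda>u v. of_bool (u = a \<and> v = b)"] conjI allI ballI)
    fix x
    have "(\<Sum>u\<in>V. of_bool (x = a \<and> u = b)) = (of_bool (x = a) :: real)"
      using V assms(1) by (cases "x = a") (simp_all add: of_bool_def)
    moreover have "(\<Sum>u\<in>V. of_bool (u = a \<and> x = b)) = (of_bool (x = b) :: real)"
      using V assms(1) by (cases "x = b") (simp_all add: of_bool_def)
    ultimately show "(\<Sum>u\<in>V. of_bool (x = a \<and> u = b)) - (\<Sum>u\<in>V. of_bool (u = a \<and> x = b)) =
        (of_bool (x = a) - of_bool (x = b) :: real)" by simp
  qed (use base in auto)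
next
  case (step b c)
  then obtain w :: "'a \<Rightarrow> 'a \<Rightarrow> real" where w: "\<And>u v. 0 \<le> w u v" "\<And>u v. w u v > 0 \<Longrightarrow> (u, v) \<in> E"
    "\<exists>u v. w u v > 0"
    "\<And>x. x \<in> V \<Longrightarrow> (\<Sum>u\<in>V. w x u) - (\<Sum>u\<in>V. w u x) = of_bool (x = a) - of_bool (x = b)"
    by blast
  have V: "b \<in> V" "c \<in> V" using assms(2) step by auto
  define w' where "w' = (\<lambda>u v. w u v + of_bool (u = b \<and> v = c))"
  have *: "(\<Sum>u\<in>V. w' x u) = (\<Sum>u\<in>V. w x u) + of_bool (x = b)"
    "(\<Sum>u\<in>V. w' u x) = (\<Sum>u\<in>V. w u x) + of_bool (x = c)" if "x \<in> V" for x
  proof -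
    have "(\<Sum>u\<in>V. of_bool (x = b \<and> u = c)) = (of_bool (x = b) :: real)"
      using V assms(1) by (cases "x = b") (simp_all add: of_bool_def)
    moreover have "(\<Sum>u\<in>V. of_bool (u = b \<and> x = c)) = (of_bool (x = c) :: real)"
      using V assms(1) by (cases "x = c") (simp_all add: of_bool_def)
    ultimately show "(\<Sum>u\<in>V. w' x u) = (\<Sum>u\<in>V. w x u) + of_bool (x = b)"
      "(\<Sum>u\<in>V. w' u x) = (\<Sum>u\<in>V. w u x) + of_bool (x = c)"
      by (simp_all add: w'_def sum.distrib)
  qed
  have "\<And>u v. 0 \<le> w' u v" using w(1) by (simp add: w'_def)
  moreover have "(u, v) \<in> E" if "w' u v > 0" for u v
    using that w(2)[of u v] step(2) by (cases "u = b \<and> v = c") (auto simp: w'_def)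
  moreover have "\<exists>u v. w' u v > 0"
    using w(3) unfolding w'_def by (metis add_pos_nonneg zero_less_eq_of_bool)
  moreover have "(\<Sum>u\<in>V. w' x u) - (\<Sum>u\<in>V. w' u x) = of_bool (x = a) - of_bool (x = c)" if "x \<in> V" for x
    using w(4)[OF that] *[OF that] by simp
  ultimately show ?case by blast
qed

text \<open>Cycles are cancelled greedily: while the positive edges contain a closed walk, a
  multiple of its edge counts moves from \<open>p\<close> to the circulation.
  \<open>walk_weights\<close> counts edges with multiplicity, so the walk need not be simple. Each
  round empties an edge, hence the induction on the number of positive edges.\<close>

lemma circulation_decomposition:
  fixes p :: "'a \<Rightarrow> 'a \<Rightarrow> real"
  assumes "finite V" and "\<And>u v. 0 \<le> p u v"
  shows "\<exists>c. (\<forall>u v. 0 \<le> c u v \<and> c u v \<le> p u v) \<and>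
    (\<forall>x\<in>V. (\<Sum>u\<in>V. c x u) = (\<Sum>u\<in>V. c u x)) \<and>
    acyclic {(u, v) \<in> V \<times> V. c u v < p u v}"
  using assms(2)
proof (induction "card {(u, v) \<in> V \<times> V. 0 < p u v}" arbitrary: p rule: less_induct)
  case less
  define E where "E = {(u, v) \<in> V \<times> V. 0 < p u v}"
  have finE: "finite E" unfolding E_def using assms(1) by (auto intro: finite_subset[of _ "V \<times> V"])
  show ?case
  proof (cases "acyclic E")
    case True
    then show ?thesis using less(2)
      by (intro exI[of _ "\<lambda>_ _. 0"]) (auto simp: E_def)
  next
    case False
    then obtain a where a: "(a, a) \<in> E\<^sup>+" unfolding acyclic_def by blast
    have "E \<subseteq> V \<times> V" by (auto simp: E_def)
    from walk_weights[OF assms(1) this a]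
    obtain w :: "'a \<Rightarrow> 'a \<Rightarrow> real" where w: "\<And>u v. 0 \<le> w u v" "\<And>u v. w u v > 0 \<Longrightarrow> (u, v) \<in> E"
      "\<exists>u v. w u v > 0"
      and w4: "\<And>x. x \<in> V \<Longrightarrow> (\<Sum>u\<in>V. w x u) - (\<Sum>u\<in>V. w u x) = of_bool (x = a) - of_bool (x = a)"
      by blast
    define W where "W = {(u, v). w u v > 0}"
    have W: "W \<subseteq> E" "W \<noteq> {}" using w(2,3) by (auto simp: W_def)
    \<comment> \<open>The largest multiple of the walk that stays below \<open>p\<close>; the edge
      attaining the minimum is emptied.\<close>
    define s where "s = Min ((\<lambda>(u, v). p u v / w u v) ` W)"
    have fW: "finite W" using W finE finite_subset by blast
    have s_le: "s * w u v \<le> p u v" for u v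
    proof (cases "(u, v) \<in> W")
      case True
      then have "s \<le> p u v / w u v" unfolding s_def using fW by (intro Min_le) auto
      then show ?thesis using True by (simp add: W_def pos_le_divide_eq)
    next
      case False
      then have "w u v = 0" using w(1)[of u v] by (simp add: W_def)
      then show ?thesis using less(2) by simp
    qed
    have "s \<in> (\<lambda>(u, v). p u v / w u v) ` W" unfolding s_def using fW W by (intro Min_in) auto
    then obtain u0 v0 where uv: "(u0, v0) \<in> W" "s = p u0 v0 / w u0 v0" by auto
    have s_pos: "s > 0" using uv W by (auto simp: W_def E_def intro!: divide_pos_pos)
    define p' where "p' = (\<lambda>u v. p u v - s * w u v)"
    have p'0: "0 \<le> p' u v" for u v using s_le by (simp add: p'_def)
    have sub: "{(u, v) \<in> V \<times> V. 0 < p' u v} \<subset> E"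
    proof
      have "p' u v \<le> p u v" for u v using w(1)[of u v] s_pos by (simp add: p'_def)
      then show "{(u, v) \<in> V \<times> V. 0 < p' u v} \<subseteq> E"
        unfolding E_def by (clarsimp, metis less_le_trans)
      have "p' u0 v0 = 0" using uv by (auto simp: p'_def W_def)
      moreover have "(u0, v0) \<in> E" using uv W by auto
      ultimately show "{(u, v) \<in> V \<times> V. 0 < p' u v} \<noteq> E" by auto
    qed
    from less(1)[OF psubset_card_mono[OF finE sub, unfolded E_def] p'0]
    obtain c where c: "\<And>u v. 0 \<le> c u v \<and> c u v \<le> p' u v"
      "\<And>x. x \<in> V \<Longrightarrow> (\<Sum>u\<in>V. c x u) = (\<Sum>u\<in>V. c u x)"
      "acyclic {(u, v) \<in> V \<times> V. c u v < p' u v}" by blast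
    show ?thesis
    proof (intro exI[of _ "\<lambda>u v. c u v + s * w u v"] conjI allI ballI)
      fix u v
      show "0 \<le> c u v + s * w u v" using c(1)[of u v] w(1)[of u v] s_pos by simp
      show "c u v + s * w u v \<le> p u v" using c(1)[of u v] by (simp add: p'_def)
    next
      fix x assume "x \<in> V"
      then show "(\<Sum>u\<in>V. c x u + s * w x u) = (\<Sum>u\<in>V. c u x + s * w u x)"
        using c(2) w4 by (simp add: sum.distrib flip: sum_distrib_left)
    next
      have "{(u, v) \<in> V \<times> V. c u v + s * w u v < p u v} = {(u, v) \<in> V \<times> V. c u v < p' u v}"
        by (auto simp: p'_def)
      then show "acyclic {(u, v) \<in> V \<times> V. c u v + s * w u v < p u v}" using c(3) by simp
    qed
  qed
qed

text \<open>The number of vertices reachable along an acyclic relation drops along every edge, so it is a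
  potential with values at most \<^term>\<open>card V\<close>; summing the drop over all edges bounds the mass.\<close>

lemma acyclic_flow_mass:
  fixes r :: "'a \<Rightarrow> 'a \<Rightarrow> real"
  assumes "finite V" and r: "\<And>u v. 0 \<le> r u v" and ac: "acyclic {(u, v) \<in> V \<times> V. 0 < r u v}"
  shows "\<exists>h :: 'a \<Rightarrow> real. (\<forall>v. 0 \<le> h v \<and> h v \<le> card V) \<and>
    (\<Sum>u\<in>V. \<Sum>v\<in>V. r u v) \<le> (\<Sum>v\<in>V. h v * ((\<Sum>u\<in>V. r v u) - (\<Sum>u\<in>V. r u v)))"
proof -
  define E where "E = {(u, v) \<in> V \<times> V. 0 < r u v}"
  define h where "h = (\<lambda>v. card {u. (v, u) \<in> E\<^sup>+})"
  have sub: "{u. (v, u) \<in> E\<^sup>+} \<subseteq> V" for v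
    using trancl_subset_Sigma[of E V] by (auto simp: E_def)
  have drop: "h v + 1 \<le> h u" if "(u, v) \<in> E" for u v
  proof -
    have "{x. (v, x) \<in> E\<^sup>+} \<subset> {x. (u, x) \<in> E\<^sup>+}"
    proof
      show "{x. (v, x) \<in> E\<^sup>+} \<subseteq> {x. (u, x) \<in> E\<^sup>+}" using that by (auto intro: trancl_into_trancl2)
      have "(v, v) \<notin> E\<^sup>+" using ac by (auto simp: acyclic_def E_def)
      then show "{x. (v, x) \<in> E\<^sup>+} \<noteq> {x. (u, x) \<in> E\<^sup>+}" using that by blast
    qed
    then have "h v < h u" unfolding h_def
      using finite_subset[OF sub assms(1)] by (intro psubset_card_mono)
    then show ?thesis by simp
  qed
  have edge: "r u v \<le> r u v * (real (h u) - real (h v))" if "u \<in> V" "v \<in> V" for u v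
  proof (cases "r u v = 0")
    case False
    then have "(u, v) \<in> E" using that r[of u v] by (auto simp: E_def)
    then have "1 \<le> real (h u) - real (h v)" using drop by fastforce
    then show ?thesis using r[of u v] by (simp add: mult_le_cancel_left1)
  qed simp
  have "(\<Sum>u\<in>V. \<Sum>v\<in>V. r u v) \<le> (\<Sum>u\<in>V. \<Sum>v\<in>V. r u v * (real (h u) - real (h v)))"
    by (intro sum_mono edge)
  also have "\<dots> = (\<Sum>u\<in>V. \<Sum>v\<in>V. r u v * h u) - (\<Sum>u\<in>V. \<Sum>v\<in>V. r u v * h v)"
    by (simp add: algebra_simps sum_subtractf)
  also have "(\<Sum>u\<in>V. \<Sum>v\<in>V. r u v * h v) = (\<Sum>v\<in>V. \<Sum>u\<in>V. r u v * h v)" by (rule sum.swap)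
  also have "(\<Sum>u\<in>V. \<Sum>v\<in>V. r u v * h u) - (\<Sum>v\<in>V. \<Sum>u\<in>V. r u v * h v)
      = (\<Sum>v\<in>V. h v * ((\<Sum>u\<in>V. r v u) - (\<Sum>u\<in>V. r u v)))"
    by (simp add: algebra_simps sum_subtractf sum_distrib_left)
  finally show ?thesis using card_mono[OF assms(1) sub]
    by (intro exI[of _ "\<lambda>v. real (h v)"]) (auto simp: h_def)
qed

text \<open>AM-GM arrives with a free scale \<open>s\<close>; the choice \<open>s = S / a\<close>
  turns it into a bound on the product. For \<open>a = 0\<close> a scale so large that
  \<open>b / s < S\<close> gives a contradiction.\<close>

lemma square_le_of_scaled_sum:
  fixes a b S :: real
  assumes "0 \<le> a" "0 \<le> b" "0 \<le> S" and *: "\<And>s. 0 < s \<Longrightarrow> 2 * S \<le> s * a + b / s"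
  shows "S\<^sup>2 \<le> a * b"
proof (cases "S = 0")
  case False
  then have S: "S > 0" using assms by simp
  have "a \<noteq> 0"
  proof
    assume "a = 0"
    then have "2 * S \<le> b / ((b + 1) / S)" using *[of "(b + 1) / S"] S assms by simp
    also have "\<dots> = S * (b / (b + 1))" by simp
    also have "\<dots> \<le> S * 1" using S assms by (intro mult_left_mono) auto
    finally show False using S by simp
  qed
  then have "a > 0" using assms by simp
  then have "2 * S \<le> S / a * a + b / (S / a)" using S by (intro *) simp
  then have "S \<le> a * b / S" using \<open>a > 0\<close> by (simp add: mult.commute)
  then show ?thesis using S by (simp add: pos_le_divide_eq power2_eq_square)
qed (use assms in simp)

section \<open>Lower bounds for scalings of nearly balanced flows\<close>

lemma bipartite_flow_bound:
  fixes pA pB :: "nat \<Rightarrow> nat \<Rightarrow> real" and d e :: "nat \<Rightarrow> real"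
  assumes pA: "\<And>i j. 0 \<le> pA i j" "(\<Sum>i<m. \<Sum>j<n. pA i j) = 1"
    and pB: "\<And>j i. 0 \<le> pB j i" "(\<Sum>i<m. \<Sum>j<n. pB j i) = 1"
    and d: "\<And>i. 0 < d i" and e: "\<And>j. 0 < e j"
    and W: "(\<Sum>i<m. ((\<Sum>j<n. pA i j) - (\<Sum>j<n. pB j i))\<^sup>2) +
            (\<Sum>j<n. ((\<Sum>i<m. pB j i) - (\<Sum>i<m. pA i j))\<^sup>2) \<le> W"
    and \<delta>: "0 \<le> \<delta>" "\<delta> \<le> 1" "real (m + n) ^ 3 * W \<le> 4 * \<delta>\<^sup>2"
  shows "(1 - \<delta>)\<^sup>2 \<le> (\<Sum>i<m. \<Sum>j<n. pA i j * (d i / e j)) * (\<Sum>i<m. \<Sum>j<n. pB j i * (e j / d i))"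
proof -
  define V :: "(nat + nat) set" where "V = {..<m} <+> {..<n}"
  have finV: "finite V" and cardV: "card V = m + n" by (simp_all add: V_def card_Plus)
  define p :: "nat + nat \<Rightarrow> nat + nat \<Rightarrow> real" where
    "p = (\<lambda>u v. case u of Inl i \<Rightarrow> (case v of Inl _ \<Rightarrow> 0 | Inr j \<Rightarrow> pA i j)
                       | Inr j \<Rightarrow> (case v of Inl i \<Rightarrow> pB j i | Inr _ \<Rightarrow> 0))"
  have p0: "0 \<le> p u v" for u v using pA pB by (auto simp: p_def split: sum.splits)
  from circulation_decomposition[of V p, OF finV p0]
  obtain c where c: "\<And>u v. 0 \<le> c u v" "\<And>u v. c u v \<le> p u v"
    and circ: "\<And>x. x \<in> V \<Longrightarrow> (\<Sum>u\<in>V. c x u) = (\<Sum>u\<in>V. c u x)"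
    and ac: "acyclic {(u, v) \<in> V \<times> V. c u v < p u v}" by blast
  define cA cB where "cA = (\<lambda>i j. c (Inl i) (Inr j))" and "cB = (\<lambda>j i. c (Inr j) (Inl i))"
  have c_zero: "c (Inl i) (Inl i') = 0" "c (Inr j) (Inr j') = 0" for i i' j j'
    using c[of "Inl i" "Inl i'"] c[of "Inr j" "Inr j'"] by (simp_all add: p_def)
  have sumV: "(\<Sum>u\<in>V. f u) = (\<Sum>i<m. f (Inl i)) + (\<Sum>j<n. f (Inr j))" for f :: "_ \<Rightarrow> real"
    by (simp add: V_def sum.Plus comp_def)
  have circ1: "(\<Sum>j<n. cA i j) = (\<Sum>j<n. cB j i)" if "i < m" for i
    using circ[of "Inl i"] InlI[of i "{..<m}" "{..<n}"] that by (simp add: sumV c_zero cA_def cB_def flip: V_def)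
  have circ2: "(\<Sum>i<m. cB j i) = (\<Sum>i<m. cA i j)" if "j < n" for j
    using circ[of "Inr j"] InrI[of j "{..<n}" "{..<m}"] that by (simp add: sumV c_zero cA_def cB_def flip: V_def)
  define S where "S = (\<Sum>i<m. \<Sum>j<n. cA i j)"
  have SB: "S = (\<Sum>i<m. \<Sum>j<n. cB j i)" unfolding S_def using circ1 by simp
  have S0: "0 \<le> S" unfolding S_def by (intro sum_nonneg) (simp add: cA_def c)
  define r where "r = (\<lambda>u v. p u v - c u v)"
  have r0: "0 \<le> r u v" for u v using c by (simp add: r_def)
  have "acyclic {(u, v) \<in> V \<times> V. 0 < r u v}" using ac by (simp add: r_def)
  from acyclic_flow_mass[OF finV r0 this] obtain h :: "_ \<Rightarrow> real" where
    h: "\<And>v. 0 \<le> h v" "\<And>v. h v \<le> card V" and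
    mass: "(\<Sum>u\<in>V. \<Sum>v\<in>V. r u v) \<le> (\<Sum>v\<in>V. h v * ((\<Sum>u\<in>V. r v u) - (\<Sum>u\<in>V. r u v)))"
    by blast
  define D where "D = (\<lambda>v. (\<Sum>u\<in>V. p v u) - (\<Sum>u\<in>V. p u v))"
  have D: "(\<Sum>u\<in>V. r v u) - (\<Sum>u\<in>V. r u v) = D v" if "v \<in> V" for v
    using circ[OF that] by (simp add: r_def D_def sum_subtractf)
  have DW: "(\<Sum>v\<in>V. (D v)\<^sup>2) \<le> W"
    using W by (simp add: sumV D_def p_def)
  \<comment> \<open>Mass balance: both flows together have mass 2 and the circulation has mass 2 S,
    so the acyclic rest has mass 2 - 2 S. Cauchy-Schwarz with potentials at most m + n on m + n
    vertices bounds it by the square root of (m + n)^3 W, hence by 2 \<delta>.\<close>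
  have "(\<Sum>j<n. \<Sum>i<m. cB j i) = S" unfolding SB by (rule sum.swap)
  moreover have "(\<Sum>j<n. \<Sum>i<m. pB j i) = 1" using pB(2) by (subst sum.swap)
  ultimately have "(\<Sum>u\<in>V. \<Sum>v\<in>V. r u v) = 2 - 2 * S"
    using pA(2) S_def by (simp add: sumV r_def sum_subtractf p_def c_zero cA_def cB_def)
  then have "2 - 2 * S \<le> (\<Sum>v\<in>V. h v * D v)" using mass D by simp
  moreover have "(\<Sum>v\<in>V. h v * D v) \<le> 2 * \<delta>"
  proof -
    have "(\<Sum>v\<in>V. h v * D v)\<^sup>2 \<le> (\<Sum>v\<in>V. (h v)\<^sup>2) * (\<Sum>v\<in>V. (D v)\<^sup>2)"
      by (rule Cauchy_Schwarz_ineq_sum)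
    also have "\<dots> \<le> (\<Sum>v\<in>V. (real (card V))\<^sup>2) * W"
      using h DW by (intro mult_mono sum_mono power_mono sum_nonneg) auto
    also have "\<dots> = real (m + n) ^ 3 * W" by (simp add: cardV power2_eq_square power3_eq_cube)
    also have "\<dots> \<le> (2 * \<delta>)\<^sup>2" using \<delta> by (simp add: power_mult_distrib)
    finally show ?thesis using \<delta>(1) by (auto intro: power2_le_imp_le[of _ "2 * \<delta>"])
  qed
  ultimately have S: "1 - \<delta> \<le> S" by simp
  define a b where "a = (\<Sum>i<m. \<Sum>j<n. cA i j * (d i / e j))"
    and "b = (\<Sum>i<m. \<Sum>j<n. cB j i * (e j / d i))"
  have a0: "0 \<le> a" and b0: "0 \<le> b" unfolding a_def b_def
    using c d e by (auto intro!: sum_nonneg mult_nonneg_nonneg divide_nonneg_nonneg simp: cA_def cB_def less_imp_le)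
  have "S\<^sup>2 \<le> a * b"
  proof (rule square_le_of_scaled_sum[OF a0 b0 S0])
    fix s :: real assume s: "s > 0"
    \<comment> \<open>The inequality 1 + ln z <= z at z = s d_i / e_j, and in \<open>B\<close> at
      the reciprocal. After summation the logarithms of \<open>d\<close> and \<open>e\<close> cancel
      because the circulation enters and leaves every vertex equally; ln s cancels because both
      halves have mass \<open>S\<close>.\<close>
    have A: "cA i j * (1 + ln s + ln (d i) - ln (e j)) \<le> cA i j * (s * (d i / e j))" for i j
    proof (rule mult_left_mono)
      have "ln (s * (d i / e j)) \<le> s * (d i / e j) - 1" using s d[of i] e[of j] by (intro ln_le_minus_one) simp
      then show "1 + ln s + ln (d i) - ln (e j) \<le> s * (d i / e j)"
        using s d[of i] e[of j] by (simp add: ln_mult ln_div)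
    qed (simp add: cA_def c)
    have B: "cB j i * (1 - ln s - ln (d i) + ln (e j)) \<le> cB j i * (e j / d i / s)" for i j
    proof (rule mult_left_mono)
      have "ln (e j / d i / s) \<le> e j / d i / s - 1" using s d[of i] e[of j] by (intro ln_le_minus_one) simp
      then show "1 - ln s - ln (d i) + ln (e j) \<le> e j / d i / s"
        using s d[of i] e[of j] by (simp add: ln_mult ln_div)
    qed (simp add: cB_def c)
    have "(\<Sum>i<m. \<Sum>j<n. cA i j * (1 + ln s + ln (d i) - ln (e j))) +
          (\<Sum>i<m. \<Sum>j<n. cB j i * (1 - ln s - ln (d i) + ln (e j)))
        \<le> (\<Sum>i<m. \<Sum>j<n. cA i j * (s * (d i / e j))) + (\<Sum>i<m. \<Sum>j<n. cB j i * (e j / d i / s))"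
      by (intro add_mono sum_mono A B)
    also have "(\<Sum>i<m. \<Sum>j<n. cA i j * (s * (d i / e j))) = s * a"
      by (simp add: a_def sum_distrib_left mult_ac)
    also have "(\<Sum>i<m. \<Sum>j<n. cB j i * (e j / d i / s)) = b / s"
      by (simp add: b_def sum_divide_distrib)
    also have "(\<Sum>i<m. \<Sum>j<n. cA i j * (1 + ln s + ln (d i) - ln (e j)))
        = (1 + ln s) * S + (\<Sum>i<m. \<Sum>j<n. cA i j * ln (d i)) - (\<Sum>i<m. \<Sum>j<n. cA i j * ln (e j))"
      by (simp add: S_def algebra_simps sum.distrib sum_subtractf sum_distrib_left)
    also have "(\<Sum>i<m. \<Sum>j<n. cB j i * (1 - ln s - ln (d i) + ln (e j)))
        = (1 - ln s) * S - (\<Sum>i<m. \<Sum>j<n. cB j i * ln (d i)) + (\<Sum>i<m. \<Sum>j<n. cB j i * ln (e j))"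
      by (simp add: SB algebra_simps sum.distrib sum_subtractf sum_distrib_left)
    also have "(\<Sum>i<m. \<Sum>j<n. cA i j * ln (d i)) = (\<Sum>i<m. \<Sum>j<n. cB j i * ln (d i))"
      using circ1 by (simp flip: sum_distrib_right)
    also have "(\<Sum>i<m. \<Sum>j<n. cA i j * ln (e j)) = (\<Sum>j<n. \<Sum>i<m. cA i j * ln (e j))" by (rule sum.swap)
    also have "\<dots> = (\<Sum>j<n. \<Sum>i<m. cB j i * ln (e j))"
      using circ2 by (simp flip: sum_distrib_right)
    also have "\<dots> = (\<Sum>i<m. \<Sum>j<n. cB j i * ln (e j))" by (rule sum.swap)
    finally show "2 * S \<le> s * a + b / s" by (simp add: algebra_simps)
  qed
  moreover have "(1 - \<delta>)\<^sup>2 \<le> S\<^sup>2" using S \<delta> by (intro power_mono) auto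
  moreover have "cA i j \<le> pA i j" "cB j i \<le> pB j i" for i j
    using c(2)[of "Inl i" "Inr j"] c(2)[of "Inr j" "Inl i"] by (simp_all add: p_def cA_def cB_def)
  then have "a * b \<le> (\<Sum>i<m. \<Sum>j<n. pA i j * (d i / e j)) * (\<Sum>i<m. \<Sum>j<n. pB j i * (e j / d i))"
    unfolding a_def b_def using c pA pB d e
    by (intro mult_mono sum_mono mult_right_mono sum_nonneg mult_nonneg_nonneg)
      (auto intro!: divide_nonneg_nonneg sum_nonneg mult_nonneg_nonneg simp: cB_def cA_def less_imp_le)
  ultimately show ?thesis by linarith
qed

text \<open>With trivial scalings on the right, only the vertices \<open>i\<close> carry a balance
  condition. Row mass \<open>f i\<close> is matched directly with column mass \<open>g i\<close> up
  to their minimum; the unmatched mass is half the l1 distance, which Cauchy-Schwarz bounds.\<close>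

lemma one_sided_flow_bound:
  fixes pA pB :: "nat \<Rightarrow> nat \<Rightarrow> real" and d :: "nat \<Rightarrow> real"
  assumes pA: "\<And>i j. 0 \<le> pA i j" "(\<Sum>i<m. \<Sum>j<n. pA i j) = 1"
    and pB: "\<And>j i. 0 \<le> pB j i" "(\<Sum>i<m. \<Sum>j<n. pB j i) = 1"
    and d: "\<And>i. 0 < d i"
    and W: "(\<Sum>i<m. ((\<Sum>j<n. pA i j) - (\<Sum>j<n. pB j i))\<^sup>2) \<le> W"
    and \<delta>: "0 \<le> \<delta>" "\<delta> \<le> 1" "real m * W \<le> 4 * \<delta>\<^sup>2"
  shows "(1 - \<delta>)\<^sup>2 \<le> (\<Sum>i<m. \<Sum>j<n. pA i j * d i) * (\<Sum>i<m. \<Sum>j<n. pB j i / d i)"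
proof -
  define f g where "f = (\<lambda>i. \<Sum>j<n. pA i j)" and "g = (\<lambda>i. \<Sum>j<n. pB j i)"
  have f0: "0 \<le> f i" and g0: "0 \<le> g i" for i unfolding f_def g_def using pA pB by (auto intro: sum_nonneg)
  define S where "S = (\<Sum>i<m. min (f i) (g i))"
  have S0: "0 \<le> S" unfolding S_def using f0 g0 by (intro sum_nonneg) simp
  have "2 - 2 * S = (\<Sum>i<m. f i) + (\<Sum>i<m. g i) - 2 * S" using pA(2) pB(2) by (simp add: f_def g_def)
  also have "\<dots> = (\<Sum>i<m. f i + g i - 2 * min (f i) (g i))"
    by (simp add: S_def sum.distrib sum_subtractf sum_distrib_left)
  also have "\<dots> = (\<Sum>i<m. 1 * \<bar>f i - g i\<bar>)" by (intro sum.cong) (auto simp: min_def)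
  also have "\<dots> \<le> 2 * \<delta>"
  proof -
    have "(\<Sum>i<m. 1 * \<bar>f i - g i\<bar>)\<^sup>2 \<le> (\<Sum>i<m. 1\<^sup>2) * (\<Sum>i<m. \<bar>f i - g i\<bar>\<^sup>2)"
      using Cauchy_Schwarz_ineq_sum[of "\<lambda>_. 1" "\<lambda>i. \<bar>f i - g i\<bar>" "{..<m}"] by simp
    also have "\<dots> \<le> real m * W" using W by (simp add: f_def g_def mult_left_mono)
    also have "\<dots> \<le> (2 * \<delta>)\<^sup>2" using \<delta> by (simp add: power_mult_distrib)
    finally show ?thesis using \<delta>(1) by (auto intro: power2_le_imp_le[of _ "2 * \<delta>"])
  qed
  finally have S: "1 - \<delta> \<le> S" by simp
  define a b where "a = (\<Sum>i<m. f i * d i)" and "b = (\<Sum>i<m. g i / d i)"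
  have a0: "0 \<le> a" and b0: "0 \<le> b" unfolding a_def b_def
    using f0 g0 d by (auto intro!: sum_nonneg mult_nonneg_nonneg divide_nonneg_nonneg simp: less_imp_le)
  have "S\<^sup>2 \<le> a * b"
  proof (rule square_le_of_scaled_sum[OF a0 b0 S0])
    fix s :: real assume s: "s > 0"
    have "2 * min (f i) (g i) \<le> s * (f i * d i) + g i / d i / s" for i
    proof -
      define z where "z = s * d i"
      have z: "z > 0" using s d[of i] by (simp add: z_def)
      have "2 * z \<le> z\<^sup>2 + 1" using zero_le_power2[of "z - 1"] by (simp add: power2_diff)
      then have "2 \<le> z + 1 / z" using z by (simp add: field_simps power2_eq_square)
      then have "min (f i) (g i) * 2 \<le> min (f i) (g i) * (z + 1 / z)"
        using f0 g0 by (intro mult_left_mono) auto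
      also have "\<dots> = min (f i) (g i) * z + min (f i) (g i) * (1 / z)" by (simp add: algebra_simps)
      also have "\<dots> \<le> f i * z + g i * (1 / z)" using z by (intro add_mono mult_right_mono) auto
      finally show ?thesis by (simp add: z_def mult_ac)
    qed
    then have "(\<Sum>i<m. 2 * min (f i) (g i)) \<le> (\<Sum>i<m. s * (f i * d i) + g i / d i / s)"
      by (intro sum_mono)
    then show "2 * S \<le> s * a + b / s"
      by (simp add: S_def a_def b_def sum.distrib sum_distrib_left sum_divide_distrib)
  qed
  moreover have "(1 - \<delta>)\<^sup>2 \<le> S\<^sup>2" using S \<delta> by (intro power_mono) auto
  ultimately show ?thesis
    by (simp add: a_def b_def f_def g_def sum_distrib_right sum_divide_distrib)
qed

text \<open>The best constant on [-1, 1] is e - 2, about 0.718. Any constant below 1 yields a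
  positive gain in \<open>descent\<close>; 3/4 leaves 1/8 - 3/32 = 1/32.\<close>

lemma exp_le_quadratic:
  fixes u :: real
  assumes "\<bar>u\<bar> \<le> 1"
  shows "exp u \<le> 1 + u + 3 / 4 * u\<^sup>2"
proof -
  \<comment> \<open>Five terms suffice since 1/2 + 1/6 + 1/24 + 3/120 is below 3/4; with four terms
    and \<open>exp t \<le> 3\<close> the sum would be 19/24.\<close>
  obtain t where t: "\<bar>t\<bar> \<le> \<bar>u\<bar>" and "exp u = (\<Sum>k<5. u ^ k / fact k) + exp t / fact 5 * u ^ 5"
    using Maclaurin_exp_le[of u 5] by blast
  then have *: "exp u = 1 + u + u\<^sup>2 / 2 + u ^ 3 / 6 + u ^ 4 / 24 + exp t / 120 * u ^ 5"
    by (simp add: eval_nat_numeral)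
  have pow: "\<bar>u\<bar> ^ k \<le> u\<^sup>2" if "k \<ge> 2" for k
    using power_decreasing[OF that, of "\<bar>u\<bar>"] assms by simp
  have "exp t \<le> 3" using t assms exp_le by (auto intro: order_trans[of _ "exp 1"])
  then have "exp t * \<bar>u\<bar> ^ 5 \<le> 3 * u\<^sup>2" using pow[of 5] by (intro mult_mono) auto
  moreover have "exp t * u ^ 5 \<le> exp t * \<bar>u\<bar> ^ 5" by (intro mult_left_mono) (simp_all flip: power_abs)
  moreover have "u ^ 3 \<le> \<bar>u\<bar> ^ 3" "u ^ 4 \<le> \<bar>u\<bar> ^ 4" by (simp_all flip: power_abs)
  moreover have "\<bar>u\<bar> ^ 3 \<le> u\<^sup>2" "\<bar>u\<bar> ^ 4 \<le> u\<^sup>2" "0 \<le> u\<^sup>2" using pow[of 3] pow[of 4] by auto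
  ultimately show ?thesis unfolding * by linarith
qed

section \<open>Complex matrices\<close>

text \<open>Premises on dimensions rather than carrier sets can be discharged by the simplifier, so
  long products are bracketed to the right in one call.\<close>

lemma mult_assoc_dims:
  fixes A B C :: cmat
  assumes "dim_col A = dim_row B" "dim_col B = dim_row C"
  shows "A * B * C = A * (B * C)"
  by (rule assoc_mult_mat[of _ "dim_row A" "dim_row B" _ "dim_row C" _ "dim_col C"]) (use assms in auto)

lemma mult_cancel_dims:
  fixes A B C :: cmat
  assumes "A * B = 1\<^sub>m n" "dim_col A = dim_row B" "dim_row C = n" "dim_col B = n"
  shows "A * (B * C) = C"
proof -
  have "A * (B * C) = A * B * C" by (rule mult_assoc_dims[symmetric]) (use assms in auto)
  then show ?thesis using assms by (simp add: left_mult_one_mat[of _ n "dim_col C"])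
qed

lemma index_mult_sum:
  fixes A B :: cmat
  assumes "i < dim_row A" "j < dim_col B" "dim_col A = dim_row B"
  shows "(A * B) $$ (i, j) = (\<Sum>l<dim_row B. A $$ (i, l) * B $$ (l, j))"
  using assms by (simp add: scalar_prod_def atLeast0LessThan)

lemma dim_cadj [simp]: "dim_row (cadj X) = dim_col X" "dim_col (cadj X) = dim_row X"
  by (simp_all add: cadj_def)

lemma cadj_carrier [simp]: "X \<in> carrier_mat r c \<Longrightarrow> cadj X \<in> carrier_mat c r"
  by (auto simp: cadj_def)

lemma cadj_index [simp]: "i < dim_col X \<Longrightarrow> j < dim_row X \<Longrightarrow> cadj X $$ (i, j) = cnj (X $$ (j, i))"
  by (simp add: cadj_def)

lemma cadj_cadj [simp]: "cadj (cadj X) = X"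
  by (rule eq_matI) auto

lemma cadj_one [simp]: "cadj (1\<^sub>m m) = 1\<^sub>m m"
  by (rule eq_matI) auto

lemma cadj_mult: "dim_col A = dim_row B \<Longrightarrow> cadj (A * B) = cadj B * cadj A"
  by (rule eq_matI) (auto simp: index_mult_sum mult.commute simp del: index_mult_mat(1))

lemma mtrace_comm:
  assumes "dim_col A = dim_row B" "dim_col B = dim_row A"
  shows "mtrace (A * B) = mtrace (B * A)"
proof -
  have "mtrace (A * B) = (\<Sum>i<dim_row A. \<Sum>l<dim_row B. A $$ (i, l) * B $$ (l, i))"
    using assms by (simp add: mtrace_def index_mult_sum del: index_mult_mat(1))
  also have "\<dots> = (\<Sum>l<dim_row B. \<Sum>i<dim_row A. A $$ (i, l) * B $$ (l, i))" by (rule sum.swap)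
  also have "\<dots> = mtrace (B * A)"
    using assms by (simp add: mtrace_def index_mult_sum mult.commute del: index_mult_mat(1))
  finally show ?thesis .
qed

definition fsq :: "cmat \<Rightarrow> real" where
  "fsq X = (\<Sum>i<dim_row X. \<Sum>j<dim_col X. (cmod (X $$ (i, j)))\<^sup>2)"

lemma frob_eq: "frob X = sqrt (fsq X)"
  by (simp add: frob_def fsq_def)

lemma fsq_nonneg: "0 \<le> fsq X"
  unfolding fsq_def by (intro sum_nonneg) auto

lemma mtrace_cadj_mult: "mtrace (cadj X * X) = complex_of_real (fsq X)"
proof -
  have "mtrace (cadj X * X) = (\<Sum>j<dim_col X. \<Sum>i<dim_row X. complex_of_real ((cmod (X $$ (i, j)))\<^sup>2))"
    by (simp add: mtrace_def index_mult_sum complex_norm_square mult.commute del: index_mult_mat(1) of_real_power)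
  also have "\<dots> = complex_of_real (fsq X)"
    by (subst sum.swap) (simp add: fsq_def)
  finally show ?thesis .
qed

lemma fsq_pos:
  assumes "X \<in> carrier_mat r c" "X \<noteq> 0\<^sub>m r c"
  shows "0 < fsq X"
proof (rule ccontr)
  assume "\<not> ?thesis"
  then have "fsq X = 0" using fsq_nonneg[of X] by simp
  then have "\<forall>i<r. \<forall>j<c. X $$ (i, j) = 0"
    using assms(1) by (auto simp: fsq_def sum_nonneg_eq_0_iff sum_nonneg)
  then have "X = 0\<^sub>m r c" using assms(1) by (intro eq_matI) auto
  then show False using assms(2) by simp
qed

lemma GL_D:
  assumes "X \<in> GL m"
  shows "X \<in> carrier_mat m m" "minv X \<in> carrier_mat m m" "X * minv X = 1\<^sub>m m" "minv X * X = 1\<^sub>m m"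
proof -
  show X: "X \<in> carrier_mat m m" using assms by (simp add: GL_def)
  obtain B where B: "inverts_mat X B" "inverts_mat B X"
    using assms by (auto simp: GL_def invertible_mat_def)
  have "dim_col B = m" "dim_row B = m"
    using arg_cong[OF B(1)[unfolded inverts_mat_def], of dim_col]
      arg_cong[OF B(2)[unfolded inverts_mat_def], of dim_col] X by simp_all
  then have "B \<in> carrier_mat m m" by (intro carrier_matI)
  then have "B \<in> carrier_mat (dim_row X) (dim_row X) \<and> inverts_mat X B \<and> inverts_mat B X"
    using B X by simp
  then have "\<exists>Z. Z \<in> carrier_mat (dim_row X) (dim_row X) \<and> inverts_mat X Z \<and> inverts_mat Z X"
    by (rule exI)
  from someI_ex[OF this, folded minv_def] X
  show "minv X \<in> carrier_mat m m" "X * minv X = 1\<^sub>m m" "minv X * X = 1\<^sub>m m"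
    by (auto simp: inverts_mat_def)
qed

lemma right_inverse_GL:
  assumes "X \<in> carrier_mat m m" "Z \<in> carrier_mat m m" "X * Z = 1\<^sub>m m"
  shows "X \<in> GL m" "minv X = Z" "Z * X = 1\<^sub>m m"
proof -
  show ZX: "Z * X = 1\<^sub>m m" by (rule mat_mult_left_right_inverse) (use assms in auto)
  then show X: "X \<in> GL m" using assms by (auto simp: GL_def invertible_mat_def inverts_mat_def)
  note M = GL_D[OF X]
  have "minv X * (X * Z) = Z"
    by (rule mult_cancel_dims[OF M(4)]) (use M assms in auto)
  then show "minv X = Z" using assms M by simp
qed

lemma minv_GL: "X \<in> GL m \<Longrightarrow> minv X \<in> GL m" "X \<in> GL m \<Longrightarrow> minv (minv X) = X"
  using right_inverse_GL[of "minv X" m X] GL_D by auto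

lemma GL_one [simp]: "1\<^sub>m m \<in> GL m" "minv (1\<^sub>m m) = 1\<^sub>m m"
  using right_inverse_GL[of "1\<^sub>m m" m "1\<^sub>m m"] by auto

lemma GL_mult:
  assumes "X \<in> GL m" "Y \<in> GL m"
  shows "X * Y \<in> GL m" "minv (X * Y) = minv Y * minv X"
proof -
  note M = GL_D[OF assms(1)] GL_D[OF assms(2)]
  have d: "dim_row X = m" "dim_col X = m" "dim_row Y = m" "dim_col Y = m"
    "dim_row (minv X) = m" "dim_col (minv X) = m" "dim_row (minv Y) = m" "dim_col (minv Y) = m" using M by auto
  have "X * Y * (minv Y * minv X) = X * (Y * (minv Y * minv X))" by (rule mult_assoc_dims) (use M in auto)
  also have "Y * (minv Y * minv X) = minv X" by (rule mult_cancel_dims[OF M(7)]) (use M in auto)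
  finally have "X * Y * (minv Y * minv X) = 1\<^sub>m m" using M by simp
  from right_inverse_GL[OF _ _ this] show "X * Y \<in> GL m" "minv (X * Y) = minv Y * minv X" using M by auto
qed

lemma GL_cadj:
  assumes "X \<in> GL m"
  shows "cadj X \<in> GL m" "minv (cadj X) = cadj (minv X)"
proof -
  note M = GL_D[OF assms]
  have "cadj X * cadj (minv X) = cadj (minv X * X)" using M by (subst cadj_mult) auto
  then have "cadj X * cadj (minv X) = 1\<^sub>m m" using M by simp
  from right_inverse_GL[OF _ _ this] show "cadj X \<in> GL m" "minv (cadj X) = cadj (minv X)" using M by auto
qed

section \<open>Unitary matrices and functional calculus in a unitary basis\<close>

definition unitary_mat :: "nat \<Rightarrow> cmat \<Rightarrow> bool" where
  "unitary_mat m U \<longleftrightarrow> U \<in> carrier_mat m m \<and> cadj U * U = 1\<^sub>m m"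

lemma unitary_matD:
  assumes "unitary_mat m U"
  shows "U \<in> carrier_mat m m" "cadj U * U = 1\<^sub>m m" "U * cadj U = 1\<^sub>m m" "U \<in> GL m" "minv U = cadj U"
proof -
  show U: "U \<in> carrier_mat m m" "cadj U * U = 1\<^sub>m m" using assms by (auto simp: unitary_mat_def)
  then show UU: "U * cadj U = 1\<^sub>m m" using right_inverse_GL[of "cadj U" m U] by simp
  show "U \<in> GL m" "minv U = cadj U" using right_inverse_GL[of U m "cadj U"] U UU by auto
qed

lemma unitary_mat_one: "unitary_mat m (1\<^sub>m m)" by (simp add: unitary_mat_def)

abbreviation rdiag :: "nat \<Rightarrow> (nat \<Rightarrow> real) \<Rightarrow> cmat" where
  "rdiag m d \<equiv> mat_diag m (\<lambda>i. complex_of_real (d i))"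

lemma dim_mat_diag [simp]: "dim_row (mat_diag m f) = m" "dim_col (mat_diag m f) = m"
  by (auto simp: mat_diag_def)

lemma cadj_rdiag [simp]: "cadj (rdiag m d) = rdiag m d"
  by (rule eq_matI) (auto simp: mat_diag_def)

text \<open>The spectral form in which Hermitian matrices are handled: for fixed unitary
  \<open>U\<close>, products, inverses and exponentials act pointwise on \<open>d\<close>.
  \<open>d\<close> is a total function of which only the values below the dimension count
  (\<open>conj_diag_cong\<close>).\<close>

definition conj_diag :: "cmat \<Rightarrow> (nat \<Rightarrow> real) \<Rightarrow> cmat" where
  "conj_diag U d = U * (rdiag (dim_col U) d * cadj U)"

lemma dim_conj_diag [simp]: "dim_row (conj_diag U d) = dim_row U" "dim_col (conj_diag U d) = dim_row U"
  by (simp_all add: conj_diag_def)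

lemma conj_diag_carrier [simp]: "U \<in> carrier_mat m m \<Longrightarrow> conj_diag U d \<in> carrier_mat m m"
  by (intro carrier_matI) auto

lemma conj_diag_index:
  assumes "i < dim_row U" "j < dim_row U"
  shows "conj_diag U d $$ (i, j) = (\<Sum>l<dim_col U. U $$ (i, l) * (complex_of_real (d l) * cnj (U $$ (j, l))))"
proof -
  have "rdiag (dim_col U) d * cadj U = Matrix.mat (dim_col U) (dim_row U) (\<lambda>(i, j). d i * cadj U $$ (i, j))"
    by (rule mat_diag_mult_left) (auto intro: carrier_matI)
  then show ?thesis
    using assms by (simp add: conj_diag_def index_mult_sum del: index_mult_mat(1))
qed

lemma cadj_conj_diag: "cadj (conj_diag U d) = conj_diag U d"
  by (simp add: conj_diag_def cadj_mult mult_assoc_dims)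

lemma conj_diag_cong: "(\<And>i. i < dim_col U \<Longrightarrow> d i = e i) \<Longrightarrow> conj_diag U d = conj_diag U e"
  by (rule eq_matI) (auto simp: conj_diag_index)

lemma conj_diag_mult:
  assumes "unitary_mat m U"
  shows "conj_diag U d * conj_diag U e = conj_diag U (\<lambda>i. d i * e i)"
proof -
  note U = unitary_matD[OF assms]
  have d: "dim_row U = m" "dim_col U = m" using U by auto
  have "cadj U * (U * (rdiag m e * cadj U)) = rdiag m e * cadj U"
    by (rule mult_cancel_dims[OF U(2)]) (use d in auto)
  then have "conj_diag U d * conj_diag U e = U * (rdiag m d * (rdiag m e * cadj U))"
    by (simp add: conj_diag_def mult_assoc_dims d)
  also have "rdiag m d * (rdiag m e * cadj U) = rdiag m d * rdiag m e * cadj U"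
    by (rule mult_assoc_dims[symmetric]) (use d in auto)
  finally show ?thesis by (simp add: conj_diag_def d)
qed

lemma conj_diag_one:
  assumes "unitary_mat m U"
  shows "conj_diag U (\<lambda>_. 1) = 1\<^sub>m m"
  using unitary_matD[OF assms] by (simp add: conj_diag_def)

lemma conj_diag_GL:
  assumes "unitary_mat m U" "\<And>i. d i \<noteq> 0"
  shows "conj_diag U d \<in> GL m" "minv (conj_diag U d) = conj_diag U (\<lambda>i. 1 / d i)"
proof -
  have "conj_diag U d * conj_diag U (\<lambda>i. 1 / d i) = 1\<^sub>m m"
    using assms by (simp add: conj_diag_mult conj_diag_one)
  from right_inverse_GL[OF _ _ this] show "conj_diag U d \<in> GL m" "minv (conj_diag U d) = conj_diag U (\<lambda>i. 1 / d i)"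
    using unitary_matD[OF assms(1)] by auto
qed

lemma conj_diag_smult: "U \<in> carrier_mat m m \<Longrightarrow> complex_of_real t \<cdot>\<^sub>m conj_diag U d = conj_diag U (\<lambda>i. t * d i)"
  by (rule eq_matI) (auto simp: conj_diag_index sum_distrib_left mult_ac)

lemma conj_diag_power:
  assumes "unitary_mat m U"
  shows "conj_diag U d ^\<^sub>m k = conj_diag U (\<lambda>i. d i ^ k)"
proof (induction k)
  case 0
  then show ?case using unitary_matD[OF assms] by (simp add: conj_diag_one[OF assms])
next
  case (Suc k)
  then show ?case using assms by (simp add: conj_diag_mult mult.commute)
qed

lemma mexp_conj_diag:
  assumes U: "unitary_mat m U"
  shows "mexp (conj_diag U d) = conj_diag U (\<lambda>i. exp (d i))"
proof (rule eq_matI)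
  have d: "dim_row U = m" "dim_col U = m" using unitary_matD[OF U] by auto
  fix i j assume "i < dim_row (conj_diag U (\<lambda>i. exp (d i)))" "j < dim_col (conj_diag U (\<lambda>i. exp (d i)))"
  then have ij: "i < m" "j < m" using d by auto
  have "(\<lambda>k. U $$ (i, l) * ((complex_of_real (d l ^ k) / of_nat (fact k)) * cnj (U $$ (j, l)))) sums
      (U $$ (i, l) * (complex_of_real (exp (d l)) * cnj (U $$ (j, l))))" for l
  proof -
    have "(\<lambda>k. complex_of_real (d l ^ k /\<^sub>R fact k)) sums complex_of_real (exp (d l))"
      by (intro sums_of_real exp_converges)
    then have "(\<lambda>k. complex_of_real (d l ^ k) / of_nat (fact k)) sums complex_of_real (exp (d l))"
      by (simp add: scaleR_conv_of_real field_simps)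
    then show ?thesis by (intro sums_mult sums_mult2)
  qed
  then have "(\<lambda>k. \<Sum>l<m. U $$ (i, l) * ((complex_of_real (d l ^ k) / of_nat (fact k)) * cnj (U $$ (j, l)))) sums
      (\<Sum>l<m. U $$ (i, l) * (complex_of_real (exp (d l)) * cnj (U $$ (j, l))))"
    by (intro sums_sum)
  moreover have "(conj_diag U d ^\<^sub>m k) $$ (i, j) / of_nat (fact k)
      = (\<Sum>l<m. U $$ (i, l) * ((complex_of_real (d l ^ k) / of_nat (fact k)) * cnj (U $$ (j, l))))" for k
    using ij d by (simp add: conj_diag_power[OF U] conj_diag_index sum_divide_distrib)
  ultimately have "(\<Sum>k. (conj_diag U d ^\<^sub>m k) $$ (i, j) / of_nat (fact k))
      = (\<Sum>l<m. U $$ (i, l) * (complex_of_real (exp (d l)) * cnj (U $$ (j, l))))"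
    by (simp add: sums_iff)
  then show "mexp (conj_diag U d) $$ (i, j) = conj_diag U (\<lambda>i. exp (d i)) $$ (i, j)"
    using ij d by (simp add: mexp_def conj_diag_index)
qed (use unitary_matD[OF U] in \<open>auto simp: mexp_def\<close>)

lemma mtrace_sandwich:
  assumes "C \<in> carrier_mat m n"
  shows "mtrace (cadj C * (rdiag m d * (C * rdiag n e))) =
    complex_of_real (\<Sum>i<m. \<Sum>j<n. (cmod (C $$ (i, j)))\<^sup>2 * (d i * e j))"
proof -
  have *: "rdiag m d * (C * rdiag n e) = Matrix.mat m n (\<lambda>(i, j). d i * (C $$ (i, j) * e j))"
    using assms by (subst mat_diag_mult_right) (auto simp: mat_diag_mult_left[of _ m n])
  have "mtrace (cadj C * (rdiag m d * (C * rdiag n e))) =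
      (\<Sum>j<n. \<Sum>i<m. complex_of_real ((cmod (C $$ (i, j)))\<^sup>2 * (d i * e j)))"
    using assms unfolding *
    by (simp add: mtrace_def index_mult_sum complex_norm_square mult_ac del: index_mult_mat(1) of_real_power)
  also have "\<dots> = complex_of_real (\<Sum>i<m. \<Sum>j<n. (cmod (C $$ (i, j)))\<^sup>2 * (d i * e j))"
    by (subst sum.swap) simp
  finally show ?thesis .
qed

text \<open>The trace of the Gram matrix of X A Y^-1 depends on X and Y only through X*X and Y*Y;
  cyclicity of the trace then moves the two spectral bases onto A.\<close>

lemma fsq_scaled:
  assumes X: "X \<in> GL m" and Y: "Y \<in> GL n" and A: "A \<in> carrier_mat m n"
    and U: "unitary_mat m U" and V: "unitary_mat n V"
    and XU: "cadj X * X = conj_diag U d" and YV: "cadj Y * Y = conj_diag V e" and e: "\<And>j. e j \<noteq> 0"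
  shows "fsq (X * A * minv Y) = (\<Sum>i<m. \<Sum>j<n. (cmod ((cadj U * A * V) $$ (i, j)))\<^sup>2 * (d i / e j))"
proof -
  note mX = GL_D[OF X] and mY = GL_D[OF Y] and mU = unitary_matD[OF U] and mV = unitary_matD[OF V]
  have dims [simp]: "dim_row X = m" "dim_col X = m" "dim_row Y = n" "dim_col Y = n" "dim_row A = m" "dim_col A = n"
    "dim_row (minv Y) = n" "dim_col (minv Y) = n" "dim_row U = m" "dim_col U = m" "dim_row V = n" "dim_col V = n"
    using mX mY A mU mV by auto
  have "minv Y * cadj (minv Y) = minv (cadj Y * Y)"
    using GL_mult[OF GL_cadj(1)[OF Y] Y] GL_cadj[OF Y] by simp
  also have "\<dots> = conj_diag V (\<lambda>j. 1 / e j)" using conj_diag_GL[OF V e] YV by simp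
  finally have YY: "minv Y * cadj (minv Y) = conj_diag V (\<lambda>j. 1 / e j)" .
  let ?C = "cadj U * A * V"
  have "complex_of_real (fsq (X * A * minv Y)) = mtrace (cadj (X * A * minv Y) * (X * A * minv Y))"
    by (rule mtrace_cadj_mult[symmetric])
  also have "\<dots> = mtrace (cadj (minv Y) * (cadj A * (cadj X * X) * A * minv Y))"
    by (simp add: cadj_mult mult_assoc_dims)
  also have "\<dots> = mtrace ((cadj A * (cadj X * X) * A * minv Y) * cadj (minv Y))"
    by (rule mtrace_comm) auto
  also have "\<dots> = mtrace (cadj A * (cadj X * X) * A * (minv Y * cadj (minv Y)))"
    by (simp add: mult_assoc_dims)
  also have "\<dots> = mtrace ((cadj A * U * rdiag m d * cadj U * A * V * rdiag n (\<lambda>j. 1 / e j)) * cadj V)"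
    unfolding XU YY by (simp add: conj_diag_def mult_assoc_dims)
  also have "\<dots> = mtrace (cadj V * (cadj A * U * rdiag m d * cadj U * A * V * rdiag n (\<lambda>j. 1 / e j)))"
    by (rule mtrace_comm) auto
  also have "\<dots> = mtrace (cadj ?C * (rdiag m d * (?C * rdiag n (\<lambda>j. 1 / e j))))"
    by (simp add: cadj_mult mult_assoc_dims)
  also have "\<dots> = complex_of_real (\<Sum>i<m. \<Sum>j<n. (cmod (?C $$ (i, j)))\<^sup>2 * (d i * (1 / e j)))"
    by (rule mtrace_sandwich, rule carrier_matI) simp_all
  finally show ?thesis unfolding of_real_eq_iff by simp
qed

section \<open>Transvections, plane rotations and compactness\<close>

definition hermitian_on :: "nat \<Rightarrow> (nat \<times> nat) set \<Rightarrow> cmat set" where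
  "hermitian_on m R = {H \<in> carrier_mat m m. cadj H = H \<and> (\<forall>i<m. \<forall>j<m. (i, j) \<notin> R \<longrightarrow> H $$ (i, j) = 0)}"

text \<open>For distinct indices this is a root subgroup of the diagonal torus: conjugation by
  diag(t) multiplies \<open>z\<close> by t_i / t_j, which is how limits under the torus single it
  out.\<close>

definition elem_mat :: "nat \<Rightarrow> nat \<Rightarrow> nat \<Rightarrow> complex \<Rightarrow> cmat" where
  "elem_mat m i j z = Matrix.mat m m (\<lambda>(k, l). of_bool (k = l) + (if k = i \<and> l = j then z else 0))"

lemma elem_mat_carrier [simp]: "elem_mat m i j z \<in> carrier_mat m m"
  by (simp add: elem_mat_def)

lemma dim_elem_mat [simp]: "dim_row (elem_mat m i j z) = m" "dim_col (elem_mat m i j z) = m"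
  by (simp_all add: elem_mat_def)

lemma elem_mat_index: "k < m \<Longrightarrow> l < m \<Longrightarrow>
    elem_mat m i j z $$ (k, l) = of_bool (k = l) + (if k = i \<and> l = j then z else 0)"
  by (simp add: elem_mat_def)

lemma sum_of_bool_mult:
  fixes f :: "nat \<Rightarrow> complex"
  assumes "k < m"
  shows "(\<Sum>p<m. of_bool (k = p) * f p) = f k" "(\<Sum>p<m. of_bool (p = k) * f p) = f k"
proof -
  have "(\<Sum>p<m. of_bool (k = p) * f p) = (\<Sum>p<m. if k = p then f p else 0)" by (intro sum.cong) auto
  then show "(\<Sum>p<m. of_bool (k = p) * f p) = f k" using assms by simp
  have "(\<Sum>p<m. of_bool (p = k) * f p) = (\<Sum>p<m. if p = k then f p else 0)" by (intro sum.cong) auto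
  then show "(\<Sum>p<m. of_bool (p = k) * f p) = f k" using assms by simp
qed

lemma elem_mat_mult_index:
  assumes "dim_row X = m" "i < m" "j < m" "k < m" "l < dim_col X"
  shows "(elem_mat m i j z * X) $$ (k, l) = X $$ (k, l) + (if k = i then z * X $$ (j, l) else 0)"
proof -
  have "(elem_mat m i j z * X) $$ (k, l) =
      (\<Sum>p<m. of_bool (k = p) * X $$ (p, l) + of_bool (p = j) * ((if k = i then z else 0) * X $$ (p, l)))"
    using assms by (simp add: index_mult_sum elem_mat_index del: index_mult_mat(1))
      (auto intro!: sum.cong simp: algebra_simps)
  then show ?thesis using assms by (simp add: sum.distrib sum_of_bool_mult)
qed

lemma elem_mat_mult_inverse:
  assumes "i \<noteq> j" "i < m" "j < m"
  shows "elem_mat m i j z * elem_mat m i j (- z) = 1\<^sub>m m"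
  by (rule eq_matI)
    (use assms in \<open>auto simp: elem_mat_mult_index elem_mat_index simp del: index_mult_mat(1)\<close>)

lemma elem_mat_GL: "i \<noteq> j \<Longrightarrow> i < m \<Longrightarrow> j < m \<Longrightarrow> elem_mat m i j z \<in> GL m"
  using right_inverse_GL(1)[OF _ _ elem_mat_mult_inverse] by simp

lemma cadj_elem_mat: "cadj (elem_mat m i j z) = elem_mat m j i (cnj z)"
  by (rule eq_matI) (auto simp: elem_mat_index)

lemma mat_diag_torus: "(\<And>i. i < m \<Longrightarrow> f i \<noteq> 0) \<Longrightarrow> mat_diag m f \<in> torus m"
  by (auto simp: torus_def mat_diag_def diagonal_mat_def)

lemma one_torus: "1\<^sub>m m \<in> torus m"
  using mat_diag_torus[of m "\<lambda>_. 1"] by simp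

lemma mat_diag_sandwich_index:
  assumes "X \<in> carrier_mat m m" "p < m" "q < m"
  shows "(mat_diag m f * X * mat_diag m g) $$ (p, q) = f p * X $$ (p, q) * g q"
proof -
  have "mat_diag m f * X = Matrix.mat m m (\<lambda>(i, j). f i * X $$ (i, j))"
    by (rule mat_diag_mult_left[OF assms(1)])
  then show ?thesis using assms by (subst mat_diag_mult_right[of _ m m]) auto
qed

definition mat_lim :: "nat \<Rightarrow> (nat \<Rightarrow> cmat) \<Rightarrow> cmat \<Rightarrow> bool" where
  "mat_lim m F M \<longleftrightarrow> (\<forall>i<m. \<forall>j<m. (\<lambda>k. F k $$ (i, j)) \<longlonglongrightarrow> M $$ (i, j))"

text \<open>The rotation in the \<open>(i, j)\<close>-plane that diagonalises the corresponding \<open>2 \<times> 2\<close> block.\<close>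

definition jacobi :: "nat \<Rightarrow> nat \<Rightarrow> complex \<Rightarrow> real \<Rightarrow> nat \<Rightarrow> nat \<Rightarrow> complex" where
  "jacobi i j a b p q =
    (if q = i then (if p = i then a else if p = j then of_real b else 0)
     else if q = j then (if p = i then - of_real b else if p = j then cnj a else 0)
     else of_bool (p = q))"

lemma cnj_jacobi: "cnj (jacobi i j a b p q) = jacobi i j (cnj a) b p q"
  by (simp add: jacobi_def)

lemma sum_jacobi:
  assumes "i \<noteq> j" "i < m" "j < m" "q < m"
  shows "(\<Sum>p<m. jacobi i j a b p q * f p) =
    (if q = i then a * f i + of_real b * f j else if q = j then cnj a * f j - of_real b * f i else f q)"
proof -
  have "(\<Sum>p<m. jacobi i j a b p q * f p) =
    (\<Sum>p<m. of_bool (p = i) * ((if q = i then a else if q = j then - of_real b else 0) * f p)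
       + of_bool (p = j) * ((if q = i then of_real b else if q = j then cnj a else 0) * f p)
       + of_bool (p = q) * ((if q = i \<or> q = j then 0 else 1) * f p))"
    by (intro sum.cong) (use assms in \<open>auto simp: jacobi_def\<close>)
  then show ?thesis using assms by (auto simp: sum.distrib sum_of_bool_mult)
qed

lemma quad_index:
  assumes "U \<in> carrier_mat m m" "H \<in> carrier_mat m m" "i < m" "j < m"
  shows "(cadj U * (H * U)) $$ (i, j) = (\<Sum>p<m. cnj (U $$ (p, i)) * (\<Sum>q<m. H $$ (p, q) * U $$ (q, j)))"
  using assms by (simp add: index_mult_sum del: index_mult_mat(1))

definition diag_sq :: "nat \<Rightarrow> cmat \<Rightarrow> real" where
  "diag_sq m W = (\<Sum>k<m. (Re (W $$ (k, k)))\<^sup>2)"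

text \<open>\<open>l\<close> is the larger eigenvalue of the Hermitian 2x2 matrix with diagonal
  \<alpha>, \<beta> and off-diagonal entry \<open>h\<close>, and (a, b) is the unit eigenvector
  proportional to (h, l - \<alpha>). The sum of squares of the diagonal grows by 2 |h|^2. That
  \<open>a\<close> is nonzero is what later lets the rotation be factored.\<close>

lemma hermitian_eigenvalue2:
  fixes \<alpha> \<beta> :: real and h :: complex
  assumes "h \<noteq> 0"
  obtains a :: complex and b l :: real where "a \<noteq> 0" "(cmod a)\<^sup>2 + b\<^sup>2 = 1"
    "(cmod a)\<^sup>2 * \<alpha> + b\<^sup>2 * \<beta> + 2 * b * Re (cnj a * h) = l"
    "b\<^sup>2 * \<alpha> + (cmod a)\<^sup>2 * \<beta> - 2 * b * Re (cnj a * h) = \<alpha> + \<beta> - l"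
    "\<alpha>\<^sup>2 + \<beta>\<^sup>2 < l\<^sup>2 + (\<alpha> + \<beta> - l)\<^sup>2"
proof -
  define D where "D = sqrt ((\<alpha> - \<beta>)\<^sup>2 + 4 * (cmod h)\<^sup>2)"
  define l where "l = (\<alpha> + \<beta> + D) / 2"
  have "D\<^sup>2 = (\<alpha> - \<beta>)\<^sup>2 + 4 * (cmod h)\<^sup>2" unfolding D_def by (rule real_sqrt_pow2) simp
  then have h: "(cmod h)\<^sup>2 = (l - \<alpha>) * (l - \<beta>)"
    by (simp add: l_def power2_eq_square field_simps)
  define N where "N = sqrt ((cmod h)\<^sup>2 + (l - \<alpha>)\<^sup>2)"
  have hpos: "(cmod h)\<^sup>2 > 0" using assms by simp
  then have N2: "N\<^sup>2 = (cmod h)\<^sup>2 + (l - \<alpha>)\<^sup>2" "N > 0" unfolding N_def by (auto intro: add_pos_nonneg)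
  define a b where "a = h / of_real N" and "b = (l - \<alpha>) / N"
  have a: "(cmod a)\<^sup>2 = (cmod h)\<^sup>2 / N\<^sup>2" by (simp add: a_def norm_divide power_divide)
  have b: "b\<^sup>2 = (l - \<alpha>)\<^sup>2 / N\<^sup>2" by (simp add: b_def power_divide)
  have "(cmod a)\<^sup>2 + b\<^sup>2 = N\<^sup>2 / N\<^sup>2" by (simp only: a b N2(1) add_divide_distrib)
  then have 1: "(cmod a)\<^sup>2 + b\<^sup>2 = 1" using N2(2) by simp
  have "Re (cnj a * h) = Re (h * cnj h) / N" by (simp add: a_def mult.commute)
  also have "h * cnj h = of_real ((cmod h)\<^sup>2)" by (simp only: complex_norm_square)
  finally have bc: "b * Re (cnj a * h) = (l - \<alpha>) * (cmod h)\<^sup>2 / N\<^sup>2" by (simp add: b_def power2_eq_square)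
  have "(cmod h)\<^sup>2 * \<alpha> + (l - \<alpha>)\<^sup>2 * \<beta> + 2 * ((l - \<alpha>) * (cmod h)\<^sup>2) = l * N\<^sup>2"
    unfolding N2 h by (simp add: power2_eq_square algebra_simps)
  then have "((cmod h)\<^sup>2 * \<alpha> + (l - \<alpha>)\<^sup>2 * \<beta> + 2 * ((l - \<alpha>) * (cmod h)\<^sup>2)) / N\<^sup>2 = l"
    using N2(2) by simp
  then have 2: "(cmod a)\<^sup>2 * \<alpha> + b\<^sup>2 * \<beta> + 2 * b * Re (cnj a * h) = l"
    using bc by (simp add: a b add_divide_distrib mult.assoc)
  have 3: "b\<^sup>2 * \<alpha> + (cmod a)\<^sup>2 * \<beta> - 2 * b * Re (cnj a * h) = \<alpha> + \<beta> - l"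
  proof -
    have "(cmod a)\<^sup>2 * \<alpha> + b\<^sup>2 * \<alpha> = \<alpha>" "(cmod a)\<^sup>2 * \<beta> + b\<^sup>2 * \<beta> = \<beta>"
      using 1 by (metis distrib_right mult_1)+
    then show ?thesis using 2 by linarith
  qed
  have "l\<^sup>2 + (\<alpha> + \<beta> - l)\<^sup>2 = \<alpha>\<^sup>2 + \<beta>\<^sup>2 + 2 * (cmod h)\<^sup>2"
    unfolding h by (simp add: power2_eq_square algebra_simps)
  then have 4: "\<alpha>\<^sup>2 + \<beta>\<^sup>2 < l\<^sup>2 + (\<alpha> + \<beta> - l)\<^sup>2" using hpos by simp
  have "a \<noteq> 0" using assms N2 by (simp add: a_def)
  from that[OF this 1 2 3 4] show thesis .
qed

lemma finite_family_convergent_subseq: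
  fixes f :: "nat \<Rightarrow> 'i \<Rightarrow> complex"
  assumes "finite I" "\<And>k i. i \<in> I \<Longrightarrow> cmod (f k i) \<le> B"
  shows "\<exists>r l. strict_mono (r :: nat \<Rightarrow> nat) \<and> (\<forall>i\<in>I. (\<lambda>k. f (r k) i) \<longlonglongrightarrow> l i)"
  using assms
proof (induction I rule: finite_induct)
  case empty
  then show ?case by (auto intro: strict_mono_id)
next
  case (insert x I)
  have "\<And>k i. i \<in> I \<Longrightarrow> cmod (f k i) \<le> B" using insert.prems by simp
  from insert.IH[OF this] obtain r l where
    r: "strict_mono (r :: nat \<Rightarrow> nat)" "\<And>i. i \<in> I \<Longrightarrow> (\<lambda>k. f (r k) i) \<longlonglongrightarrow> l i"
    by blast
  have "seq_compact (cball (0::complex) B)" by (intro compact_imp_seq_compact compact_cball)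
  moreover have "\<forall>k. f (r k) x \<in> cball 0 B" using insert.prems by simp
  ultimately obtain y s where s: "strict_mono (s :: nat \<Rightarrow> nat)" "((\<lambda>k. f (r k) x) \<circ> s) \<longlonglongrightarrow> y"
    unfolding seq_compact_def by meson
  have "(\<lambda>k. f ((r \<circ> s) k) i) \<longlonglongrightarrow> (if i = x then y else l i)" if "i \<in> insert x I" for i
  proof (cases "i = x")
    case True
    then show ?thesis using s(2) by (simp add: comp_def)
  next
    case False
    then have "(\<lambda>k. f (r k) i) \<longlonglongrightarrow> l i" using r that by auto
    from LIMSEQ_subseq_LIMSEQ[OF this s(1)] show ?thesis using False by (simp add: comp_def)
  qed
  with strict_mono_o[OF r(1) s(1)] show ?case
    by (intro exI[of _ "r \<circ> s"] exI[of _ "\<lambda>i. if i = x then y else l i"]) blast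
qed

lemma unitary_mat_mult:
  assumes "unitary_mat m U" "unitary_mat m V"
  shows "unitary_mat m (U * V)"
proof -
  note u = unitary_matD[OF assms(1)] and v = unitary_matD[OF assms(2)]
  have d: "dim_row U = m" "dim_col U = m" "dim_row V = m" "dim_col V = m" using u v by auto
  have "cadj U * (U * V) = V" by (rule mult_cancel_dims[OF u(2)]) (use d in auto)
  then have "cadj (U * V) * (U * V) = cadj V * V" by (simp add: cadj_mult mult_assoc_dims d)
  then show ?thesis using u v by (simp add: unitary_mat_def)
qed

lemma gram_index:
  assumes "X \<in> carrier_mat m m" "k < m" "l < m"
  shows "(cadj X * X) $$ (k, l) = (\<Sum>p<m. cnj (X $$ (p, k)) * X $$ (p, l))"
  using assms by (simp add: index_mult_sum del: index_mult_mat(1))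

lemma gram_diag_index:
  assumes "X \<in> carrier_mat m m" "k < m"
  shows "(cadj X * X) $$ (k, k) = complex_of_real (\<Sum>p<m. (cmod (X $$ (p, k)))\<^sup>2)"
  using assms by (simp add: gram_index[OF assms assms(2)] complex_norm_square mult.commute del: of_real_power)

lemma unitary_entry_le:
  assumes "unitary_mat m U" "i < m" "j < m"
  shows "cmod (U $$ (i, j)) \<le> 1"
proof -
  note u = unitary_matD[OF assms(1)]
  have "complex_of_real (\<Sum>p<m. (cmod (U $$ (p, j)))\<^sup>2) = 1"
    using gram_diag_index[OF u(1) assms(3)] u(2) assms by simp
  then have "(\<Sum>p<m. (cmod (U $$ (p, j)))\<^sup>2) = 1" unfolding of_real_eq_1_iff .
  then have "(cmod (U $$ (i, j)))\<^sup>2 \<le> 1"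
    using member_le_sum[of i "{..<m}" "\<lambda>p. (cmod (U $$ (p, j)))\<^sup>2"] assms by simp
  then show ?thesis by (simp add: power_le_one_iff)
qed

lemma gram_diag_pos:
  assumes "X \<in> GL m" "k < m"
  shows "0 < (\<Sum>p<m. (cmod (X $$ (p, k)))\<^sup>2)"
proof (rule ccontr)
  note X = GL_D[OF assms(1)]
  assume "\<not> ?thesis"
  then have "(\<Sum>p<m. (cmod (X $$ (p, k)))\<^sup>2) = 0"
    by (meson linorder_not_le antisym sum_nonneg zero_le_power2)
  then have "\<forall>p<m. X $$ (p, k) = 0" by (auto simp: sum_nonneg_eq_0_iff)
  moreover have "(minv X * X) $$ (k, k) = (\<Sum>p<m. minv X $$ (k, p) * X $$ (p, k))"
    using X assms by (subst index_mult_sum) auto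
  ultimately show False using X assms by simp
qed

section \<open>Groups containing the torus\<close>

text \<open>Covers the group of case (ii), both slices of a group of case (i), and all of
  \<open>GL m\<close>, which yields the ordinary spectral theorem. Zariski closedness is replaced by
  its consequence \<open>closed\<close> for entrywise limits, since polynomials are
  continuous.\<close>

locale torus_group =
  fixes m :: nat and G :: "cmat set"
  assumes sub_GL: "G \<subseteq> GL m"
    and mult: "X \<in> G \<Longrightarrow> Y \<in> G \<Longrightarrow> X * Y \<in> G"
    and adj: "X \<in> G \<Longrightarrow> cadj X \<in> G"
    and torus: "torus m \<subseteq> G"
    and closed: "(\<And>k. F k \<in> G) \<Longrightarrow> M \<in> GL m \<Longrightarrow> mat_lim m F M \<Longrightarrow> M \<in> G"
begin

text \<open>Turns out to be an equivalence relation on the indices below \<open>m\<close>, so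
  matrices supported on it are block diagonal up to a permutation.\<close>

definition roots :: "(nat \<times> nat) set" where
  "roots = {(i, j). i < m \<and> j < m \<and> (i = j \<or> (\<forall>z. elem_mat m i j z \<in> G))}"

text \<open>The property that a component of an element of a group of case (i) retains with respect
  to its slice, to which it need not belong.\<close>

definition normalises :: "cmat \<Rightarrow> bool" where
  "normalises Z \<longleftrightarrow> Z \<in> GL m \<and> (\<forall>X\<in>G. Z * X * minv Z \<in> G)"

lemma carrier: "X \<in> G \<Longrightarrow> X \<in> carrier_mat m m"
  using sub_GL GL_D(1) by blast

lemma mat_diag_mem: "(\<And>i. i < m \<Longrightarrow> f i \<noteq> 0) \<Longrightarrow> mat_diag m f \<in> G"
  using mat_diag_torus torus by blast

lemma roots_sym: "(i, j) \<in> roots \<Longrightarrow> (j, i) \<in> roots"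
proof -
  assume *: "(i, j) \<in> roots"
  have "elem_mat m j i z \<in> G" if "i \<noteq> j" for z
  proof -
    have "elem_mat m i j (cnj z) \<in> G" using * that by (simp add: roots_def)
    from adj[OF this] show ?thesis by (simp add: cadj_elem_mat)
  qed
  then show ?thesis using * by (auto simp: roots_def)
qed

text \<open>Conjugating \<open>1 + u Z E\<^sub>k\<^sub>k Z\<^sup>-\<^sup>1\<close> by \<open>diag(r at i, 1/r at j)\<close> with \<open>u = c/r\<^sup>2\<close> and letting
  \<open>r\<close> tend to infinity isolates the \<open>(i, j)\<close> entry.\<close>

lemma normalised_root:
  assumes Z: "normalises Z" and ij: "i < m" "j < m" "k < m" "i \<noteq> j"
    and nz: "Z $$ (i, k) \<noteq> 0" "minv Z $$ (k, j) \<noteq> 0"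
  shows "(i, j) \<in> roots"
proof -
  have "elem_mat m i j z \<in> G" for z
  proof -
    have ZG: "Z \<in> GL m" using Z by (simp add: normalises_def)
    note ZD = GL_D[OF ZG]
    have dims: "dim_row Z = m" "dim_col Z = m" "dim_row (minv Z) = m" "dim_col (minv Z) = m" using ZD by auto
    define P where "P = (\<lambda>p q. Z $$ (p, k) * minv Z $$ (k, q))"
    define c where "c = z / P i j"
    have Pij: "P i j \<noteq> 0" using nz by (simp add: P_def)
    \<comment> \<open>\<open>s n\<close> is the reciprocal of the growing scale \<open>r\<close>;
      the shift \<open>1 + cmod c\<close> keeps \<open>cmod (u n)\<close> below 1, so that
      \<open>1 + u n\<close> is a legitimate torus entry.\<close>
    define s where "s = (\<lambda>n::nat. inverse (real n + (1 + cmod c)))"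
    have "filterlim (\<lambda>n. real n + (1 + cmod c)) at_top sequentially"
      by (rule filterlim_at_top_mono[OF filterlim_real_sequentially]) (simp add: add_nonneg_nonneg)
    then have s0: "s \<longlonglongrightarrow> 0" unfolding s_def by (rule tendsto_inverse_0_at_top)
    have spos: "0 < s n" "s n \<le> 1" "s n * (1 + cmod c) \<le> 1" for n
    proof -
      define w where "w = real n + (1 + cmod c)"
      have "w \<ge> 1" "w \<ge> 1 + cmod c" "s n = 1 / w" by (auto simp: w_def s_def inverse_eq_divide)
      then show "0 < s n" "s n \<le> 1" "s n * (1 + cmod c) \<le> 1" by (simp_all add: divide_le_eq_1)
    qed
    define u where "u = (\<lambda>n. c * of_real ((s n)\<^sup>2))"
    have u1: "1 + u n \<noteq> 0" for n
    proof
      assume "1 + u n = 0"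
      then have "cmod (u n) = 1" by (metis add_eq_0_iff norm_minus_cancel norm_one)
      then have "cmod c * (s n)\<^sup>2 = 1" by (simp add: u_def norm_mult norm_power)
      moreover have "cmod c * (s n)\<^sup>2 \<le> cmod c * s n"
        using spos[of n] by (intro mult_left_mono) (auto simp: power2_eq_square mult_le_one intro: mult_left_le)
      moreover have "cmod c * s n < 1" using spos[of n] by (simp add: algebra_simps)
      ultimately show False by simp
    qed
    define D where "D = (\<lambda>n. mat_diag m (\<lambda>l. if l = k then 1 + u n else 1))"
    define Y where "Y = (\<lambda>n. Z * D n * minv Z)"
    have Y: "Y n \<in> G" for n
    proof -
      have "D n \<in> G" unfolding D_def by (rule mat_diag_mem) (use u1 in auto)
      then show ?thesis using Z by (simp add: normalises_def Y_def)
    qed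
    have Y_index: "Y n $$ (p, q) = of_bool (p = q) + u n * P p q" if "p < m" "q < m" for n p q
    proof -
      have "Z * D n = Matrix.mat m m (\<lambda>(i, j). Z $$ (i, j) * (if j = k then 1 + u n else 1))"
        unfolding D_def by (rule mat_diag_mult_right[OF ZD(1)])
      then have "Y n $$ (p, q) = (\<Sum>l<m. Z $$ (p, l) * minv Z $$ (l, q) + of_bool (l = k) * (u n * (Z $$ (p, l) * minv Z $$ (l, q))))"
        using that dims by (simp add: Y_def index_mult_sum del: index_mult_mat(1))
          (auto intro!: sum.cong simp: algebra_simps)
      also have "\<dots> = (\<Sum>l<m. Z $$ (p, l) * minv Z $$ (l, q)) + u n * P p q"
        using ij by (simp add: sum.distrib sum_of_bool_mult P_def)
      also have "(\<Sum>l<m. Z $$ (p, l) * minv Z $$ (l, q)) = (Z * minv Z) $$ (p, q)"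
        using that dims by (simp add: index_mult_sum del: index_mult_mat(1))
      finally show ?thesis using that ZD by simp
    qed
    define t where "t = (\<lambda>n l. complex_of_real (if l = i then 1 / s n else if l = j then s n else 1))"
    define F where "F = (\<lambda>n. mat_diag m (t n) * Y n * mat_diag m (\<lambda>l. 1 / t n l))"
    have t0: "t n l \<noteq> 0" for n l using spos(1)[of n] by (auto simp: t_def)
    have F: "F n \<in> G" for n unfolding F_def by (intro mult Y mat_diag_mem) (use t0 in auto)
    have F_index: "F n $$ (p, q) = of_bool (p = q) + c * P p q *
        of_real ((if p = i then 1 else s n * (if p = j then s n else 1)) * (if q = j then 1 else s n * (if q = i then s n else 1)))"
      if "p < m" "q < m" for n p q
    proof -
      have "F n $$ (p, q) = t n p * (of_bool (p = q) + u n * P p q) * (1 / t n q)"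
        unfolding F_def using that by (simp add: mat_diag_sandwich_index[OF carrier[OF Y]] Y_index
            del: index_mult_mat(1))
      also have "\<dots> = of_bool (p = q) + c * P p q * (of_real ((s n)\<^sup>2) * t n p * (1 / t n q))"
        using t0[of n q] by (cases "p = q") (simp_all add: field_simps u_def)
      also have "of_real ((s n)\<^sup>2) * t n p * (1 / t n q) =
          complex_of_real ((if p = i then 1 else s n * (if p = j then s n else 1)) * (if q = j then 1 else s n * (if q = i then s n else 1)))"
        using spos(1)[of n] ij by (auto simp: t_def power2_eq_square divide_simps)
      finally show ?thesis .
    qed
    have lim1: "(\<lambda>n. if p = i then 1 else s n * (if p = j then s n else 1)) \<longlonglongrightarrow> of_bool (p = i)" for p i j :: nat
      using s0 tendsto_mult[OF s0 s0] by (cases "p = i"; cases "p = j") auto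
    have "mat_lim m F (elem_mat m i j z)"
      unfolding mat_lim_def
    proof (intro allI impI)
      fix p q assume pq: "p < m" "q < m"
      have "(\<lambda>n. F n $$ (p, q)) \<longlonglongrightarrow> of_bool (p = q) + c * P p q * of_real (of_bool (p = i) * of_bool (q = j))"
        unfolding F_index[OF pq] by (intro tendsto_intros lim1)
      moreover have "of_bool (p = q) + c * P p q * of_real (of_bool (p = i) * of_bool (q = j)) = elem_mat m i j z $$ (p, q)"
        using pq Pij by (auto simp: elem_mat_index c_def)
      ultimately show "(\<lambda>n. F n $$ (p, q)) \<longlonglongrightarrow> elem_mat m i j z $$ (p, q)" by simp
    qed
    from closed[of F, OF F elem_mat_GL[OF ij(4,1,2)] this] show ?thesis .
  qed
  then show ?thesis using ij by (simp add: roots_def)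
qed

text \<open>The case j = k of \<open>normalised_root\<close>: the condition on the inverse becomes
  one on a diagonal entry, which is easy to verify for Gram matrices and for the products in
  \<open>roots_trans\<close>.\<close>

lemma normalised_support:
  assumes "normalises Z" "i < m" "k < m" "Z $$ (i, k) \<noteq> 0" "minv Z $$ (k, k) \<noteq> 0"
  shows "(i, k) \<in> roots"
  using normalised_root[OF assms(1,2,3,3) _ assms(4,5)] assms(2,3) by (cases "i = k") (auto simp: roots_def)

lemma normalises_mult: 
  assumes "normalises Z" "normalises Y"
  shows "normalises (Z * Y)"
  unfolding normalises_def
proof (intro conjI ballI)
  have G: "Z \<in> GL m" "Y \<in> GL m" using assms by (auto simp: normalises_def)
  note D = GL_D[OF G(1)] GL_D[OF G(2)]
  show "Z * Y \<in> GL m" using GL_mult G by blast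
  fix X assume X: "X \<in> G"
  then have "Z * (Y * X * minv Y) * minv Z \<in> G" using assms by (simp add: normalises_def)
  moreover have "dim_row X = m" "dim_col X = m" using carrier[OF X] by auto
  ultimately show "Z * Y * X * minv (Z * Y) \<in> G"
    using D carrier_matD[OF D(1)] carrier_matD[OF D(2)] carrier_matD[OF D(5)] carrier_matD[OF D(6)]
    by (simp only: GL_mult[OF G] mult_assoc_dims index_mult_mat(2,3))
qed

lemma mem_normalises:
  assumes "X \<in> G" "minv X \<in> G" shows "normalises X"
  using assms mult sub_GL by (auto simp: normalises_def)

text \<open>The product of the transvections at (i, j) and (j, k) has entry 1 at (i, k), and its
  inverse has entry 1 at (k, k), so \<open>normalised_support\<close> applies.\<close>

lemma roots_trans:
  assumes "(i, j) \<in> roots" "(j, k) \<in> roots"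
  shows "(i, k) \<in> roots"
proof (cases "i = j \<or> j = k \<or> i = k")
  case True
  then show ?thesis using assms by (auto simp: roots_def)
next
  case False
  then have lt: "i < m" "j < m" "k < m" and E: "\<And>z. elem_mat m i j z \<in> G" "\<And>z. elem_mat m j k z \<in> G"
    using assms by (auto simp: roots_def)
  define Z where "Z = elem_mat m i j 1 * elem_mat m j k 1"
  have "minv (elem_mat m i j 1) = elem_mat m i j (-1)" "minv (elem_mat m j k 1) = elem_mat m j k (-1)"
    using right_inverse_GL(2)[OF _ _ elem_mat_mult_inverse] False lt by auto
  then have Zi: "minv Z = elem_mat m j k (-1) * elem_mat m i j (-1)"
    unfolding Z_def using GL_mult(2)[of "elem_mat m i j 1" m "elem_mat m j k 1"] sub_GL E by auto
  have "normalises Z"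
    by (rule mem_normalises) (use E in \<open>auto simp: Zi intro: mult, simp add: Z_def mult\<close>)
  moreover have "Z $$ (i, k) \<noteq> 0"
    unfolding Z_def using lt False by (simp add: elem_mat_mult_index elem_mat_index del: index_mult_mat(1))
  moreover have "minv Z $$ (k, k) \<noteq> 0"
    unfolding Zi using lt False by (simp add: elem_mat_mult_index elem_mat_index del: index_mult_mat(1))
  ultimately show ?thesis using normalised_support lt by blast
qed

lemma roots_refl: "i < m \<Longrightarrow> (i, i) \<in> roots"
  by (simp add: roots_def)

text \<open>The inverse of X*X is itself a Gram matrix of an invertible matrix, so its diagonal is
  positive and every nonzero entry of X*X sits at a root. X itself can have entries elsewhere, for
  example when it is a permutation matrix.\<close>

lemma normalises_gram:
  assumes "normalises X" "normalises (cadj X)"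
  shows "cadj X * X \<in> hermitian_on m roots"
proof -
  have X: "X \<in> GL m" using assms by (simp add: normalises_def)
  note D = GL_D[OF X]
  have d: "dim_row X = m" "dim_col X = m" "dim_row (minv X) = m" "dim_col (minv X) = m" using D by auto
  have Zi: "minv (cadj X * X) = cadj (cadj (minv X)) * cadj (minv X)"
    using GL_mult(2)[OF GL_cadj(1)[OF X] X] GL_cadj(2)[OF X] by simp
  have "minv (cadj X * X) $$ (k, k) \<noteq> 0" if "k < m" for k
  proof -
    have "cadj (minv X) \<in> GL m" using minv_GL X GL_cadj by blast
    from gram_diag_pos[OF this that] show ?thesis
      unfolding Zi gram_diag_index[OF cadj_carrier[OF D(2)] that] of_real_eq_0_iff by linarith
  qed
  then have "(i, k) \<in> roots" if "i < m" "k < m" "(cadj X * X) $$ (i, k) \<noteq> 0" for i k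
    using normalised_support[OF normalises_mult[OF assms(2,1)] that] that by blast
  moreover have "cadj (cadj X * X) = cadj X * X" by (simp add: cadj_mult d)
  moreover have "cadj X * X \<in> carrier_mat m m" by (rule carrier_matI) (simp_all add: d)
  ultimately show ?thesis by (auto simp: hermitian_on_def)
qed

text \<open>Unitarity bounds the entries, and membership in \<open>G\<close> and the support
  condition pass to entrywise limits, so this is a compact set on which a maximum can be taken. The
  support condition makes conjugation preserve \<open>hermitian_on m roots\<close>.\<close>

definition block_unitaries :: "cmat set" where
  "block_unitaries = {U \<in> G. unitary_mat m U \<and> (\<forall>i<m. \<forall>j<m. (i, j) \<notin> roots \<longrightarrow> U $$ (i, j) = 0)}"

lemma block_unitariesD:
  assumes "U \<in> block_unitaries"
  shows "U \<in> G" "unitary_mat m U" "i < m \<Longrightarrow> j < m \<Longrightarrow> (i, j) \<notin> roots \<Longrightarrow> U $$ (i, j) = 0"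
  using assms by (auto simp: block_unitaries_def)

lemma block_mult_index:
  fixes X Y :: cmat
  assumes "X \<in> carrier_mat m m" "Y \<in> carrier_mat m m"
    and "\<And>i j. i < m \<Longrightarrow> j < m \<Longrightarrow> (i, j) \<notin> roots \<Longrightarrow> X $$ (i, j) = 0"
    and "\<And>i j. i < m \<Longrightarrow> j < m \<Longrightarrow> (i, j) \<notin> roots \<Longrightarrow> Y $$ (i, j) = 0"
    and "i < m" "j < m" "(i, j) \<notin> roots"
  shows "(X * Y) $$ (i, j) = 0"
proof -
  have "X $$ (i, l) * Y $$ (l, j) = 0" if "l < m" for l
  proof (cases "(i, l) \<in> roots")
    case True
    then have "(l, j) \<notin> roots" using roots_trans assms(7) by blast
    then show ?thesis using assms(4)[of l j] assms(6) that by simp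
  next
    case False
    then show ?thesis using assms(3)[of i l] assms(5) that by simp
  qed
  moreover have "(X * Y) $$ (i, j) = (\<Sum>l<m. X $$ (i, l) * Y $$ (l, j))"
    using assms(1,2,5,6) by (subst index_mult_sum) auto
  ultimately show ?thesis using sum.neutral[of "{..<m}" "\<lambda>l. X $$ (i, l) * Y $$ (l, j)"] by auto
qed

lemma block_unitaries_one: "1\<^sub>m m \<in> block_unitaries"
  using torus one_torus unitary_mat_one roots_refl by (auto simp: block_unitaries_def)

lemma block_unitaries_mult:
  assumes "U \<in> block_unitaries" "V \<in> block_unitaries"
  shows "U * V \<in> block_unitaries"
proof -
  note U = block_unitariesD[OF assms(1)] and V = block_unitariesD[OF assms(2)]
  have "(U * V) $$ (i, j) = 0" if "i < m" "j < m" "(i, j) \<notin> roots" for i j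
    by (rule block_mult_index[OF carrier[OF U(1)] carrier[OF V(1)] U(3) V(3) that])
  then show ?thesis using U(1,2) V(1,2) by (auto simp: block_unitaries_def intro: mult unitary_mat_mult)
qed

lemma conj_diag_hermitian_on:
  assumes "U \<in> block_unitaries"
  shows "conj_diag U d \<in> hermitian_on m roots"
proof -
  note U = block_unitariesD[OF assms]
  have Uc: "U \<in> carrier_mat m m" using unitary_matD[OF U(2)] by simp
  have "conj_diag U d $$ (i, j) = 0" if "i < m" "j < m" "(i, j) \<notin> roots" for i j
  proof -
    have "U $$ (i, l) * (complex_of_real (d l) * cnj (U $$ (j, l))) = 0" if l: "l < m" for l
    proof (cases "(i, l) \<in> roots")
      case True
      then have "(j, l) \<notin> roots" using roots_trans roots_sym \<open>(i, j) \<notin> roots\<close> by blast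
      then show ?thesis using U(3) \<open>j < m\<close> l by simp
    qed (use U(3) \<open>i < m\<close> l in simp)
    then have "(\<Sum>l<m. U $$ (i, l) * (complex_of_real (d l) * cnj (U $$ (j, l)))) = 0"
      by (intro sum.neutral) blast
    then show ?thesis using that Uc by (simp add: conj_diag_index)
  qed
  then show ?thesis using Uc by (auto simp: hermitian_on_def cadj_conj_diag)
qed

lemma conj_diag_mem:
  assumes "U \<in> block_unitaries" "\<And>i. d i \<noteq> 0"
  shows "conj_diag U d \<in> G"
proof -
  note U = block_unitariesD[OF assms(1)]
  have d: "dim_col U = m" using carrier[OF U(1)] by simp
  show ?thesis unfolding conj_diag_def d
    by (intro mult mat_diag_mem adj U(1)) (use assms(2) in auto)
qed

lemma hermitian_on_conj:
  assumes H: "H \<in> hermitian_on m roots" and U: "U \<in> block_unitaries"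
  shows "cadj U * (H * U) \<in> hermitian_on m roots"
proof -
  note u = block_unitariesD[OF U]
  have c: "U \<in> carrier_mat m m" "H \<in> carrier_mat m m" using H carrier[OF u(1)] by (auto simp: hermitian_on_def)
  then have d: "dim_row U = m" "dim_col U = m" "dim_row H = m" "dim_col H = m" by auto
  have HU: "(H * U) $$ (i, j) = 0" if "i < m" "j < m" "(i, j) \<notin> roots" for i j
    by (rule block_mult_index) (use H c u(3) that in \<open>auto simp: hermitian_on_def\<close>)
  have cU: "cadj U $$ (i, j) = 0" if "i < m" "j < m" "(i, j) \<notin> roots" for i j
    using that u(3)[of j i] roots_sym d by auto
  have "(cadj U * (H * U)) $$ (i, j) = 0" if "i < m" "j < m" "(i, j) \<notin> roots" for i j
    by (rule block_mult_index[OF _ _ cU HU]) (use c that in auto)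
  moreover have "cadj (cadj U * (H * U)) = cadj U * (H * U)"
    using H by (simp add: cadj_mult mult_assoc_dims d hermitian_on_def)
  ultimately show ?thesis using d by (auto simp: hermitian_on_def intro: carrier_matI)
qed

text \<open>A nonzero off-diagonal entry of \<open>W\<close> can only occur at a root, so the
  transvections in that coordinate plane belong to \<open>G\<close>, and with them the rotation that
  diagonalises the 2x2 block.\<close>

lemma jacobi_step:
  assumes W: "W \<in> hermitian_on m roots" and ij: "i < m" "j < m" "i \<noteq> j" "W $$ (i, j) \<noteq> 0"
  shows "\<exists>J\<in>block_unitaries. diag_sq m W < diag_sq m (cadj J * (W * J))"
proof -
  have Wc: "W \<in> carrier_mat m m" and Wh: "cadj W = W"
    and Ws: "\<And>i j. i < m \<Longrightarrow> j < m \<Longrightarrow> (i, j) \<notin> roots \<Longrightarrow> W $$ (i, j) = 0"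
    using W by (auto simp: hermitian_on_def)
  have root: "(i, j) \<in> roots" using Ws ij by blast
  then have root': "(j, i) \<in> roots" by (rule roots_sym)
  have cW: "W $$ (q, p) = cnj (W $$ (p, q))" if "p < m" "q < m" for p q
    using cadj_index[of q W p] Wh Wc that by simp
  define h where "h = W $$ (i, j)"
  define \<alpha> \<beta> where "\<alpha> = Re (W $$ (i, i))" and "\<beta> = Re (W $$ (j, j))"
  have real_diag: "Im (W $$ (p, p)) = 0" if "p < m" for p
    using arg_cong[OF cW[OF that that], of Im] by simp
  have Wii: "W $$ (i, i) = of_real \<alpha>" "W $$ (j, j) = of_real \<beta>" "W $$ (j, i) = cnj h" "W $$ (i, j) = h"
    using real_diag[OF ij(1)] real_diag[OF ij(2)] cW[OF ij(1,2)]
    by (simp_all add: \<alpha>_def \<beta>_def h_def complex_eq_iff)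
  obtain a :: complex and b l :: real where a: "a \<noteq> 0" and ab: "(cmod a)\<^sup>2 + b\<^sup>2 = 1"
    and e1: "(cmod a)\<^sup>2 * \<alpha> + b\<^sup>2 * \<beta> + 2 * b * Re (cnj a * h) = l"
    and e2: "b\<^sup>2 * \<alpha> + (cmod a)\<^sup>2 * \<beta> - 2 * b * Re (cnj a * h) = \<alpha> + \<beta> - l"
    and gain: "\<alpha>\<^sup>2 + \<beta>\<^sup>2 < l\<^sup>2 + (\<alpha> + \<beta> - l)\<^sup>2"
    using hermitian_eigenvalue2[of h \<alpha> \<beta>] ij(4) by (auto simp: h_def)
  have aa: "a * cnj a = of_real ((cmod a)\<^sup>2)" by (simp only: complex_norm_square)
  have ab': "a * cnj a + of_real b * of_real b = 1"
    unfolding aa using ab by (simp add: power2_eq_square flip: of_real_mult of_real_add)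
  define J where "J = Matrix.mat m m (\<lambda>(p, q). jacobi i j a b p q)"
  have Jc: "J \<in> carrier_mat m m" by (simp add: J_def)
  have dJ: "dim_row J = m" "dim_col J = m" by (simp_all add: J_def)
  have J_index: "J $$ (p, q) = jacobi i j a b p q" if "p < m" "q < m" for p q
    using that by (simp add: J_def)
  have "cadj J * J = 1\<^sub>m m"
  proof (rule eq_matI)
    fix k q assume "k < dim_row (1\<^sub>m m :: cmat)" "q < dim_col (1\<^sub>m m :: cmat)"
    then have kq: "k < m" "q < m" by auto
    have "(cadj J * J) $$ (k, q) = (\<Sum>p<m. jacobi i j (cnj a) b p k * jacobi i j a b p q)"
      using kq by (simp add: gram_index[OF Jc] J_index cnj_jacobi)
    also have "\<dots> = of_bool (k = q)"
      unfolding sum_jacobi[OF ij(3,1,2) kq(1)] using ab' ij by (auto simp: jacobi_def algebra_simps)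
    finally show "(cadj J * J) $$ (k, q) = 1\<^sub>m m $$ (k, q)" using kq by auto
  qed (simp_all add: dJ)
  then have Ju: "unitary_mat m J" using Jc by (simp add: unitary_mat_def)
  define g where "g = (\<lambda>k. if k = i then a else if k = j then 1 / a else 1)"
  define Y where "Y = mat_diag m g * elem_mat m i j (- b / a)"
  have Y: "Y $$ (k, q) = g k * (of_bool (k = q) + (if k = i \<and> q = j then - b / a else 0))"
    if "k < m" "q < m" for k q
    unfolding Y_def using that
    by (subst mat_diag_mult_left[of _ m m]) (simp_all add: elem_mat_index)
  have dY: "dim_row Y = m" "dim_col Y = m" by (simp_all add: Y_def)
  \<comment> \<open>Lower-diagonal-upper factorisation of the rotation block, which has determinant
    1; it needs \<open>a \<noteq> 0\<close> and shows that \<open>J\<close> lies in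
    \<open>G\<close>.\<close>
  have "J = elem_mat m j i (b / a) * Y"
  proof (rule eq_matI)
    fix k q assume "k < dim_row (elem_mat m j i (b / a) * Y)" "q < dim_col (elem_mat m j i (b / a) * Y)"
    then have kq: "k < m" "q < m" by (auto simp: dY)
    have *: "(elem_mat m j i (b / a) * Y) $$ (k, q) = Y $$ (k, q) + (if k = j then b / a * Y $$ (i, q) else 0)"
      by (rule elem_mat_mult_index) (use kq ij dY in auto)
    have "1 / a - of_real b / a * of_real b = cnj a"
    proof -
      have "1 / a - of_real b / a * of_real b = (1 - of_real b * of_real b) / a" by (simp add: diff_divide_distrib)
      also have "1 - of_real b * of_real b = a * cnj a" using ab' by (simp add: algebra_simps)
      finally show ?thesis using a by simp
    qed
    then show "J $$ (k, q) = (elem_mat m j i (b / a) * Y) $$ (k, q)"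
      unfolding * using kq ij a by (auto simp: Y J_index jacobi_def g_def algebra_simps)
  qed (simp_all add: dJ dY)
  moreover have "Y \<in> G" unfolding Y_def
    by (intro mult mat_diag_mem) (use root ij a in \<open>auto simp: roots_def g_def\<close>)
  moreover have "elem_mat m j i (b / a) \<in> G" using root' ij by (auto simp: roots_def)
  ultimately have "J \<in> G" using mult by simp
  moreover have "J $$ (p, q) = 0" if "p < m" "q < m" "(p, q) \<notin> roots" for p q
    using that root root' roots_refl ij by (auto simp: J_index jacobi_def)
  ultimately have JU: "J \<in> block_unitaries" using Ju by (simp add: block_unitaries_def)
  define W' where "W' = cadj J * (W * J)"
  have W'_index: "W' $$ (k, k) = (\<Sum>p<m. jacobi i j (cnj a) b p k * (\<Sum>q<m. jacobi i j a b q k * W $$ (p, q)))"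
    if "k < m" for k
    unfolding W'_def using that by (simp add: quad_index[OF Jc Wc] J_index cnj_jacobi mult.commute)
  have W'o: "W' $$ (k, k) = W $$ (k, k)" if "k < m" "k \<noteq> i" "k \<noteq> j" for k
    using that ij by (simp add: W'_index sum_jacobi)
  have "W' $$ (i, i) = (a * cnj a) * \<alpha> + b * b * \<beta> + b * (cnj a * h + cnj (cnj a * h))"
    using ij by (simp add: W'_index sum_jacobi Wii) (simp add: algebra_simps)
  then have W'i: "Re (W' $$ (i, i)) = l"
    unfolding aa e1[symmetric] by (simp add: power2_eq_square)
  have "W' $$ (j, j) = (a * cnj a) * \<beta> + b * b * \<alpha> - b * (cnj a * h + cnj (cnj a * h))"
    using ij by (simp add: W'_index sum_jacobi Wii) (simp add: algebra_simps)
  then have W'j: "Re (W' $$ (j, j)) = \<alpha> + \<beta> - l"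
    unfolding aa e2[symmetric] by (simp add: power2_eq_square)
  have split: "diag_sq m X = (Re (X $$ (i, i)))\<^sup>2 + (Re (X $$ (j, j)))\<^sup>2 + (\<Sum>k\<in>{..<m} - {i} - {j}. (Re (X $$ (k, k)))\<^sup>2)" for X
    unfolding diag_sq_def using ij by (simp add: sum.remove[of _ i] sum.remove[of _ j])
  have "diag_sq m W < diag_sq m W'"
    unfolding split W'i W'j \<alpha>_def[symmetric] \<beta>_def[symmetric] using gain W'o by simp
  then show ?thesis using JU unfolding W'_def by blast
qed

text \<open>A maximiser of \<open>diag_sq (U* H U)\<close> over the compact set of block unitaries diagonalises \<open>H\<close>,
  since a Jacobi rotation would otherwise increase the value.\<close>

theorem spectral:
  assumes H: "H \<in> hermitian_on m roots"
  shows "\<exists>U\<in>block_unitaries. \<exists>d. H = conj_diag U d"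
proof -
  have Hc: "H \<in> carrier_mat m m" using H by (simp add: hermitian_on_def)
  have dH: "dim_row H = m" "dim_col H = m" using Hc by auto
  define \<phi> where "\<phi> = (\<lambda>U. diag_sq m (cadj U * (H * U)))"
  have Uc: "U \<in> carrier_mat m m" if "U \<in> block_unitaries" for U
    using block_unitariesD(2)[OF that] unitary_matD by blast
  define C where "C = (\<Sum>p<m. \<Sum>q<m. cmod (H $$ (p, q)))"
  have entry: "cmod (U $$ (p, q)) \<le> 1" if "U \<in> block_unitaries" "p < m" "q < m" for U p q
    using unitary_entry_le block_unitariesD(2) that by blast
  have bound: "\<phi> U \<le> real m * C\<^sup>2" if U: "U \<in> block_unitaries" for U
  proof -
    have "(Re ((cadj U * (H * U)) $$ (k, k)))\<^sup>2 \<le> C\<^sup>2" if k: "k < m" for k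
    proof -
      have "cmod ((cadj U * (H * U)) $$ (k, k)) \<le> (\<Sum>p<m. cmod (cnj (U $$ (p, k)) * (\<Sum>q<m. H $$ (p, q) * U $$ (q, k))))"
        unfolding quad_index[OF Uc[OF U] Hc k k] by (rule norm_sum)
      also have "\<dots> \<le> (\<Sum>p<m. 1 * (\<Sum>q<m. cmod (H $$ (p, q)) * 1))"
        unfolding norm_mult
      proof (intro sum_mono mult_mono)
        fix p assume p: "p \<in> {..<m}"
        have "cmod (\<Sum>q<m. H $$ (p, q) * U $$ (q, k)) \<le> (\<Sum>q<m. cmod (H $$ (p, q) * U $$ (q, k)))" by (rule norm_sum)
        also have "\<dots> \<le> (\<Sum>q<m. cmod (H $$ (p, q)) * 1)"
          unfolding norm_mult by (intro sum_mono mult_left_mono) (use entry U k in auto)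
        finally show "cmod (\<Sum>q<m. H $$ (p, q) * U $$ (q, k)) \<le> (\<Sum>q<m. cmod (H $$ (p, q)) * 1)" .
      qed (use entry U k in auto)
      finally have "cmod ((cadj U * (H * U)) $$ (k, k)) \<le> C" by (simp add: C_def)
      then have "\<bar>Re ((cadj U * (H * U)) $$ (k, k))\<bar> \<le> C" using abs_Re_le_cmod order_trans by blast
      then show ?thesis by (metis abs_ge_zero power2_abs power_mono)
    qed
    then have "\<phi> U \<le> (\<Sum>k<m. C\<^sup>2)" unfolding \<phi>_def diag_sq_def by (intro sum_mono) simp
    then show ?thesis by simp
  qed
  define s where "s = (SUP U\<in>block_unitaries. \<phi> U)"
  have bdd: "bdd_above (\<phi> ` block_unitaries)" using bound by (auto intro!: bdd_aboveI2)
  have le_s: "\<phi> U \<le> s" if "U \<in> block_unitaries" for U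
    unfolding s_def using bdd that by (rule cSUP_upper2) simp
  have "\<exists>U\<in>block_unitaries. s - 1 / (real n + 1) < \<phi> U" for n
  proof -
    have "s - 1 / (real n + 1) < s" by simp
    then show ?thesis unfolding s_def using less_cSUP_iff[OF _ bdd] block_unitaries_one by blast
  qed
  then obtain F where F: "\<And>n. F n \<in> block_unitaries" "\<And>n. s - 1 / (real n + 1) < \<phi> (F n)" by metis
  have "\<exists>r l. strict_mono (r :: nat \<Rightarrow> nat) \<and> (\<forall>x\<in>{..<m} \<times> {..<m}. (\<lambda>k. F (r k) $$ x) \<longlonglongrightarrow> l x)"
    by (rule finite_family_convergent_subseq[of _ _ 1]) (use entry F(1) in auto)
  then obtain r l where r: "strict_mono (r :: nat \<Rightarrow> nat)"
    and l: "\<And>p q. p < m \<Longrightarrow> q < m \<Longrightarrow> (\<lambda>k. F (r k) $$ (p, q)) \<longlonglongrightarrow> l (p, q)"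
    by auto
  define U where "U = Matrix.mat m m l"
  have Ucar: "U \<in> carrier_mat m m" by (simp add: U_def)
  have lim: "(\<lambda>k. F (r k) $$ (p, q)) \<longlonglongrightarrow> U $$ (p, q)" if "p < m" "q < m" for p q
    using l that by (simp add: U_def)
  have "cadj U * U = 1\<^sub>m m"
  proof (rule eq_matI)
    fix p q assume "p < dim_row (1\<^sub>m m :: cmat)" "q < dim_col (1\<^sub>m m :: cmat)"
    then have pq: "p < m" "q < m" by auto
    have "(\<lambda>k. (cadj (F (r k)) * F (r k)) $$ (p, q)) \<longlonglongrightarrow> (cadj U * U) $$ (p, q)"
      unfolding gram_index[OF Uc[OF F(1)] pq] gram_index[OF Ucar pq]
      by (intro tendsto_intros lim) (use pq in auto)
    moreover have "(\<lambda>k. (cadj (F (r k)) * F (r k)) $$ (p, q)) = (\<lambda>k. 1\<^sub>m m $$ (p, q))"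
      using unitary_matD(2)[OF block_unitariesD(2)[OF F(1)]] by simp
    ultimately show "(cadj U * U) $$ (p, q) = 1\<^sub>m m $$ (p, q)"
      using LIMSEQ_unique tendsto_const by metis
  qed (use Ucar in auto)
  then have Uu: "unitary_mat m U" using Ucar by (simp add: unitary_mat_def)
  have "U \<in> G"
    by (rule closed[of "\<lambda>k. F (r k)"])
      (use block_unitariesD(1)[OF F(1)] unitary_matD(4)[OF Uu] lim in \<open>auto simp: mat_lim_def\<close>)
  moreover have "U $$ (p, q) = 0" if "p < m" "q < m" "(p, q) \<notin> roots" for p q
  proof -
    have "(\<lambda>k. F (r k) $$ (p, q)) = (\<lambda>k. 0)" using block_unitariesD(3)[OF F(1) that] by simp
    then show ?thesis using lim[OF that(1,2)] LIMSEQ_unique tendsto_const by metis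
  qed
  ultimately have U: "U \<in> block_unitaries" using Uu by (simp add: block_unitaries_def)
  have "(\<lambda>k. \<phi> (F (r k))) \<longlonglongrightarrow> \<phi> U"
  proof -
    have "(\<lambda>k. (cadj (F (r k)) * (H * F (r k))) $$ (p, p)) \<longlonglongrightarrow> (cadj U * (H * U)) $$ (p, p)" if p: "p < m" for p
      unfolding quad_index[OF Uc[OF F(1)] Hc p p] quad_index[OF Ucar Hc p p]
      by (intro tendsto_intros lim) (use p in auto)
    then show ?thesis unfolding \<phi>_def diag_sq_def by (intro tendsto_intros) auto
  qed
  moreover have "(\<lambda>k. \<phi> (F (r k))) \<longlonglongrightarrow> s"
  proof (rule tendsto_sandwich)
    have "(\<lambda>n. s - inverse (real (Suc n))) \<longlonglongrightarrow> s - 0"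
      by (intro tendsto_intros LIMSEQ_inverse_real_of_nat)
    then have "(\<lambda>n. s - 1 / (real n + 1)) \<longlonglongrightarrow> s" by (simp add: inverse_eq_divide add.commute)
    from LIMSEQ_subseq_LIMSEQ[OF this r] show "(\<lambda>k. s - 1 / (real (r k) + 1)) \<longlonglongrightarrow> s" by (simp add: comp_def)
    show "(\<lambda>k. s) \<longlonglongrightarrow> s" by simp
  qed (use less_imp_le[OF F(2)] F(1) le_s in auto)
  ultimately have \<phi>U: "\<phi> U = s" using LIMSEQ_unique by blast
  define W where "W = cadj U * (H * U)"
  have W: "W \<in> hermitian_on m roots" unfolding W_def by (rule hermitian_on_conj[OF H U])
  have dU: "dim_row U = m" "dim_col U = m" using Ucar by auto
  have off: "W $$ (i, j) = 0" if ij: "i < m" "j < m" "i \<noteq> j" for i j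
  proof (rule ccontr)
    assume "W $$ (i, j) \<noteq> 0"
    from jacobi_step[OF W ij this] obtain J where J: "J \<in> block_unitaries" "diag_sq m W < diag_sq m (cadj J * (W * J))"
      by blast
    have dJ: "dim_row J = m" "dim_col J = m" using Uc[OF J(1)] by auto
    have "cadj J * (W * J) = cadj (U * J) * (H * (U * J))"
      unfolding W_def by (simp add: cadj_mult mult_assoc_dims dU dJ dH)
    then have "s < \<phi> (U * J)" using J(2) \<phi>U unfolding \<phi>_def W_def by simp
    then show False using le_s[OF block_unitaries_mult[OF U J(1)]] by simp
  qed
  have Wd: "W = rdiag m (\<lambda>i. Re (W $$ (i, i)))"
  proof (rule eq_matI)
    fix i j assume "i < dim_row (rdiag m (\<lambda>i. Re (W $$ (i, i))))" "j < dim_col (rdiag m (\<lambda>i. Re (W $$ (i, i))))"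
    then have ij: "i < m" "j < m" by auto
    have "cnj (W $$ (i, i)) = W $$ (i, i)"
      using W cadj_index[of i W i] ij by (auto simp: hermitian_on_def)
    then have "Im (W $$ (i, i)) = 0" by (simp add: complex_eq_iff)
    then show "W $$ (i, j) = rdiag m (\<lambda>i. Re (W $$ (i, i))) $$ (i, j)"
      using off ij by (auto simp: mat_diag_def complex_eq_iff)
  qed (use W in \<open>auto simp: hermitian_on_def\<close>)
  have uU: "U * cadj U = 1\<^sub>m m" by (rule unitary_matD[OF Uu])
  have "U * (W * cadj U) = U * (cadj U * (H * (U * cadj U)))"
    unfolding W_def by (simp add: mult_assoc_dims dU dH)
  also have "H * (U * cadj U) = H" using uU Hc by simp
  also have "U * (cadj U * H) = H" by (rule mult_cancel_dims[OF uU]) (simp_all add: dU dH)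
  finally have "H = conj_diag U (\<lambda>i. Re (W $$ (i, i)))"
    unfolding conj_diag_def dU using Wd by metis
  then show ?thesis using U by blast
qed

end

section \<open>The full linear group and Hermitian directions of a group\<close>

lemma torus_group_GL: "torus_group m (GL m)"
proof
  show "torus m \<subseteq> GL m"
  proof
    fix X assume X: "X \<in> torus m"
    then have "X = mat_diag m (\<lambda>i. X $$ (i, i))"
      by (intro eq_matI) (auto simp: torus_def mat_diag_def diagonal_mat_def)
    moreover have "mat_diag m (\<lambda>i. X $$ (i, i)) * mat_diag m (\<lambda>i. 1 / X $$ (i, i)) = 1\<^sub>m m"
      unfolding mat_diag_diag by (rule eq_matI) (use X in \<open>auto simp: torus_def mat_diag_def\<close>)
    ultimately show "X \<in> GL m" using right_inverse_GL(1)[of X m] by (metis mat_diag_dim)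
  qed
qed (auto intro: GL_mult GL_cadj)

text \<open>In the full linear group every pair of indices is a root, so \<open>spectral\<close>
  becomes the usual spectral theorem.\<close>

lemma hermitian_spectral:
  assumes "H \<in> carrier_mat m m" "cadj H = H"
  obtains U d where "unitary_mat m U" "H = conj_diag U d"
proof -
  interpret torus_group m "GL m" by (rule torus_group_GL)
  have "(i, j) \<in> roots" if "i < m" "j < m" for i j
    using that elem_mat_GL by (auto simp: roots_def)
  then have "H \<in> hermitian_on m roots" using assms by (auto simp: hermitian_on_def)
  from spectral[OF this] show thesis using that block_unitariesD(2) by blast
qed

lemma mexp_smult_conj_diag:
  assumes "unitary_mat m U"
  shows "mexp (complex_of_real t \<cdot>\<^sub>m conj_diag U d) = conj_diag U (\<lambda>i. exp (t * d i))"
  using mexp_conj_diag[OF assms] conj_diag_smult[OF unitary_matD(1)[OF assms]] by simp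

text \<open>The derivative of exp(tH) at t = 0 is H, computed here entrywise in an eigenbasis. The
  constant is 0 at pairs outside the roots and an entry of the identity for the trivial factor of
  case (ii).\<close>

lemma mexp_entry_const:
  assumes H: "H \<in> carrier_mat m m" "cadj H = H" and ik: "i < m" "k < m"
    and const: "\<And>t. mexp (complex_of_real t \<cdot>\<^sub>m H) $$ (i, k) = c"
  shows "H $$ (i, k) = 0"
proof -
  obtain U d where U: "unitary_mat m U" "H = conj_diag U d" using hermitian_spectral[OF H] .
  have Uc: "dim_row U = m" "dim_col U = m" using unitary_matD(1)[OF U(1)] by auto
  define f where "f = (\<lambda>t. \<Sum>l<m. U $$ (i, l) * (complex_of_real (exp (t * d l)) * cnj (U $$ (k, l))))"
  have "f t = c" for t
    using const[of t] ik Uc unfolding U(2) mexp_smult_conj_diag[OF U(1)] by (simp add: conj_diag_index f_def)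
  then have "f = (\<lambda>_. c)" by blast
  then have "(f has_vector_derivative 0) (at 0)" by simp
  moreover have "(f has_vector_derivative (\<Sum>l<m. U $$ (i, l) * (complex_of_real (d l) * cnj (U $$ (k, l))))) (at 0)"
  proof -
    have "((\<lambda>t. exp (t * d l)) has_real_derivative d l) (at 0)" for l
      by (auto intro!: derivative_eq_intros)
    then have "((\<lambda>t. complex_of_real (exp (t * d l))) has_vector_derivative complex_of_real (d l)) (at 0)" for l
      using has_vector_derivative_of_real has_real_derivative_iff_has_vector_derivative by blast
    then show ?thesis unfolding f_def
      by (intro has_vector_derivative_sum has_vector_derivative_mult_right has_vector_derivative_mult_left)
  qed
  ultimately have "(\<Sum>l<m. U $$ (i, l) * (complex_of_real (d l) * cnj (U $$ (k, l)))) = 0"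
    using vector_derivative_unique_at by blast
  then show ?thesis using ik Uc by (simp add: U(2) conj_diag_index)
qed

context torus_group
begin

text \<open>\<open>spectral\<close> diagonalises X*X; the eigenvalues are squared lengths of the
  columns of the invertible matrix \<open>X * U\<close>, hence positive.\<close>

lemma polar:
  assumes "normalises X" "normalises (cadj X)"
  shows "\<exists>U\<in>block_unitaries. \<exists>d. (\<forall>i. 0 < d i) \<and> cadj X * X = conj_diag U d"
proof -
  obtain U d where U: "U \<in> block_unitaries" "cadj X * X = conj_diag U d"
    using spectral[OF normalises_gram[OF assms]] by blast
  have u: "unitary_mat m U" by (rule block_unitariesD[OF U(1)])
  note uD = unitary_matD[OF u]
  have X: "X \<in> GL m" using assms by (simp add: normalises_def)
  have dims: "dim_row U = m" "dim_col U = m" "dim_row X = m" "dim_col X = m" using uD GL_D[OF X] by auto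
  have "cadj (X * U) * (X * U) = cadj U * (cadj X * X * U)"
    by (simp add: cadj_mult mult_assoc_dims dims)
  also have "cadj X * X * U = U * (rdiag m d * (cadj U * U))"
    unfolding U(2) by (simp add: conj_diag_def mult_assoc_dims dims)
  also have "\<dots> = U * rdiag m d" using uD by simp
  also have "cadj U * (U * rdiag m d) = rdiag m d"
    by (rule mult_cancel_dims[OF uD(2)]) (simp_all add: dims)
  finally have gram: "cadj (X * U) * (X * U) = rdiag m d" .
  have "0 < d i" if i: "i < m" for i
  proof -
    have XU: "X * U \<in> GL m" using GL_mult X uD by blast
    have "complex_of_real (\<Sum>p<m. (cmod ((X * U) $$ (p, i)))\<^sup>2) = complex_of_real (d i)"
      using gram_diag_index[OF GL_D(1)[OF XU] i] gram i by (simp add: mat_diag_def)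
    then show ?thesis using gram_diag_pos[OF XU i] unfolding of_real_eq_iff by linarith
  qed
  \<comment> \<open>Eigenvalues beyond the dimension are set to 1, because the flow bounds ask for
    positivity at every natural number.\<close>
  moreover have "conj_diag U d = conj_diag U (\<lambda>i. if i < m then d i else 1)"
    by (rule conj_diag_cong) (simp add: dims)
  ultimately show ?thesis using U
    by (intro bexI[of _ U] exI[of _ "\<lambda>i. if i < m then d i else 1"]) auto
qed

lemma mexp_mem:
  assumes "H \<in> hermitian_on m roots"
  shows "mexp (complex_of_real t \<cdot>\<^sub>m H) \<in> G"
proof -
  obtain U d where U: "U \<in> block_unitaries" "H = conj_diag U d" using spectral[OF assms] by blast
  show ?thesis
    unfolding U(2) mexp_smult_conj_diag[OF block_unitariesD(2)[OF U(1)]]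
    by (rule conj_diag_mem[OF U(1)]) simp
qed

text \<open>exp(tH) is the Gram matrix of exp(tH/2), so \<open>normalises_gram\<close> keeps its
  entries outside the roots at 0 for all t; differentiating in t gives the same for H.\<close>

lemma hermitian_on_if_normalises:
  assumes H: "H \<in> carrier_mat m m" "cadj H = H"
    and N: "\<And>t. normalises (mexp (complex_of_real t \<cdot>\<^sub>m H))"
  shows "H \<in> hermitian_on m roots"
proof -
  obtain U d where U: "unitary_mat m U" "H = conj_diag U d" using hermitian_spectral[OF H] .
  have "mexp (complex_of_real t \<cdot>\<^sub>m H) \<in> hermitian_on m roots" for t
  proof -
    let ?X = "mexp (complex_of_real (t / 2) \<cdot>\<^sub>m H)"
    have X: "?X = conj_diag U (\<lambda>i. exp (t / 2 * d i))" unfolding U(2) by (rule mexp_smult_conj_diag[OF U(1)])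
    have "normalises (cadj ?X)" using N[of "t / 2"] unfolding X cadj_conj_diag .
    from normalises_gram[OF N[of "t / 2"] this]
    have "conj_diag U (\<lambda>i. exp (t / 2 * d i) * exp (t / 2 * d i)) \<in> hermitian_on m roots"
      unfolding X cadj_conj_diag conj_diag_mult[OF U(1)] .
    then show ?thesis unfolding U(2) mexp_smult_conj_diag[OF U(1)] by (simp flip: exp_add)
  qed
  then have "H $$ (i, k) = 0" if "i < m" "k < m" "(i, k) \<notin> roots" for i k
    using that mexp_entry_const[OF H that(1,2), of 0] by (simp add: hermitian_on_def)
  then show ?thesis using H by (auto simp: hermitian_on_def)
qed

end

section \<open>Zariski closed sets and limits\<close>

lemma polyfun2_tendsto:
  assumes "p \<in> polyfun2 m n" "mat_lim m (\<lambda>k. fst (F k)) (fst M)" "mat_lim n (\<lambda>k. snd (F k)) (snd M)"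
  shows "(\<lambda>k. p (F k)) \<longlonglongrightarrow> p M"
  using assms by induction (auto intro!: tendsto_intros simp: mat_lim_def)

lemma polyfun1_tendsto:
  assumes "p \<in> polyfun1 m" "mat_lim m F M"
  shows "(\<lambda>k. p (F k)) \<longlonglongrightarrow> p M"
  using assms by induction (auto intro!: tendsto_intros simp: mat_lim_def)

lemma mat_lim_const: "mat_lim m (\<lambda>_. M) M"
  by (simp add: mat_lim_def)

section \<open>Scaling groups\<close>

text \<open>The common abstraction of the two kinds of groups in the theorem.  In the one-sided case
  \<open>Y = 1\<close> always, whence the second alternative in \<open>gram2\<close>.\<close>

locale scaling_group =
  fixes m n :: nat and G :: "(cmat \<times> cmat) set" and R1 R2 :: "(nat \<times> nat) set"
  assumes GL: "(X, Y) \<in> G \<Longrightarrow> X \<in> GL m \<and> Y \<in> GL n"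
    and one: "(1\<^sub>m m, 1\<^sub>m n) \<in> G"
    and mult: "(X, Y) \<in> G \<Longrightarrow> (X', Y') \<in> G \<Longrightarrow> (X * X', Y * Y') \<in> G"
    and inv: "(X, Y) \<in> G \<Longrightarrow> (minv X, minv Y) \<in> G"
    and sym_R: "sym R1" "sym R2"
    and iLieK_eq: "iLieK m n G = hermitian_on m R1 \<times> hermitian_on n R2"
    and gram1: "(X, Y) \<in> G \<Longrightarrow> \<exists>U d. unitary_mat m U \<and> (\<forall>i. 0 < d i) \<and> cadj X * X = conj_diag U d \<and>
      (\<forall>x. conj_diag U x \<in> hermitian_on m R1)"
    and gram2: "(X, Y) \<in> G \<Longrightarrow> \<exists>V e. unitary_mat n V \<and> (\<forall>j. 0 < e j) \<and> cadj Y * Y = conj_diag V e \<and>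
      ((\<forall>y. conj_diag V y \<in> hermitian_on n R2) \<or> (\<forall>j. e j = 1))"

text \<open>\<open>G\<close> need not be the product of its slices \<open>G1\<close> and
  \<open>G2\<close>, yet its Hermitian directions are a product: the components of a one-parameter
  group in \<open>G\<close> normalise the slices, which by \<open>hermitian_on_if_normalises\<close>
  confines each generator to the roots of its slice. The Gram matrices are treated by
  \<open>polar\<close> in the same way.\<close>

lemma scaling_group_pair:
  assumes S: "symmetric_subgroup2 m n G" and T: "torus m \<times> torus n \<subseteq> G"
  shows "\<exists>R1 R2. scaling_group m n G R1 R2"
proof -
  have GGL: "X \<in> GL m \<and> Y \<in> GL n" if "(X, Y) \<in> G" for X Y
    using S that by (auto simp: symmetric_subgroup2_def)
  have one: "(1\<^sub>m m, 1\<^sub>m n) \<in> G" using S by (simp add: symmetric_subgroup2_def)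
  have mult: "(X * X', Y * Y') \<in> G" if "(X, Y) \<in> G" "(X', Y') \<in> G" for X Y X' Y'
    using S that unfolding symmetric_subgroup2_def by force
  have inv: "(minv X, minv Y) \<in> G" if "(X, Y) \<in> G" for X Y
    using S that unfolding symmetric_subgroup2_def by force
  have adj: "(cadj X, cadj Y) \<in> G" if "(X, Y) \<in> G" for X Y
    using S that unfolding symmetric_subgroup2_def by force
  have "\<exists>P \<subseteq> polyfun2 m n. G = {g \<in> GL m \<times> GL n. \<forall>p\<in>P. p g = 0}"
    using S unfolding symmetric_subgroup2_def by blast
  then obtain P where P: "P \<subseteq> polyfun2 m n" "G = {g \<in> GL m \<times> GL n. \<forall>p\<in>P. p g = 0}" by blast
  have closed: "M \<in> G" if F: "\<And>k. F k \<in> G" "M \<in> GL m \<times> GL n" "mat_lim m (\<lambda>k. fst (F k)) (fst M)" "mat_lim n (\<lambda>k. snd (F k)) (snd M)" for F M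
  proof -
    have "p M = 0" if p: "p \<in> P" for p
    proof -
      have "(\<lambda>k. p (F k)) = (\<lambda>_. 0)" using F(1) p P(2) by blast
      then show ?thesis
        using p P(1) polyfun2_tendsto[OF _ F(3,4), of p] LIMSEQ_unique[of "\<lambda>_. 0" "p M" 0] by auto
    qed
    then show ?thesis using F(2) P(2) by blast
  qed
  define G1 G2 where "G1 = {X. (X, 1\<^sub>m n) \<in> G}" and "G2 = {Y. (1\<^sub>m m, Y) \<in> G}"
  interpret A: torus_group m G1
  proof
    show "G1 \<subseteq> GL m" using GGL by (auto simp: G1_def)
    show "X * Y \<in> G1" if "X \<in> G1" "Y \<in> G1" for X Y using mult[of X "1\<^sub>m n" Y "1\<^sub>m n"] that by (simp add: G1_def)
    show "cadj X \<in> G1" if "X \<in> G1" for X using adj[of X "1\<^sub>m n"] that by (simp add: G1_def)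
    show "torus m \<subseteq> G1" using T one_torus by (auto simp: G1_def)
    show "M \<in> G1" if "\<And>k. F k \<in> G1" "M \<in> GL m" "mat_lim m F M" for F M
      using closed[of "\<lambda>k. (F k, 1\<^sub>m n)" "(M, 1\<^sub>m n)"] that by (simp add: G1_def mat_lim_const)
  qed
  interpret B: torus_group n G2
  proof
    show "G2 \<subseteq> GL n" using GGL by (auto simp: G2_def)
    show "X * Y \<in> G2" if "X \<in> G2" "Y \<in> G2" for X Y using mult[of "1\<^sub>m m" X "1\<^sub>m m" Y] that by (simp add: G2_def)
    show "cadj X \<in> G2" if "X \<in> G2" for X using adj[of "1\<^sub>m m" X] that by (simp add: G2_def)
    show "torus n \<subseteq> G2" using T one_torus by (auto simp: G2_def)
    show "M \<in> G2" if "\<And>k. F k \<in> G2" "M \<in> GL n" "mat_lim n F M" for F M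
      using closed[of "\<lambda>k. (1\<^sub>m m, F k)" "(1\<^sub>m m, M)"] that by (simp add: G2_def mat_lim_const)
  qed
  have NA: "A.normalises X" and NB: "B.normalises Y" if XY: "(X, Y) \<in> G" for X Y
  proof -
    have c: "X \<in> GL m" "Y \<in> GL n" using GGL XY by auto
    have "X * Z * minv X \<in> G1" if "Z \<in> G1" for Z
      using mult[OF mult[OF XY] inv[OF XY], of Z "1\<^sub>m n"] that GL_D[OF c(2)] by (simp add: G1_def)
    then show "A.normalises X" using c by (simp add: A.normalises_def)
    have "Y * Z * minv Y \<in> G2" if "Z \<in> G2" for Z
      using mult[OF mult[OF XY] inv[OF XY], of "1\<^sub>m m" Z] that GL_D[OF c(1)] by (simp add: G2_def)
    then show "B.normalises Y" using c by (simp add: B.normalises_def)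
  qed
  have "scaling_group m n G A.roots B.roots"
  proof
    show "iLieK m n G = hermitian_on m A.roots \<times> hermitian_on n B.roots"
    proof (intro equalityI subsetI)
      fix H assume H: "H \<in> iLieK m n G"
      have "fst H \<in> hermitian_on m A.roots"
        by (rule A.hermitian_on_if_normalises) (use H NA in \<open>auto simp: iLieK_def\<close>)
      moreover have "snd H \<in> hermitian_on n B.roots"
        by (rule B.hermitian_on_if_normalises) (use H NB in \<open>auto simp: iLieK_def\<close>)
      ultimately show "H \<in> hermitian_on m A.roots \<times> hermitian_on n B.roots" by (simp add: mem_Times_iff)
    next
      fix H assume H: "H \<in> hermitian_on m A.roots \<times> hermitian_on n B.roots"
      have "(mexp (complex_of_real t \<cdot>\<^sub>m fst H), mexp (complex_of_real t \<cdot>\<^sub>m snd H)) \<in> G" for t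
      proof -
        have "mexp (complex_of_real t \<cdot>\<^sub>m fst H) \<in> G1" "mexp (complex_of_real t \<cdot>\<^sub>m snd H) \<in> G2"
          using A.mexp_mem B.mexp_mem H by auto
        note E = this A.carrier[OF this(1)] B.carrier[OF this(2)]
        have "(mexp (complex_of_real t \<cdot>\<^sub>m fst H) * 1\<^sub>m m, 1\<^sub>m n * mexp (complex_of_real t \<cdot>\<^sub>m snd H)) \<in> G"
          using mult E(1,2) unfolding G1_def G2_def by blast
        then show ?thesis using E(3,4) by simp
      qed
      then show "H \<in> iLieK m n G" using H by (auto simp: iLieK_def hermitian_on_def)
    qed
    fix X Y assume XY: "(X, Y) \<in> G"
    note XY' = adj[OF XY]
    show "\<exists>U d. unitary_mat m U \<and> (\<forall>i. 0 < d i) \<and> cadj X * X = conj_diag U d \<and>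
      (\<forall>x. conj_diag U x \<in> hermitian_on m A.roots)"
      using A.polar[OF NA[OF XY] NA[OF XY']] A.conj_diag_hermitian_on A.block_unitariesD(2) by blast
    show "\<exists>V e. unitary_mat n V \<and> (\<forall>j. 0 < e j) \<and> cadj Y * Y = conj_diag V e \<and>
      ((\<forall>y. conj_diag V y \<in> hermitian_on n B.roots) \<or> (\<forall>j. e j = 1))"
      using B.polar[OF NB[OF XY] NB[OF XY']] B.conj_diag_hermitian_on B.block_unitariesD(2) by blast
  qed (use GGL one mult inv A.roots_sym B.roots_sym in \<open>auto intro: symI\<close>)
  then show ?thesis by blast
qed

text \<open>The right factor is the trivial group, encoded by the empty relation:
  \<open>hermitian_on n {}\<close> contains only the zero matrix.\<close>

lemma scaling_group_left:
  assumes S: "symmetric_subgroup1 m G0" and T: "torus m \<subseteq> G0"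
  shows "\<exists>R1 R2. scaling_group m n (G0 \<times> {1\<^sub>m n}) R1 R2"
proof -
  have GGL: "G0 \<subseteq> GL m" and one: "1\<^sub>m m \<in> G0" and mult: "\<And>X Y. X \<in> G0 \<Longrightarrow> Y \<in> G0 \<Longrightarrow> X * Y \<in> G0"
    and inv: "\<And>X. X \<in> G0 \<Longrightarrow> minv X \<in> G0" and adj: "\<And>X. X \<in> G0 \<Longrightarrow> cadj X \<in> G0"
    using S by (auto simp: symmetric_subgroup1_def)
  have "\<exists>P \<subseteq> polyfun1 m. G0 = {X \<in> GL m. \<forall>p\<in>P. p X = 0}"
    using S unfolding symmetric_subgroup1_def by blast
  then obtain P where P: "P \<subseteq> polyfun1 m" "G0 = {X \<in> GL m. \<forall>p\<in>P. p X = 0}" by blast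
  interpret A: torus_group m G0
  proof
    fix F M assume F: "\<And>k. F k \<in> G0" "M \<in> GL m" "mat_lim m F M"
    have "p M = 0" if p: "p \<in> P" for p
    proof -
      have "(\<lambda>k. p (F k)) = (\<lambda>_. 0)" using F(1) p P(2) by blast
      then show ?thesis
        using p P(1) polyfun1_tendsto[of p m F M] F(3) LIMSEQ_unique[of "\<lambda>_. 0" "p M" 0] by auto
    qed
    then show "M \<in> G0" using F(2) P(2) by blast
  qed (use GGL mult adj T in auto)
  have NA: "A.normalises X" if "X \<in> G0" for X using A.mem_normalises inv that by blast
  have zero: "conj_diag (1\<^sub>m n) (\<lambda>_. 0) = H" if "H \<in> hermitian_on n {}" for H
    using that by (intro eq_matI) (auto simp: hermitian_on_def conj_diag_index)
  have "scaling_group m n (G0 \<times> {1\<^sub>m n}) A.roots {}"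
  proof
    show "iLieK m n (G0 \<times> {1\<^sub>m n}) = hermitian_on m A.roots \<times> hermitian_on n {}"
    proof (intro equalityI subsetI)
      fix H assume H: "H \<in> iLieK m n (G0 \<times> {1\<^sub>m n})"
      have "fst H \<in> hermitian_on m A.roots"
        by (rule A.hermitian_on_if_normalises) (use H NA in \<open>auto simp: iLieK_def\<close>)
      \<comment> \<open>Every exponential in this direction equals the identity, so all of its
        entries are constant in \<open>t\<close>.\<close>
      moreover have "snd H $$ (i, j) = 0" if "i < n" "j < n" for i j
        by (rule mexp_entry_const[of _ n _ _ "1\<^sub>m n $$ (i, j)"]) (use H that in \<open>auto simp: iLieK_def\<close>)
      then have "snd H \<in> hermitian_on n {}" using H by (auto simp: hermitian_on_def iLieK_def)
      ultimately show "H \<in> hermitian_on m A.roots \<times> hermitian_on n {}" by (simp add: mem_Times_iff)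
    next
      fix H assume H: "H \<in> hermitian_on m A.roots \<times> hermitian_on n {}"
      have "mexp (complex_of_real t \<cdot>\<^sub>m snd H) = 1\<^sub>m n" for t
        using mexp_smult_conj_diag[OF unitary_mat_one, of t n "\<lambda>_. 0"] zero[of "snd H"] H
        by (auto simp: conj_diag_one unitary_mat_one)
      then show "H \<in> iLieK m n (G0 \<times> {1\<^sub>m n})" using H A.mexp_mem by (auto simp: iLieK_def hermitian_on_def)
    qed
    fix X Y :: cmat assume XY: "(X, Y) \<in> G0 \<times> {1\<^sub>m n}"
    then have X: "X \<in> G0" by simp
    show "\<exists>U d. unitary_mat m U \<and> (\<forall>i. 0 < d i) \<and> cadj X * X = conj_diag U d \<and>
      (\<forall>x. conj_diag U x \<in> hermitian_on m A.roots)"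
      using A.polar[OF NA[OF X] NA[OF adj[OF X]]] A.conj_diag_hermitian_on A.block_unitariesD(2) by blast
    show "\<exists>V e. unitary_mat n V \<and> (\<forall>j. 0 < e j) \<and> cadj Y * Y = conj_diag V e \<and>
      ((\<forall>y. conj_diag V y \<in> hermitian_on n {}) \<or> (\<forall>j. e j = 1))"
      using XY by (intro exI[of _ "1\<^sub>m n"] exI[of _ "\<lambda>_. 1"]) (auto simp: unitary_mat_one conj_diag_one[OF unitary_mat_one])
  qed (use GGL one mult inv A.roots_sym in \<open>auto intro: symI\<close>)
  then show ?thesis by blast
qed

section \<open>Gradient descent\<close>

text \<open>The flow along the edges from rows to columns; the division by \<open>fsq A\<close>
  gives it total mass 1 when \<open>U\<close> and \<open>V\<close> are unitary.\<close>

definition weight :: "cmat \<Rightarrow> cmat \<Rightarrow> cmat \<Rightarrow> nat \<Rightarrow> nat \<Rightarrow> real" where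
  "weight U V A i j = (cmod ((cadj U * A * V) $$ (i, j)))\<^sup>2 / fsq A"

lemma weight_nonneg: "0 \<le> weight U V A i j"
  by (simp add: weight_def fsq_nonneg)

lemma fsq_weight:
  assumes "X \<in> GL m" "Y \<in> GL n" "A \<in> carrier_mat m n" "unitary_mat m U" "unitary_mat n V"
    and "cadj X * X = conj_diag U d" "cadj Y * Y = conj_diag V e" "\<And>j. e j \<noteq> 0" "fsq A > 0"
  shows "fsq (X * A * minv Y) = fsq A * (\<Sum>i<m. \<Sum>j<n. weight U V A i j * (d i / e j))"
  using assms(9) unfolding fsq_scaled[OF assms(1-8)] by (simp add: weight_def sum_distrib_left)

text \<open>Unitary invariance of the Frobenius norm, read off from \<open>fsq_weight\<close> at X =
  Y = 1, whose Gram matrices are diagonal in every unitary basis.\<close>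

lemma weight_sum:
  assumes A: "A \<in> carrier_mat m n" and U: "unitary_mat m U" and V: "unitary_mat n V" and pos: "fsq A > 0"
  shows "(\<Sum>i<m. \<Sum>j<n. weight U V A i j) = 1"
proof -
  have "fsq (1\<^sub>m m * A * minv (1\<^sub>m n)) = fsq A * (\<Sum>i<m. \<Sum>j<n. weight U V A i j * (1 / 1))"
    by (rule fsq_weight) (use assms in \<open>simp_all add: conj_diag_one[OF U] conj_diag_one[OF V]\<close>)
  then show ?thesis using A pos by simp
qed

lemma mtrace_gram:
  assumes A: "A \<in> carrier_mat m n" and U: "unitary_mat m U" and V: "unitary_mat n V"
  shows "mtrace (conj_diag U x * (A * cadj A)) =
    complex_of_real (\<Sum>i<m. \<Sum>j<n. (cmod ((cadj U * A * V) $$ (i, j)))\<^sup>2 * x i)"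
proof -
  note uD = unitary_matD[OF U] and vD = unitary_matD[OF V]
  have d: "dim_row A = m" "dim_col A = n" "dim_row U = m" "dim_col U = m" "dim_row V = n" "dim_col V = n"
    using A uD vD by auto
  let ?C = "cadj U * A * V"
  have VA: "V * (cadj V * (cadj A * U)) = cadj A * U" by (rule mult_cancel_dims[OF vD(3)]) (simp_all add: d)
  have "mtrace (cadj ?C * (rdiag m x * (?C * rdiag n (\<lambda>_. 1)))) = mtrace (cadj ?C * (rdiag m x * ?C))"
    by (simp add: d right_mult_one_mat[of _ m n] carrier_matI)
  also have "\<dots> = mtrace (rdiag m x * ?C * cadj ?C)" by (rule mtrace_comm) (simp_all add: d)
  also have "rdiag m x * ?C * cadj ?C = rdiag m x * cadj U * (A * cadj A) * U"
    using VA by (simp add: cadj_mult mult_assoc_dims d)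
  also have "mtrace (rdiag m x * cadj U * (A * cadj A) * U) = mtrace (U * (rdiag m x * cadj U * (A * cadj A)))"
    by (rule mtrace_comm) (simp_all add: d)
  also have "U * (rdiag m x * cadj U * (A * cadj A)) = conj_diag U x * (A * cadj A)"
    by (simp add: conj_diag_def mult_assoc_dims d)
  finally have "mtrace (conj_diag U x * (A * cadj A)) = mtrace (cadj ?C * (rdiag m x * (?C * rdiag n (\<lambda>_. 1))))" ..
  also have "\<dots> = complex_of_real (\<Sum>i<m. \<Sum>j<n. (cmod (?C $$ (i, j)))\<^sup>2 * (x i * 1))"
    by (rule mtrace_sandwich, rule carrier_matI) (simp_all add: d)
  finally show ?thesis by simp
qed

text \<open>Zeroing the entries outside a symmetric \<open>R\<close> is the orthogonal projection of
  the Hermitian matrices onto \<open>hermitian_on m R\<close>, so pairings with directions in that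
  space are the same as for the full difference.\<close>

definition masked_moment :: "(nat \<times> nat) set \<Rightarrow> cmat \<Rightarrow> cmat \<Rightarrow> cmat" where
  "masked_moment R A B = Matrix.mat (dim_row A) (dim_row A) (\<lambda>(i, j). if (i, j) \<in> R then
      (A * cadj A) $$ (i, j) / complex_of_real (fsq A) - (cadj B * B) $$ (i, j) / complex_of_real (fsq B) else 0)"

lemma masked_moment_hermitian_on:
  assumes "A \<in> carrier_mat m n" "B \<in> carrier_mat n m" and R: "sym R"
  shows "masked_moment R A B \<in> hermitian_on m R"
proof -
  have d: "dim_row A = m" "dim_col A = n" "dim_row B = n" "dim_col B = m" using assms by auto
  have A: "(A * cadj A) $$ (i, j) = cnj ((A * cadj A) $$ (j, i))" if "i < m" "j < m" for i j
    using cadj_index[of i "A * cadj A" j] that by (simp add: cadj_mult d del: index_mult_mat(1))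
  have B: "(cadj B * B) $$ (i, j) = cnj ((cadj B * B) $$ (j, i))" if "i < m" "j < m" for i j
    using cadj_index[of i "cadj B * B" j] that by (simp add: cadj_mult d del: index_mult_mat(1))
  have "cadj (masked_moment R A B) = masked_moment R A B"
  proof (rule eq_matI)
    fix i j assume "i < dim_row (masked_moment R A B)" "j < dim_col (masked_moment R A B)"
    then have ij: "i < m" "j < m" by (auto simp: masked_moment_def d)
    have "(i, j) \<in> R \<longleftrightarrow> (j, i) \<in> R" using symD[OF R] by blast
    then show "cadj (masked_moment R A B) $$ (i, j) = masked_moment R A B $$ (i, j)"
      using ij A[OF ij] B[OF ij] by (simp add: masked_moment_def d del: index_mult_mat(1))
  qed (simp_all add: masked_moment_def)
  then show ?thesis by (simp add: hermitian_on_def) (simp add: masked_moment_def d)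
qed

lemma mtrace_mult_sum:
  assumes "M \<in> carrier_mat m m" "H \<in> carrier_mat m m"
  shows "mtrace (M * H) = (\<Sum>i<m. \<Sum>l<m. M $$ (i, l) * H $$ (l, i))"
  using assms by (simp add: mtrace_def index_mult_sum del: index_mult_mat(1))

lemma mtrace_masked_moment:
  assumes A: "A \<in> carrier_mat m n" and B: "B \<in> carrier_mat n m"
    and R: "sym R" and H: "H \<in> hermitian_on m R"
  shows "mtrace (cadj (masked_moment R A B) * H) =
    mtrace (H * (A * cadj A)) / complex_of_real (fsq A) - mtrace (H * (cadj B * B)) / complex_of_real (fsq B)"
proof -
  have d: "dim_row A = m" "dim_col A = n" "dim_row B = n" "dim_col B = m" using A B by auto
  have Hc: "H \<in> carrier_mat m m" and H0: "\<And>i j. i < m \<Longrightarrow> j < m \<Longrightarrow> (i, j) \<notin> R \<Longrightarrow> H $$ (i, j) = 0"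
    using H by (auto simp: hermitian_on_def)
  have M: "masked_moment R A B \<in> hermitian_on m R" by (rule masked_moment_hermitian_on) fact+
  have AA: "A * cadj A \<in> carrier_mat m m" and BB: "cadj B * B \<in> carrier_mat m m"
    by (intro carrier_matI; simp add: d)+
  have "mtrace (cadj (masked_moment R A B) * H) = mtrace (masked_moment R A B * H)"
    using M by (simp add: hermitian_on_def)
  also have "\<dots> = (\<Sum>i<m. \<Sum>l<m. masked_moment R A B $$ (i, l) * H $$ (l, i))"
    by (rule mtrace_mult_sum) (use M Hc in \<open>auto simp: hermitian_on_def\<close>)
  also have "\<dots> = (\<Sum>i<m. \<Sum>l<m. (A * cadj A) $$ (i, l) * H $$ (l, i) / complex_of_real (fsq A)
      - (cadj B * B) $$ (i, l) * H $$ (l, i) / complex_of_real (fsq B))"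
  proof (intro sum.cong refl)
    fix i l assume "i \<in> {..<m}" "l \<in> {..<m}"
    then have il: "i < m" "l < m" by auto
    show "masked_moment R A B $$ (i, l) * H $$ (l, i) = (A * cadj A) $$ (i, l) * H $$ (l, i) / complex_of_real (fsq A)
      - (cadj B * B) $$ (i, l) * H $$ (l, i) / complex_of_real (fsq B)"
    proof (cases "(i, l) \<in> R")
      case True
      then show ?thesis using il by (simp add: masked_moment_def d algebra_simps del: index_mult_mat(1))
    next
      case False
      then have "H $$ (l, i) = 0" using H0 il symD[OF R] by blast
      then show ?thesis by simp
    qed
  qed
  also have "\<dots> = mtrace (A * cadj A * H) / complex_of_real (fsq A) - mtrace (cadj B * B * H) / complex_of_real (fsq B)"
    unfolding mtrace_mult_sum[OF AA Hc] mtrace_mult_sum[OF BB Hc] by (simp add: sum_subtractf sum_divide_distrib)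
  also have "mtrace (A * cadj A * H) = mtrace (H * (A * cadj A))" by (rule mtrace_comm) (use Hc d in auto)
  also have "mtrace (cadj B * B * H) = mtrace (H * (cadj B * B))" by (rule mtrace_comm) (use Hc d in auto)
  finally show ?thesis .
qed

text \<open>In the eigenbasis \<open>U\<close> of the direction, the pairing weights each
  \<open>x i\<close> by the divergence of the two flows at vertex \<open>i\<close>. The basis
  \<open>V\<close> on the other side is free, since A A* is unchanged when V V* is inserted between
  the factors.\<close>

lemma masked_moment_pairing:
  assumes A: "A \<in> carrier_mat m n" and B: "B \<in> carrier_mat n m"
    and U: "unitary_mat m U" and V: "unitary_mat n V"
    and R: "sym R" and H: "conj_diag U x \<in> hermitian_on m R"
  shows "mtrace (cadj (masked_moment R A B) * conj_diag U x) =
    complex_of_real ((\<Sum>i<m. \<Sum>j<n. weight U V A i j * x i) - (\<Sum>i<m. \<Sum>j<n. weight V U B j i * x i))"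
proof -
  have d: "dim_row A = m" "dim_col A = n" "dim_row B = n" "dim_col B = m" "dim_row U = m" "dim_col U = m" "dim_row V = n" "dim_col V = n"
    using A B unitary_matD[OF U] unitary_matD[OF V] by auto
  have "cadj U * cadj B * V = cadj (cadj V * B * U)" by (simp add: cadj_mult mult_assoc_dims d)
  then have *: "cmod ((cadj U * cadj B * V) $$ (i, j)) = cmod ((cadj V * B * U) $$ (j, i))" if "i < m" "j < n" for i j
    using that by (simp add: d del: index_mult_mat(1))
  have "mtrace (conj_diag U x * (cadj B * B)) =
    complex_of_real (\<Sum>i<m. \<Sum>j<n. (cmod ((cadj V * B * U) $$ (j, i)))\<^sup>2 * x i)"
    using mtrace_gram[OF cadj_carrier[OF B] U V, of x] * by (simp del: index_mult_mat(1))
  then show ?thesis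
    unfolding mtrace_masked_moment[OF A B R H] mtrace_gram[OF A U V]
    by (simp add: weight_def sum_divide_distrib)
qed

lemma fsq_conj_diag:
  assumes U: "unitary_mat m U"
  shows "fsq (conj_diag U x) = (\<Sum>i<m. (x i)\<^sup>2)"
proof -
  note uD = unitary_matD[OF U]
  have d: "dim_row U = m" "dim_col U = m" using uD by auto
  have "complex_of_real (fsq (conj_diag U x)) = mtrace (conj_diag U (\<lambda>i. x i * x i))"
    by (simp add: cadj_conj_diag conj_diag_mult[OF U] flip: mtrace_cadj_mult)
  also have "\<dots> = mtrace ((rdiag m (\<lambda>i. x i * x i) * cadj U) * U)"
    unfolding conj_diag_def d by (rule mtrace_comm) (simp_all add: d)
  also have "(rdiag m (\<lambda>i. x i * x i) * cadj U) * U = rdiag m (\<lambda>i. x i * x i)"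
    using uD by (simp add: mult_assoc_dims d)
  also have "mtrace \<dots> = complex_of_real (\<Sum>i<m. (x i)\<^sup>2)"
    by (simp add: mtrace_def mat_diag_def power2_eq_square)
  finally show ?thesis unfolding of_real_eq_iff .
qed

section \<open>The real inner product and weighted averages\<close>

lemma ip_self: "ip H H = fsq (fst H) + fsq (snd H)"
  by (simp add: ip_def mtrace_cadj_mult)

lemma Re_mtrace_cadj_mult:
  assumes "V \<in> carrier_mat m m" "H \<in> carrier_mat m m"
  shows "Re (mtrace (cadj V * H)) = (\<Sum>j<m. \<Sum>i<m. Re (cnj (V $$ (i, j)) * H $$ (i, j)))"
  using assms by (simp add: mtrace_def index_mult_sum del: index_mult_mat(1))

lemma Re_mtrace_le:
  assumes "V \<in> carrier_mat m m" "H \<in> carrier_mat m m"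
  shows "2 * Re (mtrace (cadj V * H)) \<le> fsq V + fsq H"
proof -
  have "2 * Re (cnj v * h) \<le> (cmod v)\<^sup>2 + (cmod h)\<^sup>2" for v h
  proof -
    have "0 \<le> (Re v - Re h)\<^sup>2 + (Im v - Im h)\<^sup>2" by simp
    then show ?thesis unfolding cmod_power2 by (simp add: power2_eq_square algebra_simps)
  qed
  then have "(\<Sum>j<m. \<Sum>i<m. 2 * Re (cnj (V $$ (i, j)) * H $$ (i, j)))
      \<le> (\<Sum>j<m. \<Sum>i<m. (cmod (V $$ (i, j)))\<^sup>2 + (cmod (H $$ (i, j)))\<^sup>2)"
    by (intro sum_mono)
  also have "\<dots> = (\<Sum>j<m. \<Sum>i<m. (cmod (V $$ (i, j)))\<^sup>2) + (\<Sum>j<m. \<Sum>i<m. (cmod (H $$ (i, j)))\<^sup>2)"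
    by (simp add: sum.distrib)
  also have "(\<Sum>j<m. \<Sum>i<m. (cmod (V $$ (i, j)))\<^sup>2) = fsq V"
    using assms by (subst sum.swap) (simp add: fsq_def)
  also have "(\<Sum>j<m. \<Sum>i<m. (cmod (H $$ (i, j)))\<^sup>2) = fsq H"
    using assms by (subst sum.swap) (simp add: fsq_def)
  finally show ?thesis unfolding Re_mtrace_cadj_mult[OF assms] by (simp add: sum_distrib_left)
qed

lemma hermitian_on_minus:
  assumes "V \<in> hermitian_on m R" "W \<in> hermitian_on m R"
  shows "V - W \<in> hermitian_on m R"
proof -
  have d: "dim_row V = m" "dim_col V = m" "dim_row W = m" "dim_col W = m" "cadj V = V" "cadj W = W"
    using assms by (auto simp: hermitian_on_def)
  have "cadj (V - W) = V - W"
  proof (rule eq_matI)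
    fix i j assume "i < dim_row (V - W)" "j < dim_col (V - W)"
    then have ij: "i < m" "j < m" using d by auto
    have "cnj (V $$ (j, i)) = V $$ (i, j)" "cnj (W $$ (j, i)) = W $$ (i, j)"
      using cadj_index[of i V j] cadj_index[of i W j] d ij by simp_all
    then show "cadj (V - W) $$ (i, j) = (V - W) $$ (i, j)" using ij d by simp
  qed (use d in auto)
  moreover have "(V - W) $$ (i, j) = 0" if "i < m" "j < m" "(i, j) \<notin> R" for i j
    using that d(1-4) assms by (simp add: hermitian_on_def)
  moreover have "V - W \<in> carrier_mat m m" by (rule carrier_matI) (simp_all add: d(1-4))
  ultimately show ?thesis by (simp add: hermitian_on_def)
qed

lemma Re_mtrace_minus:
  assumes "V \<in> carrier_mat m m" "W \<in> carrier_mat m m"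
  shows "fsq (V - W) = Re (mtrace (cadj V * (V - W))) - Re (mtrace (cadj W * (V - W)))"
proof -
  have VW: "V - W \<in> carrier_mat m m" by (rule minus_carrier_mat) fact
  have "fsq (V - W) = Re (mtrace (cadj (V - W) * (V - W)))" by (simp add: mtrace_cadj_mult)
  also have "\<dots> = (\<Sum>j<m. \<Sum>i<m. Re (cnj (V $$ (i, j)) * (V - W) $$ (i, j)) - Re (cnj (W $$ (i, j)) * (V - W) $$ (i, j)))"
    unfolding Re_mtrace_cadj_mult[OF VW VW] using assms by (intro sum.cong refl) (simp add: algebra_simps)
  also have "\<dots> = Re (mtrace (cadj V * (V - W))) - Re (mtrace (cadj W * (V - W)))"
    unfolding Re_mtrace_cadj_mult[OF assms(1) VW] Re_mtrace_cadj_mult[OF assms(2) VW] by (simp add: sum_subtractf)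
  finally show ?thesis .
qed

lemma fsq_eq_0:
  assumes "V \<in> carrier_mat m m" "W \<in> carrier_mat m m" "fsq (V - W) = 0"
  shows "V = W"
proof -
  have "V - W = 0\<^sub>m m m" using fsq_pos[of "V - W" m m] assms by fastforce
  then have "(V - W) $$ (i, j) = 0" if "i < m" "j < m" for i j using that by simp
  then show ?thesis using assms by (intro eq_matI) auto
qed

lemma weight_avg_le:
  assumes "\<And>i j. i < m \<Longrightarrow> j < n \<Longrightarrow> f i j \<le> c"
    and A: "A \<in> carrier_mat m n" and U: "unitary_mat m U" and V: "unitary_mat n V" and pos: "fsq A > 0"
  shows "(\<Sum>i<m. \<Sum>j<n. weight U V A i j * f i j) \<le> c"
proof -
  have "(\<Sum>i<m. \<Sum>j<n. weight U V A i j * f i j) \<le> (\<Sum>i<m. \<Sum>j<n. weight U V A i j * c)"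
    by (intro sum_mono mult_left_mono weight_nonneg) (use assms(1) in auto)
  also have "\<dots> = c" using weight_sum[OF A U V pos] by (simp flip: sum_distrib_right)
  finally show ?thesis .
qed

lemma weight_exp_pos:
  assumes A: "A \<in> carrier_mat m n" and U: "unitary_mat m U" and V: "unitary_mat n V" and pos: "fsq A > 0"
  shows "0 < (\<Sum>i<m. \<Sum>j<n. weight U V A i j * exp (f i j))"
proof -
  \<comment> \<open>The extra 1 keeps the finite set nonempty; a positive lower bound times total
    mass 1 then bounds the average from below.\<close>
  define c where "c = Min ((\<lambda>(i, j). exp (f i j)) ` ({..<m} \<times> {..<n}) \<union> {1})"
  have c: "0 < c" unfolding c_def by (subst Min_gr_iff) auto
  have "c \<le> exp (f i j)" if "i < m" "j < n" for i j
    unfolding c_def using that by (intro Min_le) auto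
  then have "(\<Sum>i<m. \<Sum>j<n. weight U V A i j * c) \<le> (\<Sum>i<m. \<Sum>j<n. weight U V A i j * exp (f i j))"
    by (intro sum_mono mult_left_mono weight_nonneg) auto
  moreover have "(\<Sum>i<m. \<Sum>j<n. weight U V A i j * c) = c"
    using weight_sum[OF A U V pos] by (simp flip: sum_distrib_right)
  ultimately show ?thesis using c by linarith
qed

section \<open>The cost along one-parameter paths\<close>

lemma fsq_exp_scaled:
  assumes A: "A \<in> carrier_mat m n" and U: "unitary_mat m U" and V: "unitary_mat n V" and pos: "fsq A > 0"
  shows "fsq (conj_diag U (\<lambda>i. exp (t * x i)) * A * minv (conj_diag V (\<lambda>j. exp (t * y j)))) =
    fsq A * (\<Sum>i<m. \<Sum>j<n. weight U V A i j * exp (2 * t * (x i - y j)))"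
proof -
  have "fsq (conj_diag U (\<lambda>i. exp (t * x i)) * A * minv (conj_diag V (\<lambda>j. exp (t * y j)))) =
    fsq A * (\<Sum>i<m. \<Sum>j<n. weight U V A i j * ((exp (t * x i) * exp (t * x i)) / (exp (t * y j) * exp (t * y j))))"
    by (rule fsq_weight) (use A U V pos conj_diag_GL in \<open>auto simp: cadj_conj_diag conj_diag_mult\<close>)
  moreover have "(exp (t * x i) * exp (t * x i)) / (exp (t * y j) * exp (t * y j)) = exp (2 * t * (x i - y j))" for i j
    by (simp add: algebra_simps flip: exp_add exp_diff)
  ultimately show ?thesis by presburger
qed

lemma ln_fsq_derivative:
  assumes A: "A \<in> carrier_mat m n" and U: "unitary_mat m U" and V: "unitary_mat n V" and pos: "fsq A > 0"
  shows "((\<lambda>t. ln (fsq A * (\<Sum>i<m. \<Sum>j<n. weight U V A i j * exp (2 * t * z i j)))) has_real_derivative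
    (\<Sum>i<m. \<Sum>j<n. weight U V A i j * (2 * z i j))) (at 0)"
proof -
  define S where "S = (\<lambda>t. \<Sum>i<m. \<Sum>j<n. weight U V A i j * exp (2 * t * z i j))"
  have S0: "S 0 = 1" using weight_sum[OF A U V pos] by (simp add: S_def)
  have "(S has_real_derivative (\<Sum>i<m. \<Sum>j<n. weight U V A i j * (2 * z i j))) (at 0)"
    unfolding S_def by (intro DERIV_sum) (auto intro!: derivative_eq_intros)
  then have "((\<lambda>t. ln (fsq A * S t)) has_real_derivative
      1 / (fsq A * S 0) * (fsq A * (\<Sum>i<m. \<Sum>j<n. weight U V A i j * (2 * z i j)))) (at 0)"
    using S0 pos by (intro DERIV_ln_divide[THEN DERIV_chain2] DERIV_cmult) auto
  then show ?thesis using S0 pos by (simp add: S_def)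
qed

lemma conj_diag_exp_GL:
  assumes U: "unitary_mat m U" and V: "unitary_mat n V"
  shows "conj_diag U (\<lambda>i. exp (t * x i)) \<in> GL m" "conj_diag V (\<lambda>i. exp (t * y i)) \<in> GL n"
  using conj_diag_GL(1)[OF U] conj_diag_GL(1)[OF V] by auto

lemma orbit_mult:
  assumes "P \<in> GL m" "X \<in> GL m" "Q \<in> GL n" "Y \<in> GL n" "A \<in> carrier_mat m n"
  shows "P * X * A * minv (Q * Y) = P * (X * A * minv Y) * minv Q"
proof -
  note D = GL_D[OF assms(1)] GL_D[OF assms(2)] GL_D[OF assms(3)] GL_D[OF assms(4)]
  have "dim_row P = m" "dim_col P = m" "dim_row X = m" "dim_col X = m" "dim_row A = m" "dim_col A = n"
    "dim_row (minv Y) = n" "dim_col (minv Y) = n" "dim_row (minv Q) = n" "dim_col (minv Q) = n"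
    using D assms(5) by auto
  then show ?thesis unfolding GL_mult(2)[OF assms(3,4)] by (simp add: mult_assoc_dims)
qed

lemma orbit_carrier:
  assumes "X \<in> GL m" "Y \<in> GL n" "A \<in> carrier_mat m n"
  shows "X * A * minv Y \<in> carrier_mat m n"
  using GL_D[OF assms(1)] GL_D[OF assms(2)] assms(3) by auto

lemma orbit_cancel:
  assumes "X \<in> GL m" "Y \<in> GL n" "A \<in> carrier_mat m n"
  shows "minv X * (X * A * minv Y) * minv (minv Y) = A"
proof -
  have "minv X * (X * A * minv Y) * minv (minv Y) = (minv X * X) * A * minv (minv Y * Y)"
    by (rule orbit_mult[symmetric]) (use assms minv_GL in auto)
  then show ?thesis using GL_D[OF assms(1)] GL_D[OF assms(2)] assms(3) by simp
qed

lemma fsq_orbit_pos: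
  assumes X: "X \<in> GL m" and Y: "Y \<in> GL n" and A: "A \<in> carrier_mat m n" and pos: "fsq A > 0"
  shows "fsq (X * A * minv Y) > 0"
proof (rule ccontr)
  assume "\<not> ?thesis"
  then have "X * A * minv Y = 0\<^sub>m m n" using fsq_pos[OF orbit_carrier[OF X Y A]] by blast
  then have "A = minv X * 0\<^sub>m m n * minv (minv Y)" using orbit_cancel[OF X Y A] by simp
  also have "\<dots> = 0\<^sub>m m n" 
    using GL_D(2)[OF X] GL_D(2)[OF minv_GL(1)[OF Y]] by simp
  finally show False using pos by (simp add: fsq_def)
qed

lemma ln_kappaF:
  assumes "fsq A > 0" "fsq B > 0"
  shows "ln (frob A) + ln (frob B) = (ln (fsq A) + ln (fsq B)) / 2" "ln (kappaF A B) = (ln (fsq A) + ln (fsq B)) / 2"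
  using assms by (simp_all add: frob_eq kappaF_def ln_sqrt ln_mult)

lemma costAB_eq:
  assumes X: "X \<in> GL m" and Y: "Y \<in> GL n" and A: "A \<in> carrier_mat m n" and B: "B \<in> carrier_mat n m"
    and pos: "fsq A > 0" "fsq B > 0"
  shows "costAB A B (X, Y) = (ln (fsq (X * A * minv Y)) + ln (fsq (Y * B * minv X))) / 2"
    "costAB A B (X, Y) = ln (kappaF (X * A * minv Y) (Y * B * minv X))"
  using fsq_orbit_pos[OF X Y A] fsq_orbit_pos[OF Y X B] pos by (simp_all add: costAB_def ln_kappaF)

text \<open>In eigenbases of the direction, the cost along the path is half the sum of two functions
  of log-sum-exp type with weights independent of \<open>t\<close>. Both the derivative at 0 and the
  effect of a finite step are read off from this formula.\<close>

lemma costAB_pexp: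
  assumes X: "X \<in> GL m" and Y: "Y \<in> GL n" and A: "A \<in> carrier_mat m n" and B: "B \<in> carrier_mat n m"
    and U: "unitary_mat m U" and V: "unitary_mat n V" and pos: "fsq A > 0" "fsq B > 0"
  defines "A' \<equiv> X * A * minv Y" and "B' \<equiv> Y * B * minv X"
  shows "costAB A B (pexp t (conj_diag U x, conj_diag V y) (X, Y)) =
    (ln (fsq A' * (\<Sum>i<m. \<Sum>j<n. weight U V A' i j * exp (2 * t * (x i - y j)))) +
     ln (fsq B' * (\<Sum>j<n. \<Sum>i<m. weight V U B' j i * exp (2 * t * (y j - x i))))) / 2"
proof -
  let ?P = "conj_diag U (\<lambda>i. exp (t * x i))" and ?Q = "conj_diag V (\<lambda>j. exp (t * y j))"
  have PQ: "?P \<in> GL m" "?Q \<in> GL n" using conj_diag_exp_GL[OF U V] by auto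
  have A': "A' \<in> carrier_mat m n" "fsq A' > 0" and B': "B' \<in> carrier_mat n m" "fsq B' > 0"
    unfolding A'_def B'_def
    using orbit_carrier[OF X Y A] orbit_carrier[OF Y X B] fsq_orbit_pos[OF X Y A] fsq_orbit_pos[OF Y X B] pos by auto
  have "pexp t (conj_diag U x, conj_diag V y) (X, Y) = (?P * X, ?Q * Y)"
    by (simp add: pexp_def mexp_smult_conj_diag[OF U] mexp_smult_conj_diag[OF V])
  moreover have "costAB A B (?P * X, ?Q * Y) = (ln (fsq (?P * A' * minv ?Q)) + ln (fsq (?Q * B' * minv ?P))) / 2"
    unfolding A'_def B'_def costAB_eq[OF GL_mult(1)[OF PQ(1) X] GL_mult(1)[OF PQ(2) Y] A B pos]
      orbit_mult[OF PQ(1) X PQ(2) Y A] orbit_mult[OF PQ(2) Y PQ(1) X B] ..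
  ultimately show ?thesis
    unfolding fsq_exp_scaled[OF A'(1) U V A'(2)] fsq_exp_scaled[OF B'(1) V U B'(2)] by simp
qed

text \<open>The value of the moment map, identified with the gradient in \<open>grad_costAB\<close>;
  in the second component A and B exchange roles.\<close>

definition moment :: "(nat \<times> nat) set \<Rightarrow> (nat \<times> nat) set \<Rightarrow> cmat \<Rightarrow> cmat \<Rightarrow> cmat \<times> cmat" where
  "moment R1 R2 A B = (masked_moment R1 A B, masked_moment R2 B A)"

lemma ip_moment:
  assumes A: "A \<in> carrier_mat m n" and B: "B \<in> carrier_mat n m"
    and U: "unitary_mat m U" and V: "unitary_mat n V"
    and R: "sym R1" "sym R2"
    and H1: "conj_diag U x \<in> hermitian_on m R1" and H2: "conj_diag V y \<in> hermitian_on n R2"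
  shows "ip (moment R1 R2 A B) (conj_diag U x, conj_diag V y) =
    (\<Sum>i<m. \<Sum>j<n. weight U V A i j * (x i - y j)) + (\<Sum>j<n. \<Sum>i<m. weight V U B j i * (y j - x i))"
proof -
  have "(\<Sum>j<n. \<Sum>i<m. weight V U B j i * x i) = (\<Sum>i<m. \<Sum>j<n. weight V U B j i * x i)"
    "(\<Sum>j<n. \<Sum>i<m. weight U V A i j * y j) = (\<Sum>i<m. \<Sum>j<n. weight U V A i j * y j)"
    by (rule sum.swap)+
  then show ?thesis
    by (simp add: ip_def moment_def masked_moment_pairing[OF A B U V R(1) H1] masked_moment_pairing[OF B A V U R(2) H2]
        right_diff_distrib sum_subtractf)
qed

section \<open>The gradient and one descent step\<close>

context scaling_group
begin

lemma moment_mem: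
  assumes "A \<in> carrier_mat m n" "B \<in> carrier_mat n m"
  shows "moment R1 R2 A B \<in> iLieK m n G"
  unfolding iLieK_eq moment_def
  using masked_moment_hermitian_on[OF assms sym_R(1)] masked_moment_hermitian_on[OF assms(2,1) sym_R(2)] by simp

lemma iLieK_diag:
  assumes "H \<in> iLieK m n G"
  obtains U x V y where "unitary_mat m U" "unitary_mat n V" "H = (conj_diag U x, conj_diag V y)"
    "conj_diag U x \<in> hermitian_on m R1" "conj_diag V y \<in> hermitian_on n R2"
proof -
  have H: "fst H \<in> hermitian_on m R1" "snd H \<in> hermitian_on n R2" using assms unfolding iLieK_eq by auto
  obtain U x where U: "unitary_mat m U" "fst H = conj_diag U x"
    by (rule hermitian_spectral[of "fst H" m]) (use H in \<open>auto simp: hermitian_on_def\<close>)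
  obtain V y where V: "unitary_mat n V" "snd H = conj_diag V y"
    by (rule hermitian_spectral[of "snd H" n]) (use H in \<open>auto simp: hermitian_on_def\<close>)
  show thesis
    by (rule that[OF U(1) V(1)]) (use U V H in \<open>auto simp: prod_eq_iff\<close>)
qed

lemma costAB_derivative:
  assumes XY: "(X, Y) \<in> G" and A: "A \<in> carrier_mat m n" and B: "B \<in> carrier_mat n m"
    and pos: "fsq A > 0" "fsq B > 0" and H: "H \<in> iLieK m n G"
  shows "((\<lambda>t. costAB A B (pexp t H (X, Y))) has_real_derivative
    ip (moment R1 R2 (X * A * minv Y) (Y * B * minv X)) H) (at 0)"
proof -
  have X: "X \<in> GL m" and Y: "Y \<in> GL n" using GL XY by auto
  define A' B' where "A' = X * A * minv Y" and "B' = Y * B * minv X"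
  have A': "A' \<in> carrier_mat m n" "fsq A' > 0" and B': "B' \<in> carrier_mat n m" "fsq B' > 0"
    unfolding A'_def B'_def
    using orbit_carrier[OF X Y A] orbit_carrier[OF Y X B] fsq_orbit_pos[OF X Y A] fsq_orbit_pos[OF Y X B] pos by auto
  obtain U x V y where U: "unitary_mat m U" and V: "unitary_mat n V" and H: "H = (conj_diag U x, conj_diag V y)"
    "conj_diag U x \<in> hermitian_on m R1" "conj_diag V y \<in> hermitian_on n R2"
    using iLieK_diag[OF H] .
  have "((\<lambda>t. costAB A B (pexp t H (X, Y))) has_real_derivative
    ((\<Sum>i<m. \<Sum>j<n. weight U V A' i j * (2 * (x i - y j))) + (\<Sum>j<n. \<Sum>i<m. weight V U B' j i * (2 * (y j - x i)))) / 2) (at 0)"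
    unfolding H(1) costAB_pexp[OF X Y A B U V pos, folded A'_def B'_def]
    by (intro DERIV_cdivide DERIV_add ln_fsq_derivative A' B' U V)
  moreover have "((\<Sum>i<m. \<Sum>j<n. weight U V A' i j * (2 * (x i - y j))) + (\<Sum>j<n. \<Sum>i<m. weight V U B' j i * (2 * (y j - x i)))) / 2
      = ip (moment R1 R2 A' B') H"
  proof -
    have "(\<Sum>i<m. \<Sum>j<n. weight U V A' i j * (2 * (x i - y j))) = 2 * (\<Sum>i<m. \<Sum>j<n. weight U V A' i j * (x i - y j))"
      "(\<Sum>j<n. \<Sum>i<m. weight V U B' j i * (2 * (y j - x i))) = 2 * (\<Sum>j<n. \<Sum>i<m. weight V U B' j i * (y j - x i))"
      unfolding sum_distrib_left by (intro sum.cong refl; simp)+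
    then show ?thesis unfolding H(1) ip_moment[OF A'(1) B'(1) U V sym_R H(2,3)] by simp
  qed
  ultimately show ?thesis by (simp add: A'_def B'_def)
qed

text \<open>The definite description in \<open>grad\<close> needs uniqueness: two candidates have
  the same pairing with their difference, which is itself an admissible direction, so the difference
  has norm 0.\<close>

lemma grad_costAB:
  assumes XY: "(X, Y) \<in> G" and A: "A \<in> carrier_mat m n" and B: "B \<in> carrier_mat n m"
    and pos: "fsq A > 0" "fsq B > 0"
  shows "grad m n G (costAB A B) (X, Y) = moment R1 R2 (X * A * minv Y) (Y * B * minv X)"
  unfolding grad_def
proof (rule the_equality)
  let ?M = "moment R1 R2 (X * A * minv Y) (Y * B * minv X)"
  have X: "X \<in> GL m" and Y: "Y \<in> GL n" using GL XY by auto
  have M: "?M \<in> iLieK m n G" by (intro moment_mem orbit_carrier X Y A B)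
  note D = costAB_derivative[OF XY A B pos]
  show "?M \<in> iLieK m n G \<and> (\<forall>H\<in>iLieK m n G. ((\<lambda>t. costAB A B (pexp t H (X, Y))) has_real_derivative ip ?M H) (at 0))"
    using M D by blast
  fix V assume V: "V \<in> iLieK m n G \<and> (\<forall>H\<in>iLieK m n G. ((\<lambda>t. costAB A B (pexp t H (X, Y))) has_real_derivative ip V H) (at 0))"
  define H where "H = (fst V - fst ?M, snd V - snd ?M)"
  have Vm: "fst V \<in> hermitian_on m R1" "snd V \<in> hermitian_on n R2" using V by (auto simp: iLieK_eq)
  have Mm: "fst ?M \<in> hermitian_on m R1" "snd ?M \<in> hermitian_on n R2" using M by (auto simp: iLieK_eq)
  have Hm: "H \<in> iLieK m n G" unfolding iLieK_eq H_def using hermitian_on_minus Vm Mm by simp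
  have c: "fst V \<in> carrier_mat m m" "snd V \<in> carrier_mat n n" "fst ?M \<in> carrier_mat m m" "snd ?M \<in> carrier_mat n n"
    using Vm Mm by (auto simp: hermitian_on_def)
  have "ip V H = ip ?M H" using DERIV_unique D[OF Hm] V Hm by blast
  then have "fsq (fst V - fst ?M) + fsq (snd V - snd ?M) = 0"
    unfolding Re_mtrace_minus[OF c(1,3)] Re_mtrace_minus[OF c(2,4)] by (simp add: ip_def H_def)
  then have "fsq (fst V - fst ?M) = 0" "fsq (snd V - snd ?M) = 0"
    using fsq_nonneg[of "fst V - fst ?M"] fsq_nonneg[of "snd V - snd ?M"] by linarith+
  then show "V = ?M" using fsq_eq_0 c by (metis prod_eqI)
qed

text \<open>A bootstrap: \<open>N\<close> is both the squared norm of the eigenvalues and a sum of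
  two averages of their differences, while each difference is at most the square root of 2 N.
  Comparing linear with quadratic growth bounds \<open>N\<close> absolutely.\<close>

lemma ip_moment_le:
  assumes A: "A \<in> carrier_mat m n" and B: "B \<in> carrier_mat n m" and pos: "fsq A > 0" "fsq B > 0"
    and U: "unitary_mat m U" and V: "unitary_mat n V" and M: "moment R1 R2 A B = (conj_diag U x, conj_diag V y)"
  defines "N \<equiv> ip (moment R1 R2 A B) (moment R1 R2 A B)"
  shows "\<And>i j. i < m \<Longrightarrow> j < n \<Longrightarrow> (x i - y j)\<^sup>2 \<le> 2 * N" "N \<le> 8"
    "N = (\<Sum>i<m. \<Sum>j<n. weight U V A i j * (x i - y j)) + (\<Sum>j<n. \<Sum>i<m. weight V U B j i * (y j - x i))"
proof -
  have N: "N = (\<Sum>i<m. (x i)\<^sup>2) + (\<Sum>j<n. (y j)\<^sup>2)"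
    unfolding N_def ip_self M by (simp add: fsq_conj_diag[OF U] fsq_conj_diag[OF V])
  have mem: "conj_diag U x \<in> hermitian_on m R1" "conj_diag V y \<in> hermitian_on n R2"
    using moment_mem[OF A B] unfolding M iLieK_eq by auto
  show N': "N = (\<Sum>i<m. \<Sum>j<n. weight U V A i j * (x i - y j)) + (\<Sum>j<n. \<Sum>i<m. weight V U B j i * (y j - x i))"
    unfolding N_def using ip_moment[OF A B U V sym_R mem] unfolding M by simp
  show z: "(x i - y j)\<^sup>2 \<le> 2 * N" if "i < m" "j < n" for i j
  proof -
    have "(x i)\<^sup>2 \<le> (\<Sum>i<m. (x i)\<^sup>2)" "(y j)\<^sup>2 \<le> (\<Sum>j<n. (y j)\<^sup>2)"
      using that by (auto intro: member_le_sum)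
    moreover have "(x i - y j)\<^sup>2 + (x i + y j)\<^sup>2 = 2 * (x i)\<^sup>2 + 2 * (y j)\<^sup>2"
      by (simp add: power2_eq_square algebra_simps)
    ultimately show ?thesis using N zero_le_power2[of "x i + y j"] by linarith
  qed
  \<comment> \<open>From (w - 4)^2 >= 0; the number 4 is the extreme value of the differences at N =
    8. Summing the two averages gives N <= 4 + N / 2.\<close>
  have am: "w \<le> 2 + N / 4" if "w\<^sup>2 \<le> 2 * N" for w :: real
    using that zero_le_power2[of "w - 4"] by (simp add: power2_eq_square algebra_simps)
  have "(\<Sum>i<m. \<Sum>j<n. weight U V A i j * (x i - y j)) \<le> 2 + N / 4"
    by (rule weight_avg_le[OF _ A U V pos(1)]) (use am z in blast)
  moreover have "(\<Sum>j<n. \<Sum>i<m. weight V U B j i * (y j - x i)) \<le> 2 + N / 4"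
    by (rule weight_avg_le[OF _ B V U pos(2)]) (use am z in \<open>metis power2_commute\<close>)
  ultimately show "N \<le> 8" using N' by linarith
qed

text \<open>A step multiplies each weight by exp(-z/4) with z^2 <= 2 N <= 16, where
  \<open>exp_le_quadratic\<close> applies. Each logarithm falls by a quarter of the average of z up
  to an error 3 N / 32. The two averages add up to \<open>N\<close>, and the cost is half the sum of
  the logarithms, so the gain is N / 8 - 3 N / 32.\<close>

lemma descent:
  assumes XY: "(X, Y) \<in> G" and A: "A \<in> carrier_mat m n" and B: "B \<in> carrier_mat n m"
    and pos: "fsq A > 0" "fsq B > 0"
  defines "M \<equiv> moment R1 R2 (X * A * minv Y) (Y * B * minv X)"
  shows "costAB A B (pexp (- (1/8)) M (X, Y)) \<le> costAB A B (X, Y) - ip M M / 32"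
proof -
  have X: "X \<in> GL m" and Y: "Y \<in> GL n" using GL XY by auto
  define A' B' where "A' = X * A * minv Y" and "B' = Y * B * minv X"
  have A': "A' \<in> carrier_mat m n" "fsq A' > 0" and B': "B' \<in> carrier_mat n m" "fsq B' > 0"
    unfolding A'_def B'_def
    using orbit_carrier[OF X Y A] orbit_carrier[OF Y X B] fsq_orbit_pos[OF X Y A] fsq_orbit_pos[OF Y X B] pos by auto
  obtain U x V y where U: "unitary_mat m U" and V: "unitary_mat n V" and H: "M = (conj_diag U x, conj_diag V y)"
    using iLieK_diag[OF moment_mem[OF A'(1) B'(1)]] unfolding M_def A'_def B'_def by metis
  define N where "N = ip M M"
  note b = ip_moment_le[OF A'(1) B'(1) A'(2) B'(2) U V H[unfolded M_def, folded A'_def B'_def],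
      unfolded A'_def B'_def, folded M_def N_def, folded A'_def B'_def]
  have step: "ln (fsq C * (\<Sum>i<p. \<Sum>j<q. weight S T C i j * exp (2 * - (1/8) * z i j))) \<le>
      ln (fsq C) - (\<Sum>i<p. \<Sum>j<q. weight S T C i j * z i j) / 4 + 3 / 32 * N"
    if C: "C \<in> carrier_mat p q" "fsq C > 0" and ST: "unitary_mat p S" "unitary_mat q T"
      and z: "\<And>i j. i < p \<Longrightarrow> j < q \<Longrightarrow> (z i j)\<^sup>2 \<le> 2 * N" for C S T p q z
  proof -
    let ?E = "\<Sum>i<p. \<Sum>j<q. weight S T C i j * exp (2 * - (1/8) * z i j)"
    have E: "?E > 0" by (rule weight_exp_pos[OF C(1) ST C(2)])
    have "exp (2 * - (1/8) * z i j) \<le> 1 - z i j / 4 + 3 / 32 * N" if "i < p" "j < q" for i j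
    proof -
      have "(z i j)\<^sup>2 \<le> 4\<^sup>2" using z[OF that] b(2) by simp
      then have "\<bar>z i j\<bar> \<le> 4" by (simp add: abs_le_square_iff[of "z i j" 4, simplified])
      then have "exp (- (z i j / 4)) \<le> 1 + - (z i j / 4) + 3 / 4 * (- (z i j / 4))\<^sup>2"
        by (intro exp_le_quadratic) simp
      also have "\<dots> \<le> 1 - z i j / 4 + 3 / 32 * N" using z[OF that] by (simp add: power_divide)
      finally show ?thesis by simp
    qed
    then have "exp (2 * - (1/8) * z i j) + z i j / 4 \<le> 1 + 3 / 32 * N" if "i < p" "j < q" for i j
      using that by force
    from weight_avg_le[OF this C(1) ST C(2)]
    have "?E + (\<Sum>i<p. \<Sum>j<q. weight S T C i j * z i j) / 4 \<le> 1 + 3 / 32 * N"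
      by (simp add: distrib_left sum.distrib sum_divide_distrib)
    then show ?thesis using ln_le_minus_one[OF E] E C(2) by (simp add: ln_mult)
  qed
  have combine: "c \<le> c' - N / 32" if "c = (l1 + l2) / 2" "l1 \<le> a - p / 4 + 3 / 32 * N"
    "l2 \<le> b - q / 4 + 3 / 32 * N" "c' = (a + b) / 2" "N = p + q" for c c' l1 l2 a b p q
    using that by (simp add: field_simps)
  have "costAB A B (pexp (- (1/8)) M (X, Y)) =
    (ln (fsq A' * (\<Sum>i<m. \<Sum>j<n. weight U V A' i j * exp (2 * - (1/8) * (x i - y j)))) +
     ln (fsq B' * (\<Sum>j<n. \<Sum>i<m. weight V U B' j i * exp (2 * - (1/8) * (y j - x i))))) / 2"
    unfolding H A'_def B'_def by (rule costAB_pexp[OF X Y A B U V pos])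
  moreover have "ln (fsq A' * (\<Sum>i<m. \<Sum>j<n. weight U V A' i j * exp (2 * - (1/8) * (x i - y j)))) \<le>
      ln (fsq A') - (\<Sum>i<m. \<Sum>j<n. weight U V A' i j * (x i - y j)) / 4 + 3 / 32 * N"
    by (rule step[OF A' U V b(1)])
  moreover have "ln (fsq B' * (\<Sum>j<n. \<Sum>i<m. weight V U B' j i * exp (2 * - (1/8) * (y j - x i)))) \<le>
      ln (fsq B') - (\<Sum>j<n. \<Sum>i<m. weight V U B' j i * (y j - x i)) / 4 + 3 / 32 * N"
    by (rule step[OF B' V U]) (use b(1) in \<open>metis power2_commute\<close>)
  moreover have "costAB A B (X, Y) = (ln (fsq A') + ln (fsq B')) / 2"
    unfolding A'_def B'_def by (rule costAB_eq[OF X Y A B pos])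
  ultimately show ?thesis using b(3) unfolding N_def[symmetric] by (rule combine)
qed

end

section \<open>Near-stationary points and convergence\<close>

context scaling_group
begin

text \<open>A bound over the whole group from data at the identity: X and Y enter only through the
  spectral data of X*X and Y*Y, and \<open>fsq_weight\<close> rewrites both norms as the weighted
  sums in the flow bounds.\<close>

lemma moment_stationary:
  assumes A: "A \<in> carrier_mat m n" and B: "B \<in> carrier_mat n m" and pos: "fsq A > 0" "fsq B > 0"
    and XY: "(X, Y) \<in> G" and mn: "0 < m"
    and \<delta>: "0 \<le> \<delta>" "\<delta> \<le> 1" "real (m + n) ^ 3 * ip (moment R1 R2 A B) (moment R1 R2 A B) \<le> 4 * \<delta>\<^sup>2"
  shows "(1 - \<delta>)\<^sup>2 * (fsq A * fsq B) \<le> fsq (X * A * minv Y) * fsq (Y * B * minv X)"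
proof -
  have X: "X \<in> GL m" and Y: "Y \<in> GL n" using GL XY by auto
  define M1 M2 where "M1 = masked_moment R1 A B" and "M2 = masked_moment R2 B A"
  define N where "N = fsq M1 + fsq M2"
  have N: "ip (moment R1 R2 A B) (moment R1 R2 A B) = N" by (simp add: ip_self moment_def N_def M1_def M2_def)
  have Mc: "M1 \<in> carrier_mat m m" "M2 \<in> carrier_mat n n"
    using masked_moment_hermitian_on[OF A B sym_R(1)] masked_moment_hermitian_on[OF B A sym_R(2)]
    by (auto simp: M1_def M2_def hermitian_on_def)
  obtain U d where U: "unitary_mat m U" and d: "\<And>i. 0 < d i" "cadj X * X = conj_diag U d"
    and UR: "\<And>x. conj_diag U x \<in> hermitian_on m R1" using gram1[OF XY] by blast
  obtain V e where V: "unitary_mat n V" and e: "\<And>j. 0 < e j" "cadj Y * Y = conj_diag V e"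
    and VR: "(\<forall>y. conj_diag V y \<in> hermitian_on n R2) \<or> (\<forall>j. e j = 1)" using gram2[OF XY] by blast
  define pA pB where "pA = weight U V A" and "pB = weight V U B"
  have swap: "(\<Sum>i<m. \<Sum>j<n. pB j i * f i j) = (\<Sum>j<n. \<Sum>i<m. pB j i * f i j)" for f by (rule sum.swap)
  have pA: "0 \<le> pA i j" "(\<Sum>i<m. \<Sum>j<n. pA i j) = 1" for i j
    using weight_nonneg weight_sum[OF A U V pos(1)] by (auto simp: pA_def)
  have pB: "0 \<le> pB j i" "(\<Sum>i<m. \<Sum>j<n. pB j i) = 1" for i j
    using weight_nonneg weight_sum[OF B V U pos(2)] swap[of "\<lambda>_ _. 1"] by (auto simp: pB_def)
  define D E where "D = (\<lambda>i. (\<Sum>j<n. pA i j) - (\<Sum>j<n. pB j i))" and "E = (\<lambda>j. (\<Sum>i<m. pB j i) - (\<Sum>i<m. pA i j))"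
  \<comment> \<open>\<open>conj_diag U D\<close> is an admissible direction whose squared norm and
    whose pairing with \<open>M1\<close> are both the sum of the squares of \<open>D\<close>. Hence
    \<open>Re_mtrace_le\<close> bounds that sum by \<open>fsq M1\<close>, although \<open>M1\<close>
    need not be diagonal in the basis \<open>U\<close>.\<close>
  have D: "(\<Sum>i<m. (D i)\<^sup>2) \<le> fsq M1"
  proof -
    have "mtrace (cadj M1 * conj_diag U D) = complex_of_real (\<Sum>i<m. (D i)\<^sup>2)"
      unfolding M1_def masked_moment_pairing[OF A B U V sym_R(1) UR]
      by (simp add: D_def pA_def pB_def power2_eq_square left_diff_distrib sum_subtractf sum_distrib_right)
    then have "2 * (\<Sum>i<m. (D i)\<^sup>2) \<le> fsq M1 + fsq (conj_diag U D)"
      using Re_mtrace_le[OF Mc(1), of "conj_diag U D"] unitary_matD[OF U] by simp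
    then show ?thesis by (simp add: fsq_conj_diag[OF U])
  qed
  have A': "fsq (X * A * minv Y) = fsq A * (\<Sum>i<m. \<Sum>j<n. pA i j * (d i / e j))"
    unfolding pA_def by (rule fsq_weight[OF X Y A U V d(2) e(2) _ pos(1)]) (use e(1) less_irrefl in metis)
  have B': "fsq (Y * B * minv X) = fsq B * (\<Sum>i<m. \<Sum>j<n. pB j i * (e j / d i))"
    unfolding swap unfolding pB_def
    by (rule fsq_weight[OF Y X B V U e(2) d(2) _ pos(2)]) (use d(1) less_irrefl in metis)
  have "(1 - \<delta>)\<^sup>2 \<le> (\<Sum>i<m. \<Sum>j<n. pA i j * (d i / e j)) * (\<Sum>i<m. \<Sum>j<n. pB j i * (e j / d i))"
    using VR
  proof
    assume VR: "\<forall>y. conj_diag V y \<in> hermitian_on n R2"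
    have "(\<Sum>j<n. (E j)\<^sup>2) \<le> fsq M2"
    proof -
      have "mtrace (cadj M2 * conj_diag V E) = complex_of_real (\<Sum>j<n. (E j)\<^sup>2)"
        unfolding M2_def masked_moment_pairing[OF B A V U sym_R(2) VR[rule_format]]
        by (simp add: E_def pA_def pB_def power2_eq_square left_diff_distrib sum_subtractf sum_distrib_right)
      then have "2 * (\<Sum>j<n. (E j)\<^sup>2) \<le> fsq M2 + fsq (conj_diag V E)"
        using Re_mtrace_le[OF Mc(2), of "conj_diag V E"] unitary_matD[OF V] by simp
      then show ?thesis by (simp add: fsq_conj_diag[OF V])
    qed
    then show ?thesis
      by (intro bipartite_flow_bound[where W = N] pA pB d(1) e(1) \<delta>(1,2))
        (use D \<delta>(3) in \<open>auto simp: N D_def E_def N_def\<close>)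
  next
    assume "\<forall>j. e j = 1"
    moreover have "(1 - \<delta>)\<^sup>2 \<le> (\<Sum>i<m. \<Sum>j<n. pA i j * d i) * (\<Sum>i<m. \<Sum>j<n. pB j i / d i)"
    proof (rule one_sided_flow_bound[where W = N])
      show "(\<Sum>i<m. ((\<Sum>j<n. pA i j) - (\<Sum>j<n. pB j i))\<^sup>2) \<le> N"
        using D fsq_nonneg[of M2] by (simp add: D_def N_def)
      \<comment> \<open>The one-sided estimate has the smaller factor m; it is weakened to (m + n)^3
        so that both kinds of groups share one hypothesis.\<close>
      have "real m * N \<le> real (m + n) ^ 3 * N"
      proof (rule mult_right_mono)
        have "real m \<le> real (m + n)" by simp
        also have "\<dots> \<le> real (m + n) ^ 3" using mn by (intro self_le_power) auto
        finally show "real m \<le> real (m + n) ^ 3" .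
      qed (simp add: N_def fsq_nonneg)
      then show "real m * N \<le> 4 * \<delta>\<^sup>2" using \<delta>(3) unfolding N by linarith
    qed (use pA pB d(1) \<delta> in auto)
    ultimately show ?thesis by simp
  qed
  then have "(1 - \<delta>)\<^sup>2 * (fsq A * fsq B) \<le>
      ((\<Sum>i<m. \<Sum>j<n. pA i j * (d i / e j)) * (\<Sum>i<m. \<Sum>j<n. pB j i * (e j / d i))) * (fsq A * fsq B)"
    using pos by (intro mult_right_mono) auto
  then show ?thesis unfolding A' B' by (simp add: mult_ac)
qed

lemma kappa_star_le:
  assumes "(X, Y) \<in> G"
  shows "kappa_star G A B \<le> kappaF (X * A * minv Y) (Y * B * minv X)"
  unfolding kappa_star_def
proof (rule cINF_lower2[OF _ assms])
  show "bdd_below ((\<lambda>g. kappaF (fst g * A * minv (snd g)) (snd g * B * minv (fst g))) ` G)"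
    by (intro bdd_belowI2[of _ 0]) (simp add: kappaF_def frob_eq fsq_nonneg)
qed simp

text \<open>Any point of \<open>G\<close> is reached from (X, Y) by an element of \<open>G\<close>,
  so \<open>moment_stationary\<close> applies with the current matrices as base point. Square roots
  turn its factor (1 - \<delta>)^2 for squared norms into 1 - \<delta>.\<close>

lemma gap_le:
  assumes A: "A \<in> carrier_mat m n" and B: "B \<in> carrier_mat n m" and pos: "fsq A > 0" "fsq B > 0"
    and XY: "(X, Y) \<in> G" and m: "0 < m" and \<delta>: "0 \<le> \<delta>" "\<delta> \<le> 1"
  defines "M \<equiv> moment R1 R2 (X * A * minv Y) (Y * B * minv X)"
  assumes small: "real (m + n) ^ 3 * ip M M \<le> 4 * \<delta>\<^sup>2"
  shows "(1 - \<delta>) * kappaF (X * A * minv Y) (Y * B * minv X) \<le> kappa_star G A B"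
  unfolding kappa_star_def
proof (rule cINF_greatest)
  show "G \<noteq> {}" using one by blast
  fix g assume g: "g \<in> G"
  obtain X' Y' where g_eq: "g = (X', Y')" by (cases g)
  have X: "X \<in> GL m" and Y: "Y \<in> GL n" and X': "X' \<in> GL m" and Y': "Y' \<in> GL n"
    using GL XY g g_eq by auto
  define A' B' where "A' = X * A * minv Y" and "B' = Y * B * minv X"
  have A': "A' \<in> carrier_mat m n" "fsq A' > 0" and B': "B' \<in> carrier_mat n m" "fsq B' > 0"
    unfolding A'_def B'_def
    using orbit_carrier[OF X Y A] orbit_carrier[OF Y X B] fsq_orbit_pos[OF X Y A] fsq_orbit_pos[OF Y X B] pos by auto
  have h: "(X' * minv X, Y' * minv Y) \<in> G" using mult[OF _ inv[OF XY]] g g_eq by blast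
  have tA: "(X' * minv X) * A' * minv (Y' * minv Y) = X' * A * minv Y'"
    and tB: "(Y' * minv Y) * B' * minv (X' * minv X) = Y' * B * minv X'"
    unfolding orbit_mult[OF X' minv_GL(1)[OF X] Y' minv_GL(1)[OF Y] A'(1)]
      orbit_mult[OF Y' minv_GL(1)[OF Y] X' minv_GL(1)[OF X] B'(1)]
    unfolding A'_def B'_def orbit_cancel[OF X Y A] orbit_cancel[OF Y X B] by (rule refl)+
  have "(1 - \<delta>)\<^sup>2 * (fsq A' * fsq B') \<le> fsq (X' * A * minv Y') * fsq (Y' * B * minv X')"
    using moment_stationary[OF A'(1) B'(1) A'(2) B'(2) h m \<delta>] small[unfolded M_def, folded A'_def B'_def]
    unfolding tA tB by blast
  then have "sqrt ((1 - \<delta>)\<^sup>2 * (fsq A' * fsq B')) \<le> sqrt (fsq (X' * A * minv Y') * fsq (Y' * B * minv X'))"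
    by (rule real_sqrt_le_mono)
  then have "(1 - \<delta>) * kappaF A' B' \<le> kappaF (X' * A * minv Y') (Y' * B * minv X')"
    using \<delta> by (simp add: kappaF_def frob_eq real_sqrt_mult)
  then show "(1 - \<delta>) * kappaF (X * A * minv Y) (Y * B * minv X) \<le>
      kappaF (fst g * A * minv (snd g)) (snd g * B * minv (fst g))"
    by (simp add: g_eq A'_def B'_def)
qed

lemma pexp_mem:
  assumes "H \<in> iLieK m n G" "g \<in> G"
  shows "pexp t H g \<in> G"
  using assms mult[of _ _ "fst g" "snd g"] by (auto simp: pexp_def iLieK_def)

lemma gd_iter_mem:
  assumes A: "A \<in> carrier_mat m n" and B: "B \<in> carrier_mat n m" and pos: "fsq A > 0" "fsq B > 0"
  shows "gd_iter m n G A B \<eta> k \<in> G"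
proof (induction k)
  case (Suc k)
  obtain X Y where g: "gd_iter m n G A B \<eta> k = (X, Y)" by (cases "gd_iter m n G A B \<eta> k")
  then have XY: "(X, Y) \<in> G" using Suc by simp
  then have "X \<in> GL m" "Y \<in> GL n" using GL by auto
  then have "moment R1 R2 (X * A * minv Y) (Y * B * minv X) \<in> iLieK m n G"
    by (intro moment_mem orbit_carrier A B)
  then show ?case using XY by (simp add: g Let_def grad_costAB[OF XY A B pos] pexp_mem)
qed (simp add: one)

lemma gd_step:
  assumes A: "A \<in> carrier_mat m n" and B: "B \<in> carrier_mat n m" and pos: "fsq A > 0" "fsq B > 0"
    and star: "kappa_star G A B > 0" and \<epsilon>: "0 < \<epsilon>" "\<epsilon> < 1/2" and m: "0 < m" "0 < n"
  defines "f \<equiv> \<lambda>k. costAB A B (gd_iter m n G A B (1/8) k)"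
  shows "f (Suc k) \<le> f k"
    "\<epsilon> \<le> f k - ln (kappa_star G A B) \<Longrightarrow> f (Suc k) \<le> f k - \<epsilon>\<^sup>2 / (256 * max (real m ^ 3) (real n ^ 3))"
proof -
  obtain X Y where g: "gd_iter m n G A B (1/8) k = (X, Y)" by (cases "gd_iter m n G A B (1/8) k")
  have XY: "(X, Y) \<in> G" using gd_iter_mem[OF A B pos, of "1/8" k] g by simp
  then have X: "X \<in> GL m" and Y: "Y \<in> GL n" using GL by auto
  define M where "M = moment R1 R2 (X * A * minv Y) (Y * B * minv X)"
  have M0: "0 \<le> ip M M" by (simp add: ip_self fsq_nonneg)
  have fS: "f (Suc k) \<le> f k - ip M M / 32"
    using descent[OF XY A B pos] by (simp add: f_def g Let_def grad_costAB[OF XY A B pos] M_def)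
  then show "f (Suc k) \<le> f k" using M0 by linarith
  define Q where "Q = max (real m ^ 3) (real n ^ 3)"
  \<comment> \<open>The factor 8 from the cube of 2 max(m, n) and the factor 32 from
    \<open>descent\<close> make up the constant 256.\<close>
  have Q: "0 < Q" "real (m + n) ^ 3 \<le> 8 * Q"
  proof -
    show "0 < Q" using m by (simp add: Q_def less_max_iff_disj)
    have "real (m + n) ^ 3 \<le> (2 * max (real m) (real n)) ^ 3" by (intro power_mono) auto
    also have "\<dots> = 8 * max (real m) (real n) ^ 3" by (simp add: power_mult_distrib)
    also have "max (real m) (real n) ^ 3 = Q" by (simp add: Q_def max_def)
    finally show "real (m + n) ^ 3 \<le> 8 * Q" .
  qed
  assume gap: "\<epsilon> \<le> f k - ln (kappa_star G A B)"
  \<comment> \<open>Otherwise \<open>gap_le\<close> with \<delta> = \<epsilon> / 2 and the gap would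
    give 1 - \<epsilon> / 2 <= exp(-\<epsilon>). But exp(-\<epsilon>) is at most 1 - \<epsilon> +
    (3/4) \<epsilon>^2, which is smaller for 0 < \<epsilon> < 2/3.\<close>
  have "\<epsilon>\<^sup>2 < real (m + n) ^ 3 * ip M M"
  proof (rule ccontr)
    assume "\<not> ?thesis"
    then have small: "real (m + n) ^ 3 * ip M M \<le> 4 * (\<epsilon> / 2)\<^sup>2" by (simp add: power_divide)
    define \<kappa> where "\<kappa> = kappaF (X * A * minv Y) (Y * B * minv X)"
    have "(1 - \<epsilon> / 2) * \<kappa> \<le> kappa_star G A B"
      unfolding \<kappa>_def by (rule gap_le[OF A B pos XY m(1)]) (use \<epsilon> small in \<open>auto simp: M_def\<close>)
    moreover have \<kappa>: "0 < \<kappa>" using star kappa_star_le[OF XY, of A B] by (simp add: \<kappa>_def)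
    ultimately have "ln ((1 - \<epsilon> / 2) * \<kappa>) \<le> ln (kappa_star G A B)" using \<epsilon> by (subst ln_le_cancel_iff) (auto simp: star)
    then have "ln (1 - \<epsilon> / 2) + ln \<kappa> \<le> ln (kappa_star G A B)" using \<kappa> \<epsilon> by (simp add: ln_mult)
    moreover have "f k = ln \<kappa>" unfolding f_def g \<kappa>_def by (rule costAB_eq[OF X Y A B pos])
    ultimately have "ln (1 - \<epsilon> / 2) \<le> - \<epsilon>" using gap by linarith
    then have "exp (ln (1 - \<epsilon> / 2)) \<le> exp (- \<epsilon>)" by simp
    then have "1 - \<epsilon> / 2 \<le> exp (- \<epsilon>)" using \<epsilon> by simp
    also have "\<dots> \<le> 1 + - \<epsilon> + 3 / 4 * (- \<epsilon>)\<^sup>2" using \<epsilon> by (intro exp_le_quadratic) simp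
    finally have "\<epsilon> * 1 \<le> \<epsilon> * (3 / 2 * \<epsilon>)" by (simp add: power2_eq_square)
    then have "1 \<le> 3 / 2 * \<epsilon>" using \<epsilon> by (simp only: mult_le_cancel_left_pos)
    then show False using \<epsilon> by simp
  qed
  also have "\<dots> \<le> 8 * Q * ip M M" using Q(2) M0 by (rule mult_right_mono)
  finally have "\<epsilon>\<^sup>2 / (256 * Q) \<le> ip M M / 32" using Q(1) by (simp add: field_simps)
  then show "f (Suc k) \<le> f k - \<epsilon>\<^sup>2 / (256 * max (real m ^ 3) (real n ^ 3))" using fS unfolding Q_def by linarith
qed

text \<open>The cost never increases, so a gap of at least \<epsilon> at time \<open>T\<close> was
  there at all earlier times as well. Each of the \<open>T\<close> steps then gained the fixed
  amount of \<open>gd_step\<close>, which already exhausts the initial gap and leaves nothing at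
  time \<open>T\<close>.\<close>

theorem gd_converges:
  assumes A: "A \<in> carrier_mat m n" "A \<noteq> 0\<^sub>m m n" and B: "B \<in> carrier_mat n m" "B \<noteq> 0\<^sub>m n m"
    and star: "kappa_star G A B > 0" and \<epsilon>: "0 < \<epsilon>" "\<epsilon> < 1/2"
    and T: "real T \<ge> 256 * max (real m ^ 3) (real n ^ 3) * ln (kappaF A B / kappa_star G A B) / \<epsilon>\<^sup>2"
  defines "g \<equiv> gd_iter m n G A B (1/8) T"
  shows "ln (kappaF (fst g * A * minv (snd g)) (snd g * B * minv (fst g))) - ln (kappa_star G A B) < \<epsilon>"
proof (rule ccontr)
  have pos: "fsq A > 0" "fsq B > 0" using fsq_pos A B by auto
  have m: "0 < m" "0 < n"
  proof -
    show "0 < m"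
    proof (rule ccontr)
      assume "\<not> 0 < m"
      then show False using A pos by (simp add: fsq_def)
    qed
    show "0 < n"
    proof (rule ccontr)
      assume "\<not> 0 < n"
      then show False using A pos by (simp add: fsq_def)
    qed
  qed
  define f where "f = (\<lambda>k. costAB A B (gd_iter m n G A B (1/8) k))"
  define s where "s = ln (kappa_star G A B)"
  define Q where "Q = max (real m ^ 3) (real n ^ 3)"
  have Q: "Q > 0" using m by (simp add: Q_def less_max_iff_disj)
  have step: "f (Suc k) \<le> f k" "\<epsilon> \<le> f k - s \<Longrightarrow> f (Suc k) \<le> f k - \<epsilon>\<^sup>2 / (256 * Q)" for k
    unfolding f_def s_def Q_def by (fact gd_step[OF A(1) B(1) pos star \<epsilon> m])+
  obtain X Y where g: "g = (X, Y)" by (cases g)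
  have XY: "(X, Y) \<in> G" using gd_iter_mem[OF A(1) B(1) pos, of "1/8" T] g by (simp add: g_def)
  have fT: "f T = ln (kappaF (fst g * A * minv (snd g)) (snd g * B * minv (fst g)))"
    using costAB_eq(2)[OF _ _ A(1) B(1) pos] GL XY g by (auto simp: f_def g_def)
  assume "\<not> ?thesis"
  then have gap: "\<epsilon> \<le> f T - s" by (simp add: fT s_def)
  have "f T \<le> f k" if "k \<le> T" for k
    using step(1) that by (rule lift_Suc_antimono_le)
  then have gapk: "\<epsilon> \<le> f k - s" if "k \<le> T" for k using gap that by fastforce
  have "f k \<le> f 0 - k * (\<epsilon>\<^sup>2 / (256 * Q))" if "k \<le> T" for k
    using that
  proof (induction k)
    case (Suc k)
    then have "f (Suc k) \<le> f k - \<epsilon>\<^sup>2 / (256 * Q)" using gapk[of k] by (intro step(2)) auto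
    moreover have "real (Suc k) * (\<epsilon>\<^sup>2 / (256 * Q)) = real k * (\<epsilon>\<^sup>2 / (256 * Q)) + \<epsilon>\<^sup>2 / (256 * Q)"
      by (simp add: distrib_right add_divide_distrib)
    ultimately show ?case using Suc by simp
  qed simp
  then have "f T \<le> f 0 - real T * (\<epsilon>\<^sup>2 / (256 * Q))" by blast
  moreover have "f 0 - s \<le> real T * (\<epsilon>\<^sup>2 / (256 * Q))"
  proof -
    have f0: "f 0 = ln (kappaF A B)"
      using costAB_eq(2)[OF GL_one(1) GL_one(1) A(1) B(1) pos] A B by (simp add: f_def)
    have "kappaF A B > 0" using pos by (simp add: kappaF_def frob_eq)
    then have "ln (kappaF A B / kappa_star G A B) = f 0 - s" using star by (simp add: f0 s_def ln_div)
    then have "256 * Q * (f 0 - s) / \<epsilon>\<^sup>2 \<le> real T" using T by (simp add: Q_def)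
    then have "256 * Q * (f 0 - s) / \<epsilon>\<^sup>2 * (\<epsilon>\<^sup>2 / (256 * Q)) \<le> real T * (\<epsilon>\<^sup>2 / (256 * Q))"
      using Q by (intro mult_right_mono) auto
    then show ?thesis using Q \<epsilon> by simp
  qed
  ultimately show False using gap \<epsilon> by linarith
qed

end

text \<open>Case (ii) is expressed by a trivial second factor. If the infimum is 0, the required
  number of steps is infinite on paper, whereas division by 0 gives 0 in HOL; the premise that
  \<open>kappa_star\<close> is positive records the intended reading.\<close>

theorem mainTheorem5:
  "\<exists>c::real. c > 0 \<and>
    (\<forall>(m::nat) (n::nat) (G::(cmat \<times> cmat) set) (A::cmat) (B::cmat) (\<epsilon>::real) (T::nat).
       ((symmetric_subgroup2 m n G \<and> torus m \<times> torus n \<subseteq> G) \<or>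
        (\<exists>G0. symmetric_subgroup1 m G0 \<and> torus m \<subseteq> G0 \<and> G = G0 \<times> {1\<^sub>m n})) \<longrightarrow>
       A \<in> carrier_mat m n \<longrightarrow> A \<noteq> 0\<^sub>m m n \<longrightarrow>
       B \<in> carrier_mat n m \<longrightarrow> B \<noteq> 0\<^sub>m n m \<longrightarrow>
       kappa_star G A B > 0 \<longrightarrow>
       0 < \<epsilon> \<longrightarrow> \<epsilon> < 1/2 \<longrightarrow>
       real T \<ge> c * max (real m ^ 3) (real n ^ 3) * ln (kappaF A B / kappa_star G A B) / \<epsilon>^2 \<longrightarrow>
       (let g = gd_iter m n G A B (1/8) T in
          ln (kappaF (fst g * A * minv (snd g)) (snd g * B * minv (fst g)))
            - ln (kappa_star G A B) < \<epsilon>))"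
proof (intro exI[of _ 256] conjI allI impI)
  fix m n :: nat and G :: "(cmat \<times> cmat) set" and A B :: cmat and \<epsilon> :: real and T :: nat
  assume G: "(symmetric_subgroup2 m n G \<and> torus m \<times> torus n \<subseteq> G) \<or>
      (\<exists>G0. symmetric_subgroup1 m G0 \<and> torus m \<subseteq> G0 \<and> G = G0 \<times> {1\<^sub>m n})"
    and *: "A \<in> carrier_mat m n" "A \<noteq> 0\<^sub>m m n" "B \<in> carrier_mat n m" "B \<noteq> 0\<^sub>m n m"
      "kappa_star G A B > 0" "0 < \<epsilon>" "\<epsilon> < 1/2"
      "real T \<ge> 256 * max (real m ^ 3) (real n ^ 3) * ln (kappaF A B / kappa_star G A B) / \<epsilon>^2"
  obtain R1 R2 where "scaling_group m n G R1 R2"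
    using G scaling_group_pair scaling_group_left by metis
  then interpret scaling_group m n G R1 R2 .
  show "let g = gd_iter m n G A B (1/8) T in
      ln (kappaF (fst g * A * minv (snd g)) (snd g * B * minv (fst g))) - ln (kappa_star G A B) < \<epsilon>"
    unfolding Let_def by (rule gd_converges[OF *])
qed simp

end
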